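(* Let $E$ be a locally convex Hausdorff space over $\mathbb{K}$ and let $\mathcal{V}^{0}=(\nu_{j,0})_{j\in J}$ be a family of weights on a locally compact Hausdorff space $\Omega$ which is locally bounded and locally bounded away from zero on $\Omega$. Then the following statements hold. (a) $\mathcal{C}^{0}_{c}(\Omega)\otimes E$ is dense in $\mathcal{CV}^{0}_{0}(\Omega,E)$. (b) For any $f\in\mathcal{C}^{0}_{c}(\Omega,E)$ and any open neighbourhood $V$ of $\operatorname{supp}f$, for every $\varepsilon>0$, $j\in J$ and $\alpha\in\mathfrak{A}$, there is $g\in\mathcal{C}^{0}_{c}(\Omega)\otimes E$ such that $\operatorname{supp}g\subset V$ and $|f-g|_{j,0,\alpha}\leq\varepsilon$. (c) If $E$ is complete, then $$\mathcal{CV}^{0}_{0}(\Omega,E)\cong\mathcal{CV}^{0}_{0}(\Omega)\,\varepsilon\, E\cong\mathcal{CV}^{0}_{0}(\Omega)\,\widehat{\otimes}_{\varepsilon}\, E.$$ (d) $\mathcal{CV}^{0}_{0}(\Omega)$ has the approximation property.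
   Context: Conventions. $\mathbb{K}=\mathbb{R}$ or $\mathbb{C}$. $E$ is always a non-trivial locally convex Hausdorff space (lcHs) over $\mathbb{K}$ with a directed fundamental system of seminorms $(p_\alpha)_{\alpha\in\mathfrak{A}}$ (for $E=\mathbb{K}$ this is $\{|\cdot|\}$). $X\cong Y$ means that $X$ and $Y$ are linearly and topologically isomorphic. $\mathcal{C}^0(\Omega,E)$ is the space of continuous functions $\Omega\to E$, $\mathcal{C}^0_c(\Omega,E)$ its subspace of functions with compact support; $\mathcal{C}^0_c(\Omega):=\mathcal{C}^0_c(\Omega,\mathbb{K})$. Weights. A (directed) family of weights $\mathcal{V}^0=(\nu_{j,0})_{j\in J}$ on $\Omega$ is a family of functions $\nu_{j,0}\colon\Omega\to[0,\infty)$ such that (i) for all $j_1,j_2\in J$ there are $j_3\in J$ and $C>0$ with $\nu_{j_i,0}\le C\nu_{j_3,0}$ for $i=1,2$; (ii) for every $x\in\Omega$ there is $j\in J$ with $\nu_{j,0}(x)>0$. It is locally bounded on $\Omega$ if $\sup_{x\in K}\nu_{j,0}(x)<\infty$ for all compact $K\subset\Omega$ and $j\in J$. It is locally bounded away from zero on $\Omega$ if for every compact $K\subset\Omega$ there is $j\in J$ with $\inf_{x\in K}\nu_{j,0}(x)>0$. Weighted spaces. $\mathcal{CV}^0(\Omega,E)$ is the space of all $f\in\mathcal{C}^0(\Omega,E)$ with $|f|_{j,0,\alpha}:=\sup_{x\in\Omega}p_\alpha(f(x))\nu_{j,0}(x)<\infty$ for all $j\in J$, $\alpha\in\mathfrak{A}$,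 with the locally convex topology given by these seminorms. $\mathcal{CV}^0_0(\Omega,E)$ is its topological subspace of those $f$ such that for all $j\in J$, $\alpha\in\mathfrak{A}$ and $\varepsilon>0$ there is a compact $K\subset\Omega$ with $\sup_{x\in\Omega\setminus K}p_\alpha(f(x))\nu_{j,0}(x)<\varepsilon$. $\mathcal{CV}^0_0(\Omega):=\mathcal{CV}^0_0(\Omega,\mathbb{K})$. Local boundedness gives $\mathcal{C}^0_c(\Omega,E)\subset\mathcal{CV}^0_0(\Omega,E)$. Tensor products. For lcHs $F,E$: $F\,\varepsilon\,E:=L_e(F'_\kappa,E)$, the space of continuous linear maps $F'_\kappa\to E$, where $F'_\kappa$ is the dual $F'$ with the topology of uniform convergence on absolutely convex compact subsets of $F$, and the space carries the topology of uniform convergence on equicontinuous subsets of $F'$. $F\otimes_\varepsilon E$ is $F\otimes E$ with the topology induced by the linear injection $F\otimes E\to F\,\varepsilon\,E$, $\sum f_n\otimes e_n\mapsto[y\mapsto\sum y(f_n)e_n]$, and $F\,\widehat\otimes_\varepsilon E$ is its completion. A tensor $\sum_n f_n\otimes e_n\in\mathcal{C}^0_c(\Omega)\otimes E$ is identified with the function $x\mapsto\sum_n f_n(x)e_n$, so $\mathcal{C}^0_c(\Omega)\otimes E$ is regarded as a subspace of $\mathcal{CV}^0_0(\Omega,E)$. An lcHs $X$ has the approximation property if the identity of $X$ lies in the closure of the finite rank continuous linear operators $X\to X$ in the space $L_\kappa(X)$ of continuous linear operators $X\to X$ with the topology of uniform convergence on absolutely convex compact subsets of $X$. *)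

theory Defs
  imports "HOL-Analysis.Analysis" "HOL-Library.Function_Algebras"
begin

text \<open>The scalar field: exactly the fields isometrically isomorphic to the reals or the complex
  numbers, so that one statement covers both cases.\<close>

class real_or_complex = real_normed_field +
  assumes real_or_complex:
    "(\<exists>\<phi> :: 'a \<Rightarrow> real. bij \<phi> \<and> (\<forall>x y. \<phi> (x + y) = \<phi> x + \<phi> y) \<and>
        (\<forall>x y. \<phi> (x * y) = \<phi> x * \<phi> y) \<and> (\<forall>x. norm (\<phi> x) = norm x)) \<or>
     (\<exists>\<phi> :: 'a \<Rightarrow> complex. bij \<phi> \<and> (\<forall>x y. \<phi> (x + y) = \<phi> x + \<phi> y) \<and>
        (\<forall>x y. \<phi> (x * y) = \<phi> x * \<phi> y) \<and> (\<forall>x. norm (\<phi> x) = norm x))"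

instance real :: real_or_complex
  by standard (rule disjI1, rule exI[of _ id], simp)

instance complex :: real_or_complex
  by standard (rule disjI2, rule exI[of _ id], simp)


section \<open>Topological vector spaces\<close>

text \<open>A space is carried by a linear subspace of an ambient vector space; its underlying set is the
  topological space of the second component. This is what allows spaces of functions and of
  operators to be treated on the same footing as the given space.\<close>

record ('k, 'v) tvs =
  scl :: "'k \<Rightarrow> 'v \<Rightarrow> 'v"
  vtop :: "'v topology"

definition vsp :: "('k, 'v) tvs \<Rightarrow> 'v set" where
  "vsp X = topspace (vtop X)"

text \<open>The translation invariant topology on \<open>S\<close> for which the finite intersections of members of
  \<open>B\<close> are a base of neighbourhoods of zero. The members of \<open>B\<close> need not be open.\<close>

definition zero_nbhd_topology :: "'v::ab_group_add set \<Rightarrow> 'v set set \<Rightarrow> 'v topology" where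
  "zero_nbhd_topology S B = topology (\<lambda>U. U \<subseteq> S \<and>
     (\<forall>x\<in>U. \<exists>\<F>. finite \<F> \<and> \<F> \<subseteq> B \<and> (\<forall>y\<in>S. y - x \<in> \<Inter>\<F> \<longrightarrow> y \<in> U)))"

lemma openin_zero_nbhd_topology:
  "openin (zero_nbhd_topology S B) U \<longleftrightarrow> U \<subseteq> S \<and>
     (\<forall>x\<in>U. \<exists>\<F>. finite \<F> \<and> \<F> \<subseteq> B \<and> (\<forall>y\<in>S. y - x \<in> \<Inter>\<F> \<longrightarrow> y \<in> U))"
proof -
  let ?L = "\<lambda>U. U \<subseteq> S \<and>
     (\<forall>x\<in>U. \<exists>\<F>. finite \<F> \<and> \<F> \<subseteq> B \<and> (\<forall>y\<in>S. y - x \<in> \<Inter>\<F> \<longrightarrow> y \<in> U))"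
  have "istopology ?L"
    unfolding istopology_def
  proof (intro conjI allI impI ballI)
    fix U V assume U: "?L U" and V: "?L V"
    show "U \<inter> V \<subseteq> S" using U by blast
    fix x assume x: "x \<in> U \<inter> V"
    obtain F where F: "finite F" "F \<subseteq> B" "\<forall>y\<in>S. y - x \<in> \<Inter>F \<longrightarrow> y \<in> U"
      using U x by blast
    obtain G where G: "finite G" "G \<subseteq> B" "\<forall>y\<in>S. y - x \<in> \<Inter>G \<longrightarrow> y \<in> V"
      using V x by blast
    show "\<exists>\<F>. finite \<F> \<and> \<F> \<subseteq> B \<and> (\<forall>y\<in>S. y - x \<in> \<Inter>\<F> \<longrightarrow> y \<in> U \<inter> V)"
      using F G by (intro exI[of _ "F \<union> G"]) auto
  next
    fix \<K> assume K: "\<forall>U\<in>\<K>. ?L U"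
    show "\<Union>\<K> \<subseteq> S" using K by blast
    fix x assume "x \<in> \<Union>\<K>"
    then obtain U where U: "U \<in> \<K>" "x \<in> U" by blast
    then obtain F where "finite F" "F \<subseteq> B" "\<forall>y\<in>S. y - x \<in> \<Inter>F \<longrightarrow> y \<in> U"
      using bspec[OF K U(1)] by meson
    then show "\<exists>\<F>. finite \<F> \<and> \<F> \<subseteq> B \<and> (\<forall>y\<in>S. y - x \<in> \<Inter>\<F> \<longrightarrow> y \<in> \<Union>\<K>)"
      using U(1) by (intro exI[of _ F] conjI ballI impI) (auto intro: UnionI)
  qed
  then show ?thesis
    unfolding zero_nbhd_topology_def by (simp add: topology_inverse')
qed

lemma topspace_zero_nbhd_topology [simp]: "topspace (zero_nbhd_topology S B) = S"
proof
  show "topspace (zero_nbhd_topology S B) \<subseteq> S"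
    using openin_topspace[of "zero_nbhd_topology S B"]
    unfolding openin_zero_nbhd_topology by blast
  have "openin (zero_nbhd_topology S B) S"
    unfolding openin_zero_nbhd_topology by blast
  then show "S \<subseteq> topspace (zero_nbhd_topology S B)"
    by (rule openin_subset)
qed

definition seminorm_topology :: "'v::ab_group_add set \<Rightarrow> ('v \<Rightarrow> real) set \<Rightarrow> 'v topology" where
  "seminorm_topology S P = zero_nbhd_topology S {{v \<in> S. p v < r} | p r. p \<in> P \<and> 0 < r}"

definition seminorm_on :: "('k::real_or_complex, 'v::ab_group_add) tvs \<Rightarrow> ('v \<Rightarrow> real) \<Rightarrow> bool" where
  "seminorm_on X p \<longleftrightarrow>
     (\<forall>v\<in>vsp X. 0 \<le> p v) \<and>
     (\<forall>v\<in>vsp X. \<forall>w\<in>vsp X. p (v + w) \<le> p v + p w) \<and>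
     (\<forall>c. \<forall>v\<in>vsp X. p (scl X c v) = norm c * p v)"

definition lcHs :: "('k::real_or_complex, 'v::ab_group_add) tvs \<Rightarrow> bool" where
  "lcHs X \<longleftrightarrow> vector_space (scl X) \<and> module.subspace (scl X) (vsp X) \<and>
     Hausdorff_space (vtop X) \<and>
     (\<exists>P. (\<forall>p\<in>P. seminorm_on X p) \<and> vtop X = seminorm_topology (vsp X) P)"

definition fundamental_seminorms ::
  "('k::real_or_complex, 'v::ab_group_add) tvs \<Rightarrow> 'a set \<Rightarrow> ('a \<Rightarrow> 'v \<Rightarrow> real) \<Rightarrow> bool" where
  "fundamental_seminorms X A p \<longleftrightarrow>
     A \<noteq> {} \<and> (\<forall>\<alpha>\<in>A. seminorm_on X (p \<alpha>)) \<and>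
     (\<forall>\<alpha>\<in>A. \<forall>\<beta>\<in>A. \<exists>\<gamma>\<in>A. \<exists>C>0. \<forall>v\<in>vsp X. p \<alpha> v \<le> C * p \<gamma> v \<and> p \<beta> v \<le> C * p \<gamma> v) \<and>
     vtop X = seminorm_topology (vsp X) (p ` A)"

definition scalars :: "('k::real_or_complex, 'k) tvs" where
  "scalars = \<lparr>scl = (*), vtop = euclidean\<rparr>"

definition linear_on ::
  "('k, 'v::ab_group_add) tvs \<Rightarrow> ('k, 'w::ab_group_add) tvs \<Rightarrow> ('v \<Rightarrow> 'w) \<Rightarrow> bool" where
  "linear_on X Y T \<longleftrightarrow>
     (\<forall>v\<in>vsp X. \<forall>w\<in>vsp X. T (v + w) = T v + T w) \<and>
     (\<forall>c. \<forall>v\<in>vsp X. T (scl X c v) = scl Y c (T v))"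

definition tvs_isomorphic ::
  "('k, 'v::ab_group_add) tvs \<Rightarrow> ('k, 'w::ab_group_add) tvs \<Rightarrow> bool" (infix "\<cong>\<^sub>t" 50) where
  "X \<cong>\<^sub>t Y \<longleftrightarrow> (\<exists>T. linear_on X Y T \<and> homeomorphic_map (vtop X) (vtop Y) T)"

definition subspace_tvs :: "('k, 'v) tvs \<Rightarrow> 'v set \<Rightarrow> ('k, 'v) tvs" where
  "subspace_tvs X S = \<lparr>scl = scl X, vtop = subtopology (vtop X) S\<rparr>"

definition cauchy_filter_on :: "('k, 'v::ab_group_add) tvs \<Rightarrow> 'v filter \<Rightarrow> bool" where
  "cauchy_filter_on X \<F> \<longleftrightarrow> \<F> \<noteq> bot \<and> eventually (\<lambda>v. v \<in> vsp X) \<F> \<and>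
     (\<forall>U. openin (vtop X) U \<and> 0 \<in> U \<longrightarrow> eventually (\<lambda>(v, w). v - w \<in> U) (\<F> \<times>\<^sub>F \<F>))"

definition complete_tvs :: "('k, 'v::ab_group_add) tvs \<Rightarrow> bool" where
  "complete_tvs X \<longleftrightarrow> (\<forall>\<F>. cauchy_filter_on X \<F> \<longrightarrow> (\<exists>l. limitin (vtop X) (\<lambda>v. v) l \<F>))"

definition is_completion ::
  "('k::real_or_complex, 'v::ab_group_add) tvs \<Rightarrow> ('k, 'w::ab_group_add) tvs \<Rightarrow> ('v \<Rightarrow> 'w) \<Rightarrow> bool"
  where
  "is_completion X Y i \<longleftrightarrow> lcHs Y \<and> complete_tvs Y \<and> linear_on X Y i \<and>
     embedding_map (vtop X) (vtop Y) i \<and> vtop Y closure_of (i ` vsp X) = vsp Y"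


section \<open>Spaces of continuous linear maps\<close>

text \<open>Maps out of \<open>X\<close> are extended by zero outside \<open>vsp X\<close>, so that equality of maps is equality on
  \<open>vsp X\<close>.\<close>

definition cont_lin ::
  "('k, 'v::ab_group_add) tvs \<Rightarrow> ('k, 'w::ab_group_add) tvs \<Rightarrow> ('v \<Rightarrow> 'w) set" where
  "cont_lin X Y = {u. linear_on X Y u \<and> continuous_map (vtop X) (vtop Y) u \<and>
                      (\<forall>v. v \<notin> vsp X \<longrightarrow> u v = 0)}"

text \<open>The continuous linear maps with the topology of uniform convergence on the members of
  \<open>\<SS>\<close>.\<close>

definition cont_lin_tvs ::
  "('k, 'v::ab_group_add) tvs \<Rightarrow> ('k, 'w::ab_group_add) tvs \<Rightarrow> 'v set set \<Rightarrow> ('k, 'v \<Rightarrow> 'w) tvs"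
  where
  "cont_lin_tvs X Y \<SS> = \<lparr>scl = (\<lambda>c u v. scl Y c (u v)),
     vtop = zero_nbhd_topology (cont_lin X Y)
       {{u \<in> cont_lin X Y. \<forall>v\<in>M. u v \<in> V} | M V. M \<in> \<SS> \<and> openin (vtop Y) V \<and> 0 \<in> V}\<rparr>"

definition abs_convex :: "('k::real_or_complex, 'v::ab_group_add) tvs \<Rightarrow> 'v set \<Rightarrow> bool" where
  "abs_convex X M \<longleftrightarrow> M \<subseteq> vsp X \<and>
     (\<forall>v\<in>M. \<forall>w\<in>M. \<forall>a b. norm a + norm b \<le> 1 \<longrightarrow> scl X a v + scl X b w \<in> M)"

definition abs_convex_compacts ::
  "('k::real_or_complex, 'v::ab_group_add) tvs \<Rightarrow> 'v set set" where
  "abs_convex_compacts X = {M. abs_convex X M \<and> compactin (vtop X) M}"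

definition dual :: "('k::real_or_complex, 'v::ab_group_add) tvs \<Rightarrow> ('v \<Rightarrow> 'k) set" where
  "dual X = cont_lin X scalars"

definition dual_kappa ::
  "('k::real_or_complex, 'v::ab_group_add) tvs \<Rightarrow> ('k, 'v \<Rightarrow> 'k) tvs" where
  "dual_kappa X = cont_lin_tvs X scalars (abs_convex_compacts X)"

definition equicontinuous_sets ::
  "('k::real_or_complex, 'v::ab_group_add) tvs \<Rightarrow> ('v \<Rightarrow> 'k) set set" where
  "equicontinuous_sets X = {H. H \<subseteq> dual X \<and>
     (\<forall>v\<in>vsp X. \<forall>\<epsilon>>0. \<exists>U. openin (vtop X) U \<and> v \<in> U \<and>
        (\<forall>w\<in>U. \<forall>y\<in>H. norm (y w - y v) < \<epsilon>))}"

definition eps_product ::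
  "('k::real_or_complex, 'v::ab_group_add) tvs \<Rightarrow> ('k, 'w::ab_group_add) tvs \<Rightarrow>
   ('k, ('v \<Rightarrow> 'k) \<Rightarrow> 'w) tvs" (infixr "\<epsilon>\<^sub>t" 70) where
  "F \<epsilon>\<^sub>t E = cont_lin_tvs (dual_kappa F) E (equicontinuous_sets F)"

text \<open>The algebraic tensor product is identified with its image under the linear injection into
  the \<open>\<epsilon>\<close>-product that sends \<open>\<Sum>\<^sub>n f\<^sub>n \<otimes> e\<^sub>n\<close> to \<open>y \<mapsto> \<Sum>\<^sub>n y(f\<^sub>n) e\<^sub>n\<close>; its topology is the induced one.\<close>

definition tensor_operators ::
  "('k::real_or_complex, 'v::ab_group_add) tvs \<Rightarrow> ('k, 'w::ab_group_add) tvs \<Rightarrow>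
   (('v \<Rightarrow> 'k) \<Rightarrow> 'w) set" where
  "tensor_operators F E =
     {(\<lambda>y. if y \<in> dual F then \<Sum>n<N. scl E (y (f n)) (e n) else 0) | (N::nat) f e.
        (\<forall>n<N. f n \<in> vsp F) \<and> (\<forall>n<N. e n \<in> vsp E)}"

definition eps_tensor ::
  "('k::real_or_complex, 'v::ab_group_add) tvs \<Rightarrow> ('k, 'w::ab_group_add) tvs \<Rightarrow>
   ('k, ('v \<Rightarrow> 'k) \<Rightarrow> 'w) tvs" (infixr "\<otimes>\<^sub>\<epsilon>" 70) where
  "F \<otimes>\<^sub>\<epsilon> E = subspace_tvs (F \<epsilon>\<^sub>t E) (tensor_operators F E)"

definition finite_rank :: "('k::real_or_complex, 'v::ab_group_add) tvs \<Rightarrow> ('v \<Rightarrow> 'v) set" where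
  "finite_rank X = {u \<in> cont_lin X X. \<exists>B. finite B \<and> u ` vsp X \<subseteq> module.span (scl X) B}"

definition approximation_property ::
  "('k::real_or_complex, 'v::ab_group_add) tvs \<Rightarrow> bool" where
  "approximation_property X \<longleftrightarrow>
     (\<lambda>v. if v \<in> vsp X then v else 0) \<in>
       vtop (cont_lin_tvs X X (abs_convex_compacts X)) closure_of finite_rank X"


section \<open>Weighted spaces of continuous functions\<close>

text \<open>Suprema of nonnegative quantities are taken in the extended nonnegative reals, where the
  supremum over the empty set is zero and that of an unbounded set is infinite.\<close>

definition weight_family :: "'j set \<Rightarrow> ('j \<Rightarrow> 'x \<Rightarrow> real) \<Rightarrow> bool" where
  "weight_family J \<nu> \<longleftrightarrow>
     (\<forall>j\<in>J. \<forall>x. 0 \<le> \<nu> j x) \<and>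
     (\<forall>j1\<in>J. \<forall>j2\<in>J. \<exists>j3\<in>J. \<exists>C>0. \<forall>x. \<nu> j1 x \<le> C * \<nu> j3 x \<and> \<nu> j2 x \<le> C * \<nu> j3 x) \<and>
     (\<forall>x. \<exists>j\<in>J. 0 < \<nu> j x)"

definition locally_bounded_weights ::
  "'j set \<Rightarrow> ('j \<Rightarrow> 'x::topological_space \<Rightarrow> real) \<Rightarrow> bool" where
  "locally_bounded_weights J \<nu> \<longleftrightarrow>
     (\<forall>K. compact K \<longrightarrow> (\<forall>j\<in>J. (SUP x\<in>K. ennreal (\<nu> j x)) < \<infinity>))"

definition locally_bounded_away_from_zero ::
  "'j set \<Rightarrow> ('j \<Rightarrow> 'x::topological_space \<Rightarrow> real) \<Rightarrow> bool" where
  "locally_bounded_away_from_zero J \<nu> \<longleftrightarrow>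
     (\<forall>K. compact K \<longrightarrow> (\<exists>j\<in>J. (INF x\<in>K. ennreal (\<nu> j x)) > 0))"

definition wsup :: "'x set \<Rightarrow> ('x \<Rightarrow> real) \<Rightarrow> ('v \<Rightarrow> real) \<Rightarrow> ('x \<Rightarrow> 'v) \<Rightarrow> ennreal" where
  "wsup M w q f = (SUP x\<in>M. ennreal (q (f x) * w x))"

definition supp :: "('x::topological_space \<Rightarrow> 'v::zero) \<Rightarrow> 'x set" where
  "supp f = closure {x. f x \<noteq> 0}"

definition Cc :: "('k, 'v::zero) tvs \<Rightarrow> ('x::topological_space \<Rightarrow> 'v) set" where
  "Cc E = {f. continuous_map euclidean (vtop E) f \<and> compact (supp f)}"

definition CV ::
  "'j set \<Rightarrow> ('j \<Rightarrow> 'x::topological_space \<Rightarrow> real) \<Rightarrow> ('k, 'v::ab_group_add) tvs \<Rightarrow>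
   'a set \<Rightarrow> ('a \<Rightarrow> 'v \<Rightarrow> real) \<Rightarrow> ('k, 'x \<Rightarrow> 'v) tvs" where
  "CV J \<nu> E A p = \<lparr>scl = (\<lambda>c f x. scl E c (f x)),
     vtop = seminorm_topology
       {f. continuous_map euclidean (vtop E) f \<and>
           (\<forall>j\<in>J. \<forall>\<alpha>\<in>A. wsup UNIV (\<nu> j) (p \<alpha>) f < \<infinity>)}
       {\<lambda>f. enn2real (wsup UNIV (\<nu> j) (p \<alpha>) f) | j \<alpha>. j \<in> J \<and> \<alpha> \<in> A}\<rparr>"

definition CV0 ::
  "'j set \<Rightarrow> ('j \<Rightarrow> 'x::topological_space \<Rightarrow> real) \<Rightarrow> ('k, 'v::ab_group_add) tvs \<Rightarrow>
   'a set \<Rightarrow> ('a \<Rightarrow> 'v \<Rightarrow> real) \<Rightarrow> ('k, 'x \<Rightarrow> 'v) tvs" where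
  "CV0 J \<nu> E A p = subspace_tvs (CV J \<nu> E A p)
     {f \<in> vsp (CV J \<nu> E A p). \<forall>j\<in>J. \<forall>\<alpha>\<in>A. \<forall>\<epsilon>>0.
        \<exists>K. compact K \<and> wsup (- K) (\<nu> j) (p \<alpha>) f < ennreal \<epsilon>}"

definition CV0_scalar ::
  "'j set \<Rightarrow> ('j \<Rightarrow> 'x::topological_space \<Rightarrow> real) \<Rightarrow> ('k::real_or_complex, 'x \<Rightarrow> 'k) tvs" where
  "CV0_scalar J \<nu> = CV0 J \<nu> scalars {()} (\<lambda>_. norm)"

text \<open>Tensors of scalar functions in \<open>G\<close> with vectors in \<open>E\<close>, regarded as functions
  \<open>x \<mapsto> \<Sum>\<^sub>n f\<^sub>n(x) e\<^sub>n\<close>.\<close>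

definition function_tensor ::
  "('x \<Rightarrow> 'k) set \<Rightarrow> ('k, 'v::ab_group_add) tvs \<Rightarrow> ('x \<Rightarrow> 'v) set" where
  "function_tensor G E =
     {(\<lambda>x. \<Sum>n<N. scl E (f n x) (e n)) | (N::nat) f e.
        (\<forall>n<N. f n \<in> G) \<and> (\<forall>n<N. e n \<in> vsp E)}"

end

theory Submission
  imports Defs
begin

text \<open>Everything rests on one approximation of the identity. On a compact set \<open>M\<close> of functions vanishing at
  infinity in the weighted sense, the operators \<open>h \<mapsto> \<Sum>\<^sub>z \<phi>\<^sub>z h(z)\<close>, formed with a finite partition of unity \<open>\<phi>\<close> on a
  large compact set, are uniformly close to the identity, because \<open>M\<close> vanishes uniformly at infinity
  and is equicontinuous (this is where the weights must be locally bounded away from zero). For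
  singletons \<open>M\<close> this gives the density statements, for general \<open>M\<close> the approximation property of
  the scalar space \<open>F\<close>, and, by transposition, the density of \<open>F \<otimes> E\<close> in \<open>F \<epsilon> E\<close>.

  The isomorphism with the \<open>\<epsilon>\<close>-product sends \<open>u\<close> to \<open>x \<mapsto> u(\<delta>\<^sub>x)\<close>. The approximation yields
  \<open>l(u(y)) = y(l \<circ> u(\<delta>))\<close> for functionals \<open>l\<close> on \<open>E\<close>; with the Hahn--Banach theorem this identifies the two
  systems of seminorms. For surjectivity, given \<open>f\<close>, the value \<open>u(y)\<close> is the element \<open>e\<close> with
  \<open>l(e) = y(l \<circ> f)\<close> for all \<open>l\<close>; approximate solutions exist by the same approximation and form a Cauchy filter, and
  continuity of \<open>u\<close> follows since \<open>{l \<circ> f. \<bar>l\<bar> \<le> p\<^sub>\<alpha>}\<close> is absolutely convex and compact.\<close>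

section \<open>The scalar field\<close>

text \<open>The passage from functions to operators hinges on one reformulation: continuity of u on
  \<open>dual_kappa\<close> at zero means that p \<alpha> (u y) is controlled by the values of y on
  one compact set of functions. A statement about u thus becomes one about a compact set, and the
  partition of unity that approximates its members also approximates u. Functionals of the form l
  \<circ> u are identified concretely in this way, in place of an appeal to the Mackey-Arens
  theorem. In the converse direction the compact set must already be absolutely convex, since the
  topology of the dual is built from such sets and closed convex hulls of compact sets need not be
  compact. The image of a polar under l \<mapsto> l \<circ> f supplies one: absolute convexity is
  inherited from the polar, compactness comes from Tychonoff's theorem. The topology of the
  \<epsilon>-product is given by neighbourhoods of zero and not by seminorms, so its separation and
  completeness are carried over from the function space. A completion is unique only up to
  isomorphism, so every completion is compared with the \<epsilon>-product.\<close>

lemma isometric_hom_of_real: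
  fixes \<phi> :: "'k::real_normed_field \<Rightarrow> complex"
  assumes add: "\<forall>x y. \<phi> (x + y) = \<phi> x + \<phi> y" and mul: "\<forall>x y. \<phi> (x * y) = \<phi> x * \<phi> y"
    and nrm: "\<forall>x. norm (\<phi> x) = norm x"
  shows "\<phi> (of_real r) = of_real r"
proof -
  have "\<phi> 1 * \<phi> 1 = \<phi> 1" using mul[rule_format, of 1 1] by simp
  moreover have "\<phi> 1 \<noteq> 0" using nrm[rule_format, of 1] by auto
  ultimately have 1: "\<phi> 1 = 1" by simp
  have "\<phi> (of_real r - 1) + 1 = \<phi> (of_real r)" using add[rule_format, of "of_real r - 1" 1] 1 by simp
  then have 2: "\<phi> (of_real r) - 1 = \<phi> (of_real r - 1)" by (simp add: algebra_simps)
  let ?z = "\<phi> (of_real r)"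
  \<comment> \<open>The image of r lies on the circle about 0 and on the circle about 1 that pass
    through r; having real centres, they touch only there. This settles real scalars although \<phi>
    is only assumed additive and multiplicative.\<close>
  have a: "norm ?z = \<bar>r\<bar>" using nrm by simp
  have "norm (?z - 1) = norm (of_real (r - 1) :: 'k)" using nrm 2 by simp
  then have b: "norm (?z - 1) = \<bar>r - 1\<bar>" by (simp only: norm_of_real)
  have a2: "(Re ?z)\<^sup>2 + (Im ?z)\<^sup>2 = r\<^sup>2" using cmod_power2[of ?z] a by simp
  have b2: "(Re ?z - 1)\<^sup>2 + (Im ?z)\<^sup>2 = (r - 1)\<^sup>2" using cmod_power2[of "?z - 1"] b by simp
  have "Re ?z = r" using a2 b2 by (simp add: power2_eq_square algebra_simps)
  with a2 show ?thesis by (simp add: complex_eq_iff)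
qed

text \<open>Both alternatives of the type class are merged into one isometric ring embedding into
  the complex numbers; only the range still tells them apart.\<close>

lemma scalar_embedding:
  obtains \<phi> :: "'k::real_or_complex \<Rightarrow> complex"
  where "\<forall>x y. \<phi> (x + y) = \<phi> x + \<phi> y" "\<forall>x y. \<phi> (x * y) = \<phi> x * \<phi> y"
    "\<forall>x. norm (\<phi> x) = norm x" "range \<phi> = range complex_of_real \<or> range \<phi> = UNIV"
proof -
  consider (1) "\<exists>\<phi> :: 'k \<Rightarrow> real. bij \<phi> \<and> (\<forall>x y. \<phi> (x + y) = \<phi> x + \<phi> y) \<and>
        (\<forall>x y. \<phi> (x * y) = \<phi> x * \<phi> y) \<and> (\<forall>x. norm (\<phi> x) = norm x)"
    | (2) "\<exists>\<phi> :: 'k \<Rightarrow> complex. bij \<phi> \<and> (\<forall>x y. \<phi> (x + y) = \<phi> x + \<phi> y) \<and>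
        (\<forall>x y. \<phi> (x * y) = \<phi> x * \<phi> y) \<and> (\<forall>x. norm (\<phi> x) = norm x)"
    using real_or_complex by blast
  then show ?thesis
  proof cases
    case 1
    then obtain \<phi> :: "'k \<Rightarrow> real" where \<phi>: "bij \<phi>" "\<forall>x y. \<phi> (x + y) = \<phi> x + \<phi> y"
        "\<forall>x y. \<phi> (x * y) = \<phi> x * \<phi> y" "\<forall>x. norm (\<phi> x) = norm x" by blast
    have "range (\<lambda>x. complex_of_real (\<phi> x)) = complex_of_real ` range \<phi>" by (rule image_image[symmetric])
    also have "range \<phi> = UNIV" using \<phi>(1) by (rule bij_is_surj)
    finally show ?thesis using \<phi> by (intro that[of "\<lambda>x. of_real (\<phi> x)"]) auto
  next
    case 2
    then obtain \<phi> :: "'k \<Rightarrow> complex" where "bij \<phi>" "\<forall>x y. \<phi> (x + y) = \<phi> x + \<phi> y"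
        "\<forall>x y. \<phi> (x * y) = \<phi> x * \<phi> y" "\<forall>x. norm (\<phi> x) = norm x" by blast
    then show ?thesis by (intro that[of \<phi>]) (auto simp: bij_def)
  qed
qed

text \<open>The element I is the preimage of \<i>. The bound on \<bar>a\<bar> is \<bar>Re z\<bar>
  \<le> \<bar>z\<bar> carried back; the Hahn-Banach proof uses it to compare a functional with its
  real part.\<close>

lemma scalar_decomposition:
  "(\<forall>c::'k::real_or_complex. \<exists>r. c = of_real r) \<or>
   (\<exists>I::'k. I * I = - 1 \<and> (\<forall>c. \<exists>a b. c = of_real a + of_real b * I) \<and>
      (\<forall>a b. \<bar>a\<bar> \<le> norm (of_real a + of_real b * I)))"
proof -
  obtain \<phi> :: "'k \<Rightarrow> complex" where h: "\<forall>x y. \<phi> (x + y) = \<phi> x + \<phi> y"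
    "\<forall>x y. \<phi> (x * y) = \<phi> x * \<phi> y"
    "\<forall>x. norm (\<phi> x) = norm x" "range \<phi> = range complex_of_real \<or> range \<phi> = UNIV"
    by (rule scalar_embedding)
  note r = isometric_hom_of_real[OF h(1-3)]
  have d: "\<phi> (x - y) = \<phi> x - \<phi> y" for x y
    using h(1)[rule_format, of "x - y" y] by simp
  have inj: "x = y" if "\<phi> x = \<phi> y" for x y
    using h(3)[rule_format, of "x - y"] d[of x y] that by simp
  from h(4) show ?thesis
  proof
    assume R: "range \<phi> = range complex_of_real"
    have "\<exists>r. c = of_real r" for c :: 'k
    proof -
      have "\<phi> c \<in> range complex_of_real" unfolding R[symmetric] by (rule rangeI)
      then obtain s where "\<phi> c = of_real s" by blast
      then have "c = of_real s" by (intro inj) (simp add: r)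
      then show ?thesis ..
    qed
    then show ?thesis by blast
  next
    assume U: "range \<phi> = UNIV"
    then obtain I where I: "\<phi> I = \<i>" by (metis UNIV_I rangeE)
    have "\<phi> (I * I) = \<phi> (- 1)" using h(2) I r[of "-1"] by simp
    then have "I * I = -1" by (rule inj)
    moreover have e: "\<phi> (of_real a + of_real b * I) = Complex a b" for a b
      using h(1,2) r I by (simp add: complex_eq_iff)
    moreover have "\<exists>a b. c = of_real a + of_real b * I" for c
      using inj[of c "of_real (Re (\<phi> c)) + of_real (Im (\<phi> c)) * I"] e by (auto simp: complex_eq_iff)
    moreover have "\<bar>a\<bar> \<le> norm (of_real a + of_real b * I)" for a b
    proof -
      have "norm (of_real a + of_real b * I) = cmod (Complex a b)" using h(3)[rule_format, of "of_real a + of_real b * I"] e by simp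
      then show ?thesis using abs_Re_le_cmod[of "Complex a b"] by simp
    qed
    ultimately show ?thesis by blast
  qed
qed

text \<open>The embedding is isometric with closed range, so the ball is the image of a compact set
  under the continuous inverse. Tychonoff's theorem relies on this in
  \<open>compact_polar\<close>.\<close>

lemma compact_cball_scalar: "compact (cball 0 r :: 'k::real_or_complex set)"
proof -
  obtain \<phi> :: "'k \<Rightarrow> complex" where h: "\<forall>x y. \<phi> (x + y) = \<phi> x + \<phi> y"
    "\<forall>x y. \<phi> (x * y) = \<phi> x * \<phi> y"
    "\<forall>x. norm (\<phi> x) = norm x" "range \<phi> = range complex_of_real \<or> range \<phi> = UNIV"
    by (rule scalar_embedding)
  have d: "\<phi> (x - y) = \<phi> x - \<phi> y" for x y
    using h(1)[rule_format, of "x - y" y] by simp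
  have D: "dist (\<phi> x) (\<phi> y) = dist x y" for x y using h(3) by (simp add: dist_norm flip: d)
  then have inj: "inj \<phi>" by (intro injI) (metis dist_eq_0_iff)
  define \<psi> where "\<psi> = inv \<phi>"
  have \<psi>: "\<psi> (\<phi> x) = x" for x unfolding \<psi>_def using inj by simp
  have cl: "closed (range \<phi>)" using h(4)
  proof
    assume "range \<phi> = range complex_of_real"
    moreover have "range complex_of_real = {z. Im z = 0}" by (auto simp: complex_eq_iff image_iff)
    moreover have "closed {z. Im z = 0}" by (intro closed_Collect_eq continuous_intros)
    ultimately show ?thesis by simp
  qed simp
  have "continuous_on (range \<phi>) \<psi>"
    unfolding continuous_on_iff using D \<psi> by auto
  then have c: "continuous_on (cball 0 r \<inter> range \<phi>) \<psi>" by (rule continuous_on_subset) simp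
  have "compact (cball 0 r \<inter> range \<phi>)" using cl by (simp add: compact_Int_closed)
  then have "compact (\<psi> ` (cball 0 r \<inter> range \<phi>))" using c by (rule compact_continuous_image[rotated])
  moreover have "cball 0 r \<inter> range \<phi> = \<phi> ` cball 0 r" using h(3) by auto
  then have "\<psi> ` (cball 0 r \<inter> range \<phi>) = cball 0 r" by (simp add: image_image \<psi>)
  ultimately show ?thesis by simp
qed

section \<open>Spaces with a fundamental system of seminorms\<close>

lemma finite_enumeration:
  assumes "finite I"
  obtains N :: nat and b where "bij_betw b {..<N} I"
  using assms ex_bij_betw_nat_finite[OF assms] by (metis atLeast0LessThan)

text \<open>Separation is kept out of this locale and characterised by \<open>lcHs_iff\<close>, so
  that a weighted space can be handled through its seminorms first and shown to be Hausdorff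
  afterwards.\<close>

locale seminormed_space =
  fixes X :: "('k::real_or_complex, 'v::ab_group_add) tvs" and A :: "'a set"
    and p :: "'a \<Rightarrow> 'v \<Rightarrow> real"
  assumes vector_space_scl: "vector_space (scl X)"
    and subspace_vsp: "module.subspace (scl X) (vsp X)"
    and fundamental: "fundamental_seminorms X A p"
begin

sublocale V: vector_space "scl X" by (rule vector_space_scl)

lemma zero_mem [simp]: "0 \<in> vsp X" using subspace_vsp by (rule V.subspace_0)
lemma add_mem: "v \<in> vsp X \<Longrightarrow> w \<in> vsp X \<Longrightarrow> v + w \<in> vsp X" using subspace_vsp by (rule V.subspace_add)
lemma diff_mem: "v \<in> vsp X \<Longrightarrow> w \<in> vsp X \<Longrightarrow> v - w \<in> vsp X" using subspace_vsp by (rule V.subspace_diff)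
lemma minus_mem: "v \<in> vsp X \<Longrightarrow> - v \<in> vsp X" using subspace_vsp by (rule V.subspace_neg)
lemma scl_mem: "v \<in> vsp X \<Longrightarrow> scl X c v \<in> vsp X" using subspace_vsp by (rule V.subspace_scale)
lemma sum_mem: "(\<And>i. i \<in> I \<Longrightarrow> v i \<in> vsp X) \<Longrightarrow> sum v I \<in> vsp X"
  using subspace_vsp by (rule V.subspace_sum)

lemmas mems = zero_mem add_mem diff_mem minus_mem scl_mem sum_mem

lemma index_nonempty: "A \<noteq> {}" using fundamental by (simp add: fundamental_seminorms_def)
lemma seminorm: "\<alpha> \<in> A \<Longrightarrow> seminorm_on X (p \<alpha>)"
  using fundamental by (simp add: fundamental_seminorms_def)
lemma directed:
  "\<alpha> \<in> A \<Longrightarrow> \<beta> \<in> A \<Longrightarrow> \<exists>\<gamma>\<in>A. \<exists>C>0. \<forall>v\<in>vsp X. p \<alpha> v \<le> C * p \<gamma> v \<and> p \<beta> v \<le> C * p \<gamma> v"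
  using fundamental by (simp add: fundamental_seminorms_def)

lemma p_nonneg: "\<alpha> \<in> A \<Longrightarrow> v \<in> vsp X \<Longrightarrow> 0 \<le> p \<alpha> v" using seminorm by (simp add: seminorm_on_def)
lemma p_add: "\<alpha> \<in> A \<Longrightarrow> v \<in> vsp X \<Longrightarrow> w \<in> vsp X \<Longrightarrow> p \<alpha> (v + w) \<le> p \<alpha> v + p \<alpha> w"
  using seminorm by (simp add: seminorm_on_def)
lemma p_scl: "\<alpha> \<in> A \<Longrightarrow> v \<in> vsp X \<Longrightarrow> p \<alpha> (scl X c v) = norm c * p \<alpha> v"
  using seminorm by (simp add: seminorm_on_def)
lemma p_zero: "\<alpha> \<in> A \<Longrightarrow> p \<alpha> 0 = 0" using p_scl[of \<alpha> 0 0] by simp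
lemma p_minus: "\<alpha> \<in> A \<Longrightarrow> v \<in> vsp X \<Longrightarrow> p \<alpha> (- v) = p \<alpha> v" using p_scl[of \<alpha> v "-1"] by simp
lemma p_commute: "\<alpha> \<in> A \<Longrightarrow> v \<in> vsp X \<Longrightarrow> w \<in> vsp X \<Longrightarrow> p \<alpha> (v - w) = p \<alpha> (w - v)"
  using p_minus[of \<alpha> "v - w"] by (simp add: mems)
lemma p_diff: "\<alpha> \<in> A \<Longrightarrow> v \<in> vsp X \<Longrightarrow> w \<in> vsp X \<Longrightarrow> p \<alpha> (v - w) \<le> p \<alpha> v + p \<alpha> w"
  using p_add[of \<alpha> v "- w"] by (simp add: mems p_minus)
lemma p_triangle:
  "\<alpha> \<in> A \<Longrightarrow> u \<in> vsp X \<Longrightarrow> v \<in> vsp X \<Longrightarrow> w \<in> vsp X \<Longrightarrow> p \<alpha> (u - w) \<le> p \<alpha> (u - v) + p \<alpha> (v - w)"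
  using p_add[of \<alpha> "u - v" "v - w"] by (simp add: mems)
lemma p_sum:
  assumes "\<alpha> \<in> A" "\<And>i. i \<in> I \<Longrightarrow> v i \<in> vsp X"
  shows "p \<alpha> (sum v I) \<le> (\<Sum>i\<in>I. p \<alpha> (v i))"
  using assms(2)
proof (induction I rule: infinite_finite_induct)
  case (insert x F)
  have "p \<alpha> (v x + sum v F) \<le> p \<alpha> (v x) + p \<alpha> (sum v F)"
    using insert.prems by (intro p_add assms(1)) (auto intro!: mems)
  then show ?case using insert by fastforce
qed (simp_all add: p_zero assms(1))

text \<open>Basic neighbourhoods of zero are finite intersections of balls; directedness finds a
  single ball inside each of them, so that all later arguments work with one seminorm and one
  radius.\<close>

lemma ball_in_finite_Inter:
  assumes "finite \<F>" "\<F> \<subseteq> {{v \<in> vsp X. q v < r} |q r. q \<in> p ` A \<and> 0 < r}"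
  shows "\<exists>\<alpha>\<in>A. \<exists>r>0. \<forall>v\<in>vsp X. p \<alpha> v < r \<longrightarrow> v \<in> \<Inter>\<F>"
  using assms
proof (induction \<F>)
  case empty
  obtain \<alpha> where "\<alpha> \<in> A" using index_nonempty by blast
  then show ?case by (intro bexI[of _ \<alpha>] exI[of _ 1]) auto
next
  case (insert B \<F>)
  then obtain \<alpha> r where 1: "\<alpha> \<in> A" "r > 0" "\<forall>v\<in>vsp X. p \<alpha> v < r \<longrightarrow> v \<in> \<Inter>\<F>" by auto
  obtain \<beta> s where 2: "\<beta> \<in> A" "s > 0" "B = {v \<in> vsp X. p \<beta> v < s}" using insert.prems by auto
  obtain \<gamma> C where 3: "\<gamma> \<in> A" "C > 0" "\<forall>v\<in>vsp X. p \<alpha> v \<le> C * p \<gamma> v \<and> p \<beta> v \<le> C * p \<gamma> v"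
    using directed 1(1) 2(1) by blast
  have "v \<in> \<Inter>(insert B \<F>)" if v: "v \<in> vsp X" "p \<gamma> v < min r s / C" for v
  proof -
    have "C * p \<gamma> v < min r s" using v(2) 3(2) by (simp add: field_simps)
    then have "p \<alpha> v < r" "p \<beta> v < s" using 3(3) v(1) by (smt (verit))+
    then show ?thesis using 1(3) 2(3) v(1) by auto
  qed
  moreover have "min r s / C > 0" using 1 2 3 by simp
  ultimately show ?case using 3(1) by blast
qed

lemma openin_iff:
  "openin (vtop X) U \<longleftrightarrow> U \<subseteq> vsp X \<and>
     (\<forall>x\<in>U. \<exists>\<alpha>\<in>A. \<exists>r>0. \<forall>y\<in>vsp X. p \<alpha> (y - x) < r \<longrightarrow> y \<in> U)"
proof -
  let ?B = "{{v \<in> vsp X. q v < r} |q r. q \<in> p ` A \<and> 0 < r}"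
  have top: "vtop X = zero_nbhd_topology (vsp X) ?B"
    using fundamental by (simp add: fundamental_seminorms_def seminorm_topology_def)
  have key: "(\<exists>\<F>. finite \<F> \<and> \<F> \<subseteq> ?B \<and> (\<forall>y\<in>vsp X. y - x \<in> \<Inter>\<F> \<longrightarrow> y \<in> U)) \<longleftrightarrow>
    (\<exists>\<alpha>\<in>A. \<exists>r>0. \<forall>y\<in>vsp X. p \<alpha> (y - x) < r \<longrightarrow> y \<in> U)" (is "?L = ?R") if x: "x \<in> vsp X" for x
  proof
    assume ?L
    then obtain \<F> where "finite \<F>" "\<F> \<subseteq> ?B" and F: "\<forall>y\<in>vsp X. y - x \<in> \<Inter>\<F> \<longrightarrow> y \<in> U" by blast
    then obtain \<alpha> r where "\<alpha> \<in> A" "r > 0" "\<forall>v\<in>vsp X. p \<alpha> v < r \<longrightarrow> v \<in> \<Inter>\<F>"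
      using ball_in_finite_Inter[of \<F>] by blast
    then show ?R using F x diff_mem by blast
  next
    assume ?R
    then obtain \<alpha> r where "\<alpha> \<in> A" "r > 0" "\<forall>y\<in>vsp X. p \<alpha> (y - x) < r \<longrightarrow> y \<in> U" by blast
    then show ?L by (intro exI[of _ "{{v \<in> vsp X. p \<alpha> v < r}}"]) auto
  qed
  show ?thesis
    unfolding top openin_zero_nbhd_topology by (intro conj_cong ball_cong refl key) blast
qed

lemma openin_ball:
  assumes "\<alpha> \<in> A" "x \<in> vsp X"
  shows "openin (vtop X) {v \<in> vsp X. p \<alpha> (v - x) < r}"
  unfolding openin_iff
proof (intro conjI ballI)
  fix v assume v: "v \<in> {v \<in> vsp X. p \<alpha> (v - x) < r}"
  have "p \<alpha> (y - x) < r" if "y \<in> vsp X" "p \<alpha> (y - v) < r - p \<alpha> (v - x)" for y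
    using p_triangle[of \<alpha> y v x] that v assms by simp
  then show "\<exists>\<beta>\<in>A. \<exists>s>0. \<forall>y\<in>vsp X. p \<beta> (y - v) < s \<longrightarrow> y \<in> {v \<in> vsp X. p \<alpha> (v - x) < r}"
    using v assms(1) by (intro bexI[of _ \<alpha>] exI[of _ "r - p \<alpha> (v - x)"]) auto
qed auto

lemma continuous_map_into_iff:
  "continuous_map T (vtop X) f \<longleftrightarrow> f \<in> topspace T \<rightarrow> vsp X \<and>
     (\<forall>t\<in>topspace T. \<forall>\<alpha>\<in>A. \<forall>\<epsilon>>0. \<exists>U. openin T U \<and> t \<in> U \<and> (\<forall>s\<in>U. p \<alpha> (f s - f t) < \<epsilon>))"
  (is "?L = ?R")
proof
  assume L: ?L
  then have m: "f \<in> topspace T \<rightarrow> vsp X" by (simp add: continuous_map_def vsp_def)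
  have "\<exists>U. openin T U \<and> t \<in> U \<and> (\<forall>s\<in>U. p \<alpha> (f s - f t) < \<epsilon>)"
    if t: "t \<in> topspace T" "\<alpha> \<in> A" "\<epsilon> > 0" for t \<alpha> and \<epsilon> :: real
  proof -
    have "openin T {s \<in> topspace T. f s \<in> {v \<in> vsp X. p \<alpha> (v - f t) < \<epsilon>}}"
      using m t by (intro openin_continuous_map_preimage[OF L] openin_ball) auto
    then show ?thesis using t m p_zero
      by (intro exI[of _ "{s \<in> topspace T. f s \<in> {v \<in> vsp X. p \<alpha> (v - f t) < \<epsilon>}}"]) auto
  qed
  then show ?R using m by blast
next
  assume R: ?R
  have "openin T {x \<in> topspace T. f x \<in> U}" if U: "openin (vtop X) U" for U
  proof (subst openin_subopen, intro ballI)
    fix t assume t: "t \<in> {x \<in> topspace T. f x \<in> U}"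
    then obtain \<alpha> r where 1: "\<alpha> \<in> A" "r > 0" "\<forall>y\<in>vsp X. p \<alpha> (y - f t) < r \<longrightarrow> y \<in> U"
      using U unfolding openin_iff by blast
    then obtain W where "openin T W" "t \<in> W" "\<forall>s\<in>W. p \<alpha> (f s - f t) < r" using R t by blast
    moreover have "W \<subseteq> topspace T" using \<open>openin T W\<close> by (rule openin_subset)
    ultimately show "\<exists>S. openin T S \<and> t \<in> S \<and> S \<subseteq> {x \<in> topspace T. f x \<in> U}"
      using 1 R by (intro exI[of _ W]) auto
  qed
  then show ?L using R by (simp add: continuous_map_def vsp_def)
qed

lemma limitin_iff:
  "limitin (vtop X) f l \<F> \<longleftrightarrow> l \<in> vsp X \<and>
     (\<forall>\<alpha>\<in>A. \<forall>\<epsilon>>0. eventually (\<lambda>t. f t \<in> vsp X \<and> p \<alpha> (f t - l) < \<epsilon>) \<F>)" (is "?L = ?R")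
proof
  assume L: ?L
  then have l: "l \<in> vsp X" by (simp add: limitin_def vsp_def)
  have "eventually (\<lambda>t. f t \<in> vsp X \<and> p \<alpha> (f t - l) < \<epsilon>) \<F>" if "\<alpha> \<in> A" "\<epsilon> > 0" for \<alpha> and \<epsilon> :: real
  proof -
    have "eventually (\<lambda>t. f t \<in> {v \<in> vsp X. p \<alpha> (v - l) < \<epsilon>}) \<F>"
      using L openin_ball[OF that(1) l, of \<epsilon>] that l p_zero unfolding limitin_def by auto
    then show ?thesis by simp
  qed
  then show ?R using l by blast
next
  assume R: ?R
  have "eventually (\<lambda>x. f x \<in> U) \<F>" if U: "openin (vtop X) U" "l \<in> U" for U
  proof -
    obtain \<alpha> r where 1: "\<alpha> \<in> A" "r > 0" "\<forall>y\<in>vsp X. p \<alpha> (y - l) < r \<longrightarrow> y \<in> U"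
      using U unfolding openin_iff by blast
    then have "eventually (\<lambda>t. f t \<in> vsp X \<and> p \<alpha> (f t - l) < r) \<F>" using R by blast
    then show ?thesis by eventually_elim (use 1 in blast)
  qed
  then show ?L using R by (simp add: limitin_def vsp_def)
qed

lemma closure_iff:
  "x \<in> vtop X closure_of S \<longleftrightarrow>
     x \<in> vsp X \<and> (\<forall>\<alpha>\<in>A. \<forall>\<epsilon>>0. \<exists>y\<in>S \<inter> vsp X. p \<alpha> (y - x) < \<epsilon>)" (is "?L = ?R")
proof
  assume L: ?L
  then have x: "x \<in> vsp X" by (simp add: in_closure_of vsp_def)
  have "\<exists>y\<in>S \<inter> vsp X. p \<alpha> (y - x) < \<epsilon>" if a: "\<alpha> \<in> A" "\<epsilon> > 0" for \<alpha> and \<epsilon> :: real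
  proof -
    have "x \<in> {v \<in> vsp X. p \<alpha> (v - x) < \<epsilon>}" using x p_zero a by simp
    from L[unfolded in_closure_of, THEN conjunct2, rule_format, OF conjI[OF this openin_ball[OF a(1) x]]]
    show ?thesis by blast
  qed
  then show ?R using x by blast
next
  assume R: ?R
  show ?L unfolding in_closure_of
  proof (intro conjI allI impI)
    show "x \<in> topspace (vtop X)" using R by (simp add: vsp_def)
    fix U assume U: "x \<in> U \<and> openin (vtop X) U"
    then obtain \<alpha> r where 1: "\<alpha> \<in> A" "r > 0" "\<forall>y\<in>vsp X. p \<alpha> (y - x) < r \<longrightarrow> y \<in> U"
      unfolding openin_iff by blast
    then obtain y where "y \<in> S \<inter> vsp X" "p \<alpha> (y - x) < r" using R by blast
    then show "\<exists>y. y \<in> S \<and> y \<in> U" using 1(3) by blast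
  qed
qed

lemma cauchy_filter_on_iff:
  "cauchy_filter_on X \<F> \<longleftrightarrow> \<F> \<noteq> bot \<and> eventually (\<lambda>v. v \<in> vsp X) \<F> \<and>
     (\<forall>\<alpha>\<in>A. \<forall>\<epsilon>>0. \<exists>Q. eventually Q \<F> \<and> (\<forall>v w. Q v \<longrightarrow> Q w \<longrightarrow> v \<in> vsp X \<and> w \<in> vsp X \<and> p \<alpha> (v - w) < \<epsilon>))"
  (is "?L = ?R")
proof
  assume L: ?L
  have "\<exists>Q. eventually Q \<F> \<and> (\<forall>v w. Q v \<longrightarrow> Q w \<longrightarrow> v \<in> vsp X \<and> w \<in> vsp X \<and> p \<alpha> (v - w) < \<epsilon>)"
    if "\<alpha> \<in> A" "\<epsilon> > 0" for \<alpha> and \<epsilon> :: real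
  proof -
    have "openin (vtop X) {v \<in> vsp X. p \<alpha> (v - 0) < \<epsilon>}" by (intro openin_ball that) simp
    then have "eventually (\<lambda>(v, w). v - w \<in> {v \<in> vsp X. p \<alpha> (v - 0) < \<epsilon>}) (\<F> \<times>\<^sub>F \<F>)"
      using L that p_zero unfolding cauchy_filter_on_def by auto
    then obtain P where "eventually P \<F>" "\<forall>x y. P x \<longrightarrow> P y \<longrightarrow> p \<alpha> (x - y) < \<epsilon>"
      unfolding eventually_prod_same by auto
    moreover have "eventually (\<lambda>v. v \<in> vsp X) \<F>" using L by (simp add: cauchy_filter_on_def)
    ultimately show ?thesis
      by (intro exI[of _ "\<lambda>v. P v \<and> v \<in> vsp X"]) (auto intro: eventually_conj)
  qed
  then show ?R using L by (simp add: cauchy_filter_on_def)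
next
  assume R: ?R
  have "eventually (\<lambda>(v, w). v - w \<in> U) (\<F> \<times>\<^sub>F \<F>)" if U: "openin (vtop X) U" "0 \<in> U" for U
  proof -
    obtain \<alpha> r where 1: "\<alpha> \<in> A" "r > 0" "\<forall>y\<in>vsp X. p \<alpha> (y - 0) < r \<longrightarrow> y \<in> U"
      using U unfolding openin_iff by blast
    then obtain Q where "eventually Q \<F>"
      "\<forall>v w. Q v \<longrightarrow> Q w \<longrightarrow> v \<in> vsp X \<and> w \<in> vsp X \<and> p \<alpha> (v - w) < r" using R by meson
    then show ?thesis unfolding eventually_prod_same using 1 by (intro exI[of _ Q]) (auto simp: mems)
  qed
  then show ?L using R by (simp add: cauchy_filter_on_def)
qed

text \<open>Total boundedness is the form in which compactness enters the weighted estimates: a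
  property of finitely many functions is spread over the whole set.\<close>

lemma compact_finite_net:
  assumes "compactin (vtop X) M" "\<alpha> \<in> A" "\<epsilon> > 0"
  obtains N where "finite N" "N \<subseteq> M" "\<And>v. v \<in> M \<Longrightarrow> \<exists>n\<in>N. p \<alpha> (v - n) < \<epsilon>"
proof -
  have M: "M \<subseteq> vsp X" using assms(1) by (simp add: compactin_def vsp_def)
  let ?U = "\<lambda>x. {v \<in> vsp X. p \<alpha> (v - x) < \<epsilon>}"
  have "M \<subseteq> \<Union>(?U ` M)" using M p_zero[OF assms(2)] assms(3) by auto
  moreover have "\<forall>U \<in> ?U ` M. openin (vtop X) U" using M assms(2) openin_ball by blast
  ultimately obtain \<F> where "finite \<F>" "\<F> \<subseteq> ?U ` M" "M \<subseteq> \<Union>\<F>"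
    using assms(1) unfolding compactin_def by meson
  then obtain N where "N \<subseteq> M" "finite N" "\<F> = ?U ` N" using finite_subset_image[of \<F> ?U M] by blast
  then show ?thesis using \<open>M \<subseteq> \<Union>\<F>\<close> by (intro that[of N]) auto
qed

lemma compact_bounded:
  assumes "compactin (vtop X) M" "\<alpha> \<in> A"
  obtains B where "B > 0" "\<And>v. v \<in> M \<Longrightarrow> p \<alpha> v \<le> B"
proof -
  have M: "M \<subseteq> vsp X" using assms(1) by (simp add: compactin_def vsp_def)
  obtain N where N: "finite N" "N \<subseteq> M" "\<And>v. v \<in> M \<Longrightarrow> \<exists>n\<in>N. p \<alpha> (v - n) < 1"
    using compact_finite_net[OF assms zero_less_one] by blast
  have "p \<alpha> v \<le> 1 + (\<Sum>n\<in>N. p \<alpha> n)" if v: "v \<in> M" for v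
  proof -
    obtain n where n: "n \<in> N" "p \<alpha> (v - n) < 1" using N v by blast
    have "p \<alpha> ((v - n) + n) \<le> p \<alpha> (v - n) + p \<alpha> n" using M N v n by (intro p_add assms mems) auto
    moreover have "p \<alpha> n \<le> (\<Sum>n\<in>N. p \<alpha> n)"
      using n N M by (intro member_le_sum) (auto intro!: p_nonneg assms)
    ultimately show ?thesis using n by simp
  qed
  moreover have "(\<Sum>n\<in>N. p \<alpha> n) \<ge> 0" using N M assms by (intro sum_nonneg p_nonneg) auto
  ultimately show ?thesis by (intro that[of "1 + (\<Sum>n\<in>N. p \<alpha> n)"]) auto
qed

lemma lcHs_iff: "lcHs X \<longleftrightarrow> (\<forall>v\<in>vsp X. (\<forall>\<alpha>\<in>A. p \<alpha> v = 0) \<longrightarrow> v = 0)" (is "?L = ?R")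
proof
  assume L: ?L
  show ?R
  proof (intro ballI impI, rule ccontr)
    fix v assume v: "v \<in> vsp X" "\<forall>\<alpha>\<in>A. p \<alpha> v = 0" "v \<noteq> 0"
    have "Hausdorff_space (vtop X)" using L by (simp add: lcHs_def)
    then obtain U W where UW: "openin (vtop X) U" "0 \<in> U" "v \<in> W" "disjnt U W"
      using v zero_mem unfolding Hausdorff_space_def vsp_def by metis
    then obtain \<alpha> r where 1: "\<alpha> \<in> A" "r > 0" "\<forall>y\<in>vsp X. p \<alpha> (y - 0) < r \<longrightarrow> y \<in> U"
      unfolding openin_iff by blast
    then have "v \<in> U" using v by simp
    then show False using UW by (auto simp: disjnt_iff)
  qed
next
  assume R: ?R
  have "Hausdorff_space (vtop X)" unfolding Hausdorff_space_def
  proof (intro allI impI)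
    fix x y assume "x \<in> topspace (vtop X) \<and> y \<in> topspace (vtop X) \<and> x \<noteq> y"
    then have xy: "x \<in> vsp X" "y \<in> vsp X" "x \<noteq> y" by (auto simp: vsp_def)
    then obtain \<alpha> where \<alpha>: "\<alpha> \<in> A" "p \<alpha> (x - y) \<noteq> 0" using R diff_mem by (metis eq_iff_diff_eq_0)
    define r where "r = p \<alpha> (x - y) / 2"
    have r: "r > 0" using \<alpha> p_nonneg[OF \<alpha>(1) diff_mem[OF xy(1,2)]] by (simp add: r_def)
    have False if z: "z \<in> vsp X" "p \<alpha> (z - x) < r" "p \<alpha> (z - y) < r" for z
      using p_triangle[of \<alpha> x z y] p_commute[of \<alpha> x z] \<alpha>(1) xy z by (simp add: r_def)
    then have "disjnt {v \<in> vsp X. p \<alpha> (v - x) < r} {v \<in> vsp X. p \<alpha> (v - y) < r}"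
      by (auto simp: disjnt_iff)
    then show "\<exists>U V. openin (vtop X) U \<and> openin (vtop X) V \<and> x \<in> U \<and> y \<in> V \<and> disjnt U V"
      using openin_ball[OF \<alpha>(1)] xy r p_zero[OF \<alpha>(1)]
      by (intro exI[of _ "{v \<in> vsp X. p \<alpha> (v - x) < r}"] exI[of _ "{v \<in> vsp X. p \<alpha> (v - y) < r}"]) auto
  qed
  then show ?L unfolding lcHs_def
    using vector_space_scl subspace_vsp fundamental seminorm
    by (auto simp: fundamental_seminorms_def intro!: exI[of _ "p ` A"])
qed

text \<open>Equations that are solvable only up to an error give a directed family of solution sets
  instead of a sequence; the filter they generate is Cauchy. The sets are not assumed closed, so the
  limit is merely close to points of each of them.\<close>

lemma complete_limit:
  assumes complete: "complete_tvs X"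
    and ne: "I \<noteq> {}" "\<And>i. i \<in> I \<Longrightarrow> G i \<noteq> {} \<and> G i \<subseteq> vsp X"
    and dir: "\<And>i j. i \<in> I \<Longrightarrow> j \<in> I \<Longrightarrow> \<exists>k\<in>I. G k \<subseteq> G i \<inter> G j"
    and small: "\<And>\<alpha> \<epsilon>. \<alpha> \<in> A \<Longrightarrow> \<epsilon> > 0 \<Longrightarrow> \<exists>i\<in>I. \<forall>v\<in>G i. \<forall>w\<in>G i. p \<alpha> (v - w) < \<epsilon>"
  obtains l where "l \<in> vsp X"
    "\<And>i \<alpha> \<epsilon>. i \<in> I \<Longrightarrow> \<alpha> \<in> A \<Longrightarrow> \<epsilon> > 0 \<Longrightarrow> \<exists>v\<in>G i. p \<alpha> (v - l) < \<epsilon>"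
proof -
  define \<F> where "\<F> = (INF i\<in>I. principal (G i))"
  have ev: "eventually P \<F> \<longleftrightarrow> (\<exists>i\<in>I. \<forall>v\<in>G i. P v)" for P
  proof -
    have "eventually P \<F> \<longleftrightarrow> (\<exists>b\<in>I. eventually P (principal (G b)))"
      unfolding \<F>_def by (rule eventually_INF_base) (use ne dir in auto)
    then show ?thesis by (simp add: eventually_principal)
  qed
  have "cauchy_filter_on X \<F>" unfolding cauchy_filter_on_iff
  proof (intro conjI ballI allI impI)
    show "\<F> \<noteq> bot" unfolding trivial_limit_def ev using ne by auto
    show "eventually (\<lambda>v. v \<in> vsp X) \<F>" unfolding ev using ne by blast
    fix \<alpha> and \<epsilon> :: real assume "\<alpha> \<in> A" "\<epsilon> > 0"
    then obtain i where "i \<in> I" "\<forall>v\<in>G i. \<forall>w\<in>G i. p \<alpha> (v - w) < \<epsilon>" using small by blast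
    then show "\<exists>Q. eventually Q \<F> \<and> (\<forall>v w. Q v \<longrightarrow> Q w \<longrightarrow> v \<in> vsp X \<and> w \<in> vsp X \<and> p \<alpha> (v - w) < \<epsilon>)"
      using ne unfolding ev by (intro exI[of _ "\<lambda>v. v \<in> G i"]) blast
  qed
  then obtain l where l: "limitin (vtop X) (\<lambda>v. v) l \<F>" using complete unfolding complete_tvs_def by blast
  show ?thesis
  proof (rule that[of l])
    show "l \<in> vsp X" using l by (simp add: limitin_iff)
    fix i \<alpha> and \<epsilon> :: real assume i: "i \<in> I" "\<alpha> \<in> A" "\<epsilon> > 0"
    then obtain j where "j \<in> I" "\<forall>v\<in>G j. p \<alpha> (v - l) < \<epsilon>" using l unfolding limitin_iff ev by blast
    then show "\<exists>v\<in>G i. p \<alpha> (v - l) < \<epsilon>" using dir[OF i(1)] ne by blast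
  qed
qed

lemma completeI:
  assumes "\<And>\<F>. \<lbrakk>\<F> \<noteq> bot; eventually (\<lambda>v. v \<in> vsp X) \<F>;
     \<And>\<alpha> \<epsilon>. \<alpha> \<in> A \<Longrightarrow> \<epsilon> > 0 \<Longrightarrow> \<exists>Q. eventually Q \<F> \<and> (\<forall>v w. Q v \<longrightarrow> Q w \<longrightarrow> v \<in> vsp X \<and> w \<in> vsp X \<and> p \<alpha> (v - w) < \<epsilon>)\<rbrakk>
     \<Longrightarrow> \<exists>l\<in>vsp X. \<forall>\<alpha>\<in>A. \<forall>\<epsilon>>0. eventually (\<lambda>v. v \<in> vsp X \<and> p \<alpha> (v - l) < \<epsilon>) \<F>"
  shows "complete_tvs X"
  unfolding complete_tvs_def cauchy_filter_on_iff limitin_iff using assms by blast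

end

lemma lcHs_seminormed_space:
  assumes "lcHs X" "fundamental_seminorms X A p"
  shows "seminormed_space X A p"
  using assms by (simp add: seminormed_space_def lcHs_def)

text \<open>The seminorms hidden in \<open>lcHs\<close> may fail to be directed and may even form an
  empty family. Sums over finite subsets repair both, the empty sum being the zero seminorm. This
  provides seminorms for a completion about which nothing else is known.\<close>

lemma lcHs_fundamental_seminorms:
  fixes X :: "('k::real_or_complex, 'v::ab_group_add) tvs"
  assumes "lcHs X"
  shows "\<exists>(A :: ('v \<Rightarrow> real) set set) p. fundamental_seminorms X A p"
proof -
  obtain P where P: "\<forall>q\<in>P. seminorm_on X q" "vtop X = seminorm_topology (vsp X) P"
    using assms by (auto simp: lcHs_def)
  interpret V: vector_space "scl X" using assms by (simp add: lcHs_def)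
  have sub: "V.subspace (vsp X)" using assms by (simp add: lcHs_def)
  define A where "A = {Q. finite Q \<and> Q \<subseteq> P}"
  define p where "p Q v = (\<Sum>q\<in>Q. q v :: real)" for Q and v :: 'v
  have q: "q v \<ge> 0" "q (v + w) \<le> q v + q w" "q (scl X c v) = norm c * q v"
    if "q \<in> P" "v \<in> vsp X" "w \<in> vsp X" for q v w c
    using that P by (auto simp: seminorm_on_def)
  have mono: "p Q v \<le> p R v" if "Q \<subseteq> R" "R \<in> A" "v \<in> vsp X" for Q R v
    unfolding p_def using that q by (intro sum_mono2) (auto simp: A_def)
  have "vtop X = seminorm_topology (vsp X) (p ` A)"
  proof (rule topology_eq[THEN iffD2], intro allI)
    fix U
    let ?B = "\<lambda>P. {{v \<in> vsp X. q v < r} |q r. q \<in> P \<and> 0 < r}"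
    have key: "(\<exists>\<F>. finite \<F> \<and> \<F> \<subseteq> ?B P \<and> (\<forall>y\<in>vsp X. y - x \<in> \<Inter>\<F> \<longrightarrow> y \<in> U)) \<longleftrightarrow>
        (\<exists>\<F>. finite \<F> \<and> \<F> \<subseteq> ?B (p ` A) \<and> (\<forall>y\<in>vsp X. y - x \<in> \<Inter>\<F> \<longrightarrow> y \<in> U))" (is "?L = ?R")
      if x: "x \<in> vsp X" for x
    proof
      assume ?L
      moreover have "?B P \<subseteq> ?B (p ` A)"
      proof -
        have "q = p {q}" "{q} \<in> A" if "q \<in> P" for q using that by (auto simp: p_def A_def fun_eq_iff)
        then have "P \<subseteq> p ` A" by blast
        then show ?thesis by blast
      qed
      ultimately show ?R by (meson subset_trans)
    next
      assume ?R
      then obtain \<F> where F: "finite \<F>" "\<F> \<subseteq> ?B (p ` A)" "\<forall>y\<in>vsp X. y - x \<in> \<Inter>\<F> \<longrightarrow> y \<in> U" by blast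
      have "\<exists>\<G>. finite \<G> \<and> \<G> \<subseteq> ?B P \<and> vsp X \<inter> \<Inter>\<G> \<subseteq> \<Inter>\<F>" using F(1,2)
      proof (induction \<F>)
        case empty
        then show ?case by (intro exI[of _ "{}"]) auto
      next
        case (insert W \<F>)
        then obtain \<G> where G: "finite \<G>" "\<G> \<subseteq> ?B P" "vsp X \<inter> \<Inter>\<G> \<subseteq> \<Inter>\<F>" by auto
        obtain Q r where Q: "W = {v \<in> vsp X. p Q v < r}" "finite Q" "Q \<subseteq> P" "r > 0"
          using insert.prems by (auto simp: A_def)
        \<comment> \<open>Each of the card Q summands is at most s; the extra 1 keeps the total
          strictly below r and covers an empty Q.\<close>
        define s where "s = r / (card Q + 1)"
        have s: "s > 0" using Q by (simp add: s_def)
        let ?H = "(\<lambda>q. {v \<in> vsp X. q v < s}) ` Q"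
        have sub: "vsp X \<inter> \<Inter>?H \<subseteq> W"
        proof
          fix v assume v: "v \<in> vsp X \<inter> \<Inter>?H"
          have "p Q v \<le> (\<Sum>q\<in>Q. s)" unfolding p_def using v by (intro sum_mono) (auto intro: less_imp_le)
          also have "\<dots> < (card Q + 1) * s" using s by (simp add: algebra_simps)
          also have "\<dots> = r" by (simp add: s_def)
          finally show "v \<in> W" using v Q by simp
        qed
        have H: "?H \<subseteq> ?B P" using Q s by blast
        show ?case
        proof (intro exI[of _ "\<G> \<union> ?H"] conjI)
          show "finite (\<G> \<union> ?H)" using G Q by simp
          show "\<G> \<union> ?H \<subseteq> ?B P" using G(2) H by (rule Un_least)
          have "V \<inter> (I \<inter> K) \<subseteq> W \<inter> L" if "V \<inter> I \<subseteq> L" "V \<inter> K \<subseteq> W" for V I K L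
            using that by blast
          from this[OF G(3) sub] show "vsp X \<inter> \<Inter>(\<G> \<union> ?H) \<subseteq> \<Inter>(insert W \<F>)"
            by (simp only: Inter_Un_distrib Inter_insert)
        qed
      qed
      then obtain \<G> where G: "finite \<G>" "\<G> \<subseteq> ?B P" "vsp X \<inter> \<Inter>\<G> \<subseteq> \<Inter>\<F>" by (elim exE conjE)
      have "y \<in> U" if y: "y \<in> vsp X" "y - x \<in> \<Inter>\<G>" for y
      proof -
        have "y - x \<in> \<Inter>\<F>" using G(3) y(2) V.subspace_diff[OF sub y(1) x] by (auto simp del: Inter_iff)
        then show ?thesis using F(3) y(1) by blast
      qed
      then show ?L using G(1,2) by (intro exI[of _ \<G>]) simp
    qed
    show "openin (vtop X) U = openin (seminorm_topology (vsp X) (p ` A)) U"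
      unfolding P(2) seminorm_topology_def openin_zero_nbhd_topology by (intro conj_cong ball_cong refl key) blast
  qed
  moreover have "A \<noteq> {}" by (auto simp: A_def)
  moreover have "seminorm_on X (p Q)" if "Q \<in> A" for Q
    unfolding seminorm_on_def p_def using that q
    by (auto simp: A_def sum_distrib_left sum.distrib[symmetric] intro!: sum_nonneg sum_mono sum.cong)
  moreover have "\<exists>R\<in>A. \<exists>C>0. \<forall>v\<in>vsp X. p Q v \<le> C * p R v \<and> p Q' v \<le> C * p R v" if "Q \<in> A" "Q' \<in> A" for Q Q'
  proof -
    have R: "Q \<union> Q' \<in> A" using that by (auto simp: A_def)
    then show ?thesis using mono by (intro bexI[of _ "Q \<union> Q'"] exI[of _ 1]) auto
  qed
  ultimately have "fundamental_seminorms X A p" unfolding fundamental_seminorms_def by blast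
  then show ?thesis by blast
qed

section \<open>The Hahn--Banach theorem\<close>

text \<open>The value of a linear minorant at \<open>v0\<close> is prescribed by starting from the sublinear functional
  \<open>v \<mapsto> inf\<^sub>t (p (v + t v0) - t p v0)\<close>; a minimal sublinear functional below it is linear, because it is
  not decreased further by the same construction at any other vector.\<close>

locale real_subspace =
  fixes sm :: "real \<Rightarrow> 'v::ab_group_add \<Rightarrow> 'v" and S :: "'v set"
  assumes vs: "vector_space sm" and sub: "module.subspace sm S"
begin

interpretation V: vector_space sm by (rule vs)

text \<open>Values off S are pinned to zero; otherwise they could be lowered for ever and no minimal
  functional would exist.\<close>

definition sublinear :: "('v \<Rightarrow> real) \<Rightarrow> bool" where
  "sublinear q \<longleftrightarrow> (\<forall>v\<in>S. \<forall>w\<in>S. q (v + w) \<le> q v + q w) \<and>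
     (\<forall>r>0. \<forall>v\<in>S. q (sm r v) \<le> r * q v) \<and> (\<forall>v. v \<notin> S \<longrightarrow> q v = 0)"

definition shift :: "('v \<Rightarrow> real) \<Rightarrow> 'v \<Rightarrow> 'v \<Rightarrow> real" where
  "shift q a v = (if v \<in> S then INF t\<in>{0..}. q (v + sm t a) - t * q a else 0)"

lemma mem: "0 \<in> S" "v \<in> S \<Longrightarrow> w \<in> S \<Longrightarrow> v + w \<in> S" "v \<in> S \<Longrightarrow> - v \<in> S" "v \<in> S \<Longrightarrow> sm r v \<in> S"
  using sub by (auto intro: V.subspace_0 V.subspace_add V.subspace_neg V.subspace_scale)

lemma sublinear_add: "sublinear q \<Longrightarrow> v \<in> S \<Longrightarrow> w \<in> S \<Longrightarrow> q (v + w) \<le> q v + q w"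
  by (simp add: sublinear_def)

lemma sublinear_scale:
  assumes "sublinear q" "v \<in> S" "r > 0" shows "q (sm r v) = r * q v"
proof (rule antisym)
  show "q (sm r v) \<le> r * q v" using assms by (simp add: sublinear_def)
  have "q (sm (inverse r) (sm r v)) \<le> inverse r * q (sm r v)"
    using assms(1,3) mem(4)[OF assms(2)] unfolding sublinear_def by (meson positive_imp_inverse_positive)
  then show "r * q v \<le> q (sm r v)" using assms(3) by (simp add: field_simps)
qed

lemma sublinear_zero: "sublinear q \<Longrightarrow> q 0 = 0"
  using sublinear_scale[of q 0 2] mem(1) by simp

lemma sublinear_scale_nonneg: "sublinear q \<Longrightarrow> v \<in> S \<Longrightarrow> r \<ge> 0 \<Longrightarrow> q (sm r v) = r * q v"
  using sublinear_scale[of q v r] sublinear_zero by (cases "r = 0") auto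

lemma sublinear_lower: "sublinear q \<Longrightarrow> v \<in> S \<Longrightarrow> - q (- v) \<le> q v"
  using sublinear_add[of q v "- v"] sublinear_zero[of q] mem(3) by fastforce

lemma shift_le:
  assumes q: "sublinear q" and "a \<in> S" "v \<in> S" "t \<ge> 0"
  shows "shift q a v \<le> q (v + sm t a) - t * q a"
proof -
  \<comment> \<open>Subadditivity bounds every term of the infimum from below by a quantity
    independent of s, as the real-valued infimum requires.\<close>
  have "- q (- v) \<le> q (v + sm s a) - s * q a" if "s \<ge> 0" for s
  proof -
    have "q ((v + sm s a) + - v) \<le> q (v + sm s a) + q (- v)"
      using assms by (intro sublinear_add q mem)
    then have "q (sm s a) \<le> q (v + sm s a) + q (- v)" by simp
    then show ?thesis using sublinear_scale_nonneg[OF q assms(2) that] by simp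
  qed
  then have "bdd_below ((\<lambda>t. q (v + sm t a) - t * q a) ` {0..})" by (intro bdd_belowI2) auto
  then show ?thesis using assms by (auto simp: shift_def intro!: cINF_lower)
qed

lemma shift_attained:
  assumes "sublinear q" "a \<in> S" "v \<in> S" "\<epsilon> > 0"
  obtains t where "t \<ge> 0" "q (v + sm t a) - t * q a < shift q a v + \<epsilon>"
proof -
  have "\<exists>t\<in>{0..}. q (v + sm t a) - t * q a < shift q a v + \<epsilon>"
  proof (rule ccontr)
    assume "\<not> ?thesis"
    then have "shift q a v + \<epsilon> \<le> (INF t\<in>{0..}. q (v + sm t a) - t * q a)"
      by (intro cINF_greatest) (auto simp: not_less)
    then show False using assms by (simp add: shift_def)
  qed
  then show ?thesis using that by auto
qed

lemma sublinear_shift: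
  assumes q: "sublinear q" and a: "a \<in> S"
  shows "sublinear (shift q a)"
  unfolding sublinear_def
proof (intro conjI ballI allI impI)
  fix v w assume vw: "v \<in> S" "w \<in> S"
  show "shift q a (v + w) \<le> shift q a v + shift q a w"
  proof (rule field_le_epsilon)
    fix e :: real assume e: "e > 0"
    obtain s where s: "s \<ge> 0" "q (v + sm s a) - s * q a < shift q a v + e / 2"
      using shift_attained[OF q a vw(1), of "e / 2"] e by auto
    obtain t where t: "t \<ge> 0" "q (w + sm t a) - t * q a < shift q a w + e / 2"
      using shift_attained[OF q a vw(2), of "e / 2"] e by auto
    have "shift q a (v + w) \<le> q ((v + w) + sm (s + t) a) - (s + t) * q a"
      using s t vw by (intro shift_le q a mem) auto
    also have "(v + w) + sm (s + t) a = (v + sm s a) + (w + sm t a)" by (simp add: V.scale_left_distrib)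
    also have "q \<dots> \<le> q (v + sm s a) + q (w + sm t a)" using vw a by (intro sublinear_add q mem)
    finally show "shift q a (v + w) \<le> shift q a v + shift q a w + e"
      using s t by (simp add: algebra_simps)
  qed
next
  fix r :: real and v assume r: "r > 0" and v: "v \<in> S"
  have "shift q a (sm r v) / r \<le> shift q a v"
  proof (rule field_le_epsilon)
    fix e :: real assume e: "e > 0"
    obtain s where s: "s \<ge> 0" "q (v + sm s a) - s * q a < shift q a v + e"
      using shift_attained[OF q a v e] by auto
    have "shift q a (sm r v) \<le> q (sm r v + sm (r * s) a) - (r * s) * q a"
      using s r v by (intro shift_le q a mem) auto
    also have "sm r v + sm (r * s) a = sm r (v + sm s a)" by (simp add: V.scale_right_distrib)
    also have "q (sm r (v + sm s a)) = r * q (v + sm s a)"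
      using v a r by (intro sublinear_scale q mem)
    finally have "shift q a (sm r v) \<le> r * (q (v + sm s a) - s * q a)" by (simp add: algebra_simps)
    also have "\<dots> \<le> r * (shift q a v + e)" using s r by (intro mult_left_mono) auto
    finally show "shift q a (sm r v) / r \<le> shift q a v + e" using r by (simp add: field_simps)
  qed
  then show "shift q a (sm r v) \<le> r * shift q a v" using r by (simp add: field_simps)
qed (simp add: shift_def)

lemma shift_le_self: "sublinear q \<Longrightarrow> a \<in> S \<Longrightarrow> shift q a v \<le> q v"
  using shift_le[of q a v 0] by (cases "v \<in> S") (auto simp: shift_def sublinear_def)

text \<open>This is the term t = 1 of the infimum. For a minimal m, which equals its own shift, it
  reads m (- a) \<le> - m a; sublinearity gives the reverse inequality, so m is odd.\<close>

lemma shift_minus: "sublinear q \<Longrightarrow> a \<in> S \<Longrightarrow> shift q a (- a) \<le> - q a"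
  using shift_le[of q a "- a" 1] mem(3) sublinear_zero by fastforce

text \<open>Zorn's lemma is applied downwards. The pointwise infimum over a chain stays subadditive
  because one of any two members lies below the other, so near-optimal values at v and at w can be
  taken from a single member.\<close>

lemma minimal_sublinear:
  assumes q0: "sublinear q0"
  shows "\<exists>m. sublinear m \<and> (\<forall>v. m v \<le> q0 v) \<and> (\<forall>q. sublinear q \<and> (\<forall>v. q v \<le> m v) \<longrightarrow> q = m)"
proof -
  define \<A> where "\<A> = {q. sublinear q \<and> (\<forall>v. q v \<le> q0 v)}"
  define P where "P q q' \<longleftrightarrow> (\<forall>v. q' v \<le> q v)" for q q' :: "'v \<Rightarrow> real"
  have "\<exists>m\<in>\<A>. \<forall>q\<in>\<A>. P m q \<longrightarrow> q = m"
  proof (rule predicate_Zorn)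
    show "partial_order_on \<A> (relation_of P \<A>)"
    proof (rule partial_order_on_relation_ofI)
      show "P q q'' " if "P q q'" "P q' q''" for q q' q'' using that order_trans unfolding P_def by blast
      show "q = q'" if "P q q'" "P q' q" for q q' using that unfolding P_def by (auto intro: antisym)
    qed (simp add: P_def)
    fix C assume C: "C \<in> Chains (relation_of P \<A>)"
    show "\<exists>u\<in>\<A>. \<forall>a\<in>C. P a u"
    proof (cases "C = {}")
      case True
      then show ?thesis using q0 by (auto simp: \<A>_def)
    next
      case False
      have CA: "C \<subseteq> \<A>" using C by (auto simp: Chains_def relation_of_def)
      have cmp: "P q q' \<or> P q' q" if "q \<in> C" "q' \<in> C" for q q'
        using C that by (auto simp: Chains_def relation_of_def)
      have sl: "sublinear q" "\<And>v. q v \<le> q0 v" if "q \<in> C" for q using CA that by (auto simp: \<A>_def)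
      define u where "u v = (INF q\<in>C. q v)" for v
      \<comment> \<open>On S all members share the lower bound - q0 (- v); the minimum with 0 serves
        the points off S, where they vanish.\<close>
      have bdd: "bdd_below ((\<lambda>q. q v) ` C)" for v
      proof (rule bdd_belowI2)
        fix q assume q: "q \<in> C"
        show "min 0 (- q0 (- v)) \<le> q v"
        proof (cases "v \<in> S")
          case True
          then show ?thesis using sublinear_lower[OF sl(1)[OF q] True] sl(2)[OF q, of "- v"] by linarith
        next
          case False
          then show ?thesis using sl(1)[OF q] by (simp add: sublinear_def)
        qed
      qed
      have le: "u v \<le> q v" if "q \<in> C" for q v unfolding u_def using bdd that by (rule cINF_lower)
      have att: "\<exists>q\<in>C. q v < u v + e" if "e > 0" for v and e :: real
      proof (rule ccontr)
        assume "\<not> ?thesis"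
        then have "u v + e \<le> (INF q\<in>C. q v)" using False by (intro cINF_greatest) (auto simp: not_less)
        then show False using that by (simp add: u_def)
      qed
      have "sublinear u" unfolding sublinear_def
      proof (intro conjI ballI allI impI)
        fix v w assume vw: "v \<in> S" "w \<in> S"
        show "u (v + w) \<le> u v + u w"
        proof (rule field_le_epsilon)
          fix e :: real assume e: "e > 0"
          obtain q where q: "q \<in> C" "q v < u v + e / 2" using att[of "e / 2" v] e by auto
          obtain q' where q': "q' \<in> C" "q' w < u w + e / 2" using att[of "e / 2" w] e by auto
          obtain q'' where q'': "q'' \<in> C" "q'' v \<le> q v" "q'' w \<le> q' w"
            using cmp[OF q(1) q'(1)] q(1) q'(1) unfolding P_def by blast
          have "u (v + w) \<le> q'' v + q'' w"
            using le[OF q''(1), of "v + w"] sublinear_add[OF sl(1)[OF q''(1)] vw] by linarith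
          then show "u (v + w) \<le> u v + u w + e" using q q' q'' by linarith
        qed
      next
        fix r :: real and v assume r: "r > 0" and v: "v \<in> S"
        have "u (sm r v) / r \<le> u v" unfolding u_def[of v]
        proof (rule cINF_greatest[OF False])
          fix q assume q: "q \<in> C"
          then show "u (sm r v) / r \<le> q v"
            using le[OF q, of "sm r v"] sublinear_scale[OF sl(1)[OF q] v r] r by (simp add: field_simps)
        qed
        then show "u (sm r v) \<le> r * u v" using r by (simp add: field_simps)
      next
        fix v assume v: "v \<notin> S"
        have "q v = 0" if "q \<in> C" for q using sl(1)[OF that] v by (simp add: sublinear_def)
        then have "(\<lambda>q. q v) ` C = {0}" using False by force
        then show "u v = 0" by (simp add: u_def)
      qed
      moreover have "u v \<le> q0 v" for v
      proof -
        obtain q where "q \<in> C" using False by blast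
        then show ?thesis using le[of q v] sl(2)[of q v] by linarith
      qed
      ultimately show ?thesis using le by (intro bexI[of _ u]) (auto simp: P_def \<A>_def)
    qed
  qed
  then obtain m where m: "m \<in> \<A>" "\<And>q. q \<in> \<A> \<Longrightarrow> P m q \<Longrightarrow> q = m" by blast
  have "q = m" if q: "sublinear q" "\<forall>v. q v \<le> m v" for q
  proof -
    have "q v \<le> q0 v" for v using q(2) m(1) order_trans[of "q v" "m v" "q0 v"] by (simp add: \<A>_def)
    then show ?thesis using q m(2)[of q] by (simp add: \<A>_def P_def)
  qed
  then show ?thesis using m(1) by (auto simp: \<A>_def)
qed

lemma linear_minorant:
  assumes p: "sublinear p" and v0: "v0 \<in> S"
  obtains l where "\<And>v w. v \<in> S \<Longrightarrow> w \<in> S \<Longrightarrow> l (v + w) = l v + l w"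
    "\<And>r v. v \<in> S \<Longrightarrow> l (sm r v) = r * l v" "\<And>v. l v \<le> p v" "l v0 = p v0"
proof -
  obtain m where m0: "sublinear m" "\<forall>v. m v \<le> shift p v0 v"
    "\<forall>q. sublinear q \<and> (\<forall>v. q v \<le> m v) \<longrightarrow> q = m"
    using minimal_sublinear[OF sublinear_shift[OF p v0]] by blast
  note m = m0(1) m0(2)[rule_format] m0(3)[rule_format, OF conjI]
  have neg: "m (- a) = - m a" if a: "a \<in> S" for a
  proof -
    have "shift m a = m" using a by (intro m(3) sublinear_shift allI shift_le_self m(1))
    then have "m (- a) \<le> - m a" using shift_minus[OF m(1) a] by simp
    moreover have "- m (- a) \<le> m a" using sublinear_lower[OF m(1) a] .
    ultimately show ?thesis by linarith
  qed
  show ?thesis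
  proof (rule that[of m])
    fix v w assume vw: "v \<in> S" "w \<in> S"
    have "m ((v + w) + - w) \<le> m (v + w) + m (- w)" using vw by (intro sublinear_add m mem)
    then have "m v \<le> m (v + w) - m w" using neg vw by simp
    then show "m (v + w) = m v + m w" using sublinear_add[OF m(1) vw] by linarith
  next
    fix r v assume v: "v \<in> S"
    show "m (sm r v) = r * m v"
    proof (cases "r \<ge> 0")
      case True
      then show ?thesis using sublinear_scale_nonneg[OF m(1) v] by simp
    next
      case False
      then have "m (- sm (- r) v) = - ((- r) * m v)"
        using neg[OF mem(4)[OF v]] sublinear_scale_nonneg[OF m(1) v, of "- r"] by simp
      then show ?thesis by simp
    qed
  next
    fix v show le: "m v \<le> p v" for v using m(2)[of v] shift_le_self[OF p v0, of v] by linarith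
    have "m (- v0) \<le> - p v0" using m(2)[of "- v0"] shift_minus[OF p v0] by linarith
    then show "m v0 = p v0" using neg[OF v0] le[of v0] by linarith
  qed
qed

end

section \<open>Polars, norming functionals and the Alaoglu theorem\<close>

lemma vsp_scalars [simp]: "vsp (scalars :: ('k::real_or_complex, 'k) tvs) = UNIV"
  by (simp add: vsp_def scalars_def)

lemma scl_scalars [simp]: "scl scalars = (*)"
  by (simp add: scalars_def)

context seminormed_space
begin

text \<open>Continuity is encoded by the bound by \<open>p \<alpha>\<close>, a condition on the
  values at single points. This keeps the set closed under pointwise convergence, which
  \<open>compact_polar\<close> exploits.\<close>

definition polar :: "'a \<Rightarrow> ('v \<Rightarrow> 'k) set" where
  "polar \<alpha> = {l. linear_on X scalars l \<and> (\<forall>v\<in>vsp X. norm (l v) \<le> p \<alpha> v) \<and> (\<forall>v. v \<notin> vsp X \<longrightarrow> l v = 0)}"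

lemma polar_add: "l \<in> polar \<alpha> \<Longrightarrow> v \<in> vsp X \<Longrightarrow> w \<in> vsp X \<Longrightarrow> l (v + w) = l v + l w"
  by (simp add: polar_def linear_on_def)

lemma polar_scl: "l \<in> polar \<alpha> \<Longrightarrow> v \<in> vsp X \<Longrightarrow> l (scl X c v) = c * l v"
  by (simp add: polar_def linear_on_def)

lemma polar_le: "l \<in> polar \<alpha> \<Longrightarrow> v \<in> vsp X \<Longrightarrow> norm (l v) \<le> p \<alpha> v"
  by (simp add: polar_def)

lemma polar_zero: "l \<in> polar \<alpha> \<Longrightarrow> l 0 = 0"
  using polar_scl[of l \<alpha> 0 0] by simp

lemma polar_diff: "l \<in> polar \<alpha> \<Longrightarrow> v \<in> vsp X \<Longrightarrow> w \<in> vsp X \<Longrightarrow> l (v - w) = l v - l w"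
  using polar_add[of l \<alpha> "v - w" w] diff_mem by simp

lemma polar_sum: "l \<in> polar \<alpha> \<Longrightarrow> (\<And>i. i \<in> I \<Longrightarrow> v i \<in> vsp X) \<Longrightarrow> l (sum v I) = (\<Sum>i\<in>I. l (v i))"
  by (induction I rule: infinite_finite_induct) (auto simp: polar_zero polar_add sum_mem)

theorem hahn_banach:
  assumes \<alpha>: "\<alpha> \<in> A" and v0: "v0 \<in> vsp X"
  obtains l where "l \<in> polar \<alpha>" "norm (l v0) = p \<alpha> v0"
proof -
  let ?rs = "\<lambda>r::real. scl X (of_real r)"
  interpret R: real_subspace ?rs "vsp X"
  proof (rule real_subspace.intro)
    show "vector_space ?rs"
      by unfold_locales (simp_all add: V.scale_right_distrib V.scale_left_distrib)
    then interpret R': vector_space ?rs .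
    show "R'.subspace (vsp X)" using mems by (auto simp: R'.subspace_def)
  qed
  define q where "q v = (if v \<in> vsp X then p \<alpha> v else 0)" for v
  have "R.sublinear q" using \<alpha> by (auto simp: R.sublinear_def q_def mems p_add p_scl)
  then obtain h where h: "\<And>v w. v \<in> vsp X \<Longrightarrow> w \<in> vsp X \<Longrightarrow> h (v + w) = h v + h w"
    "\<And>r v. v \<in> vsp X \<Longrightarrow> h (scl X (of_real r) v) = r * h v" "\<And>v. h v \<le> q v" "h v0 = q v0"
    using R.linear_minorant[OF _ v0] by metis
  have bound: "\<bar>h v\<bar> \<le> p \<alpha> v" if "v \<in> vsp X" for v
  proof -
    have "h (scl X (of_real (-1)) v) = - h v" using h(2)[OF that, of "-1"] by simp
    then show ?thesis using h(3)[of v] h(3)[of "scl X (of_real (-1)) v"] that \<alpha>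
      by (auto simp: q_def mems p_minus)
  qed
  have hv0: "h v0 = p \<alpha> v0" using h(4) v0 by (simp add: q_def)
  from scalar_decomposition[where 'k='k] show ?thesis
  proof
    assume re: "\<forall>c::'k. \<exists>r. c = of_real r"
    define l where "l v = (if v \<in> vsp X then of_real (h v) else 0 :: 'k)" for v
    have "l (scl X c v) = c * l v" if "v \<in> vsp X" for c v
      using re[rule_format, of c] that h(2)[OF that] by (auto simp: l_def mems)
    then have "l \<in> polar \<alpha>" using h(1) bound by (auto simp: polar_def linear_on_def l_def mems)
    moreover have "norm (l v0) = p \<alpha> v0" using hv0 v0 p_nonneg[OF \<alpha> v0] by (simp add: l_def)
    ultimately show ?thesis by (rule that)
  next
    assume "\<exists>I::'k. I * I = - 1 \<and> (\<forall>c. \<exists>a b. c = of_real a + of_real b * I) \<and>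
      (\<forall>a b. \<bar>a\<bar> \<le> norm (of_real a + of_real b * I))"
    then obtain I :: 'k where I: "I * I = - 1" "\<And>c. \<exists>a b. c = of_real a + of_real b * I"
      "\<And>a b. \<bar>a\<bar> \<le> norm (of_real a + of_real b * I)" by blast
    \<comment> \<open>The only functional compatible with multiplication by I whose real part is
      h.\<close>
    define l where "l v = (if v \<in> vsp X then of_real (h v) - I * of_real (h (scl X I v)) else 0 :: 'k)" for v
    have II: "scl X I (scl X I v) = - v" for v using I(1) by simp
    have add: "l (v + w) = l v + l w" if "v \<in> vsp X" "w \<in> vsp X" for v w
      using that h(1) by (simp add: l_def mems V.scale_right_distrib algebra_simps)
    have r: "l (scl X (of_real r) v) = of_real r * l v" if v: "v \<in> vsp X" for r v
    proof -
      have "scl X I (scl X (of_real r) v) = scl X (of_real r) (scl X I v)" by (simp add: mult.commute)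
      then show ?thesis using v h(2)[OF v] h(2)[OF scl_mem[OF v]] by (simp add: l_def mems algebra_simps)
    qed
    have i: "l (scl X I v) = I * l v" if v: "v \<in> vsp X" for v
    proof -
      have "h (- v) = - h v" using h(2)[OF v, of "-1"] by simp
      then have "l (scl X I v) = of_real (h (scl X I v)) + I * of_real (h v)" using v II by (simp add: l_def mems)
      also have "\<dots> = I * l v" using v I(1) by (simp add: l_def right_diff_distrib mult.assoc[symmetric])
      finally show ?thesis .
    qed
    have scl: "l (scl X c v) = c * l v" if v: "v \<in> vsp X" for c v
    proof -
      obtain a b where c: "c = of_real a + of_real b * I" using I(2) by blast
      have "scl X c v = scl X (of_real a) v + scl X (of_real b) (scl X I v)"
        by (simp add: c V.scale_left_distrib)
      then have "l (scl X c v) = l (scl X (of_real a) v) + l (scl X (of_real b) (scl X I v))"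
        by (simp only: add scl_mem v)
      also have "\<dots> = of_real a * l v + of_real b * (I * l v)" by (simp only: r i scl_mem v)
      finally show ?thesis by (simp add: c algebra_simps)
    qed
    have lower: "\<bar>h v\<bar> \<le> norm (l v)" if "v \<in> vsp X" for v
      using I(3)[of "h v" "- h (scl X I v)"] that by (simp add: l_def mult.commute)
    have upper: "norm (l v) \<le> p \<alpha> v" if v: "v \<in> vsp X" for v
    proof (cases "l v = 0")
      case True
      then show ?thesis using p_nonneg[OF \<alpha> v] by simp
    next
      case False
      define t where "t = norm (l v)"
      \<comment> \<open>Rotates v so that l takes the real value norm (l v) there. At such a vector
        l agrees with h, and h obeys the bound by p \<alpha>.\<close>
      define c where "c = of_real t / l v"
      have c: "norm c = 1" using False by (simp add: c_def t_def norm_divide)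
      have cv: "scl X c v \<in> vsp X" using v by (rule scl_mem)
      have "l (scl X c v) = of_real t" using scl[OF v, of c] False by (simp add: c_def)
      \<comment> \<open>A real scalar equals I times a real scalar; squaring turns this into a
        vanishing sum of two squares, which forces h (scl X c v) = t.\<close>
      then have "of_real (h (scl X c v) - t) = I * of_real (h (scl X I (scl X c v)))"
        using cv by (simp add: l_def algebra_simps)
      then have "(of_real (h (scl X c v) - t) :: 'k)\<^sup>2 = (I * I) * (of_real (h (scl X I (scl X c v))))\<^sup>2"
        by (simp only: power2_eq_square mult_ac)
      then have "(of_real (h (scl X c v) - t) :: 'k)\<^sup>2 = - (of_real (h (scl X I (scl X c v))))\<^sup>2"
        by (simp only: I(1) mult_minus_left mult_1_left)
      then have "(of_real ((h (scl X c v) - t)\<^sup>2 + (h (scl X I (scl X c v)))\<^sup>2) :: 'k) = 0" by simp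
      then have "(h (scl X c v) - t)\<^sup>2 + (h (scl X I (scl X c v)))\<^sup>2 = 0"
        by (simp only: of_real_eq_0_iff)
      then have "h (scl X c v) = t" by (simp add: sum_power2_eq_zero_iff)
      then show ?thesis using bound[OF cv] c p_scl[OF \<alpha> v, of c] by (simp add: t_def)
    qed
    have "l \<in> polar \<alpha>" using add scl upper by (simp add: polar_def linear_on_def l_def)
    moreover have "norm (l v0) = p \<alpha> v0"
      using lower[OF v0] upper[OF v0] hv0 p_nonneg[OF \<alpha> v0] by simp
    ultimately show ?thesis by (rule that)
  qed
qed

text \<open>Alaoglu's theorem: the polar is a closed subset of a product of compact balls. Off the
  space the radius is 0, in accordance with the convention that members of \<open>polar\<close>
  vanish there.\<close>

lemma compact_polar: "compact (polar \<alpha>)"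
proof -
  let ?r = "\<lambda>v. if v \<in> vsp X then p \<alpha> v else 0"
  have "polar \<alpha> = (\<Pi>\<^sub>E v\<in>UNIV. cball 0 (?r v)) \<inter>
      ((\<Inter>v\<in>vsp X. \<Inter>w\<in>vsp X. {l. l (v + w) = l v + l w}) \<inter>
       (\<Inter>c. \<Inter>v\<in>vsp X. {l. l (scl X c v) = c * l v}))"
    by (fastforce simp: polar_def linear_on_def PiE_def Pi_def split: if_splits)
  moreover have "compact (\<Pi>\<^sub>E v\<in>UNIV. cball 0 (?r v) :: 'k set)"
    using compactin_PiE[of "\<lambda>_. euclidean" UNIV "\<lambda>v. cball 0 (?r v) :: 'k set"]
    by (simp add: euclidean_product_topology compact_cball_scalar)
  moreover have "closed {l :: 'v \<Rightarrow> 'k. l (v + w) = l v + l w}" for v w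
    by (intro closed_Collect_eq continuous_intros continuous_on_product_coordinates)
  moreover have "closed {l :: 'v \<Rightarrow> 'k. l (scl X c v) = c * l v}" for c v
    by (intro closed_Collect_eq continuous_intros continuous_on_product_coordinates)
  ultimately show ?thesis by (auto intro!: compact_Int_closed closed_Int closed_INT)
qed

end

section \<open>Partitions of unity on locally compact spaces\<close>

lemma Hausdorff_space_euclidean_t2: "Hausdorff_space (euclidean :: 'x::t2_space topology)"
  unfolding Hausdorff_space_def
proof (intro allI impI)
  fix x y :: 'x assume "x \<in> topspace euclidean \<and> y \<in> topspace euclidean \<and> x \<noteq> y"
  then obtain U V where "open U" "open V" "x \<in> U" "y \<in> V" "U \<inter> V = {}" using hausdorff[of x y] by auto
  then show "\<exists>U V. openin euclidean U \<and> openin euclidean V \<and> x \<in> U \<and> y \<in> V \<and> disjnt U V"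
    by (intro exI[of _ U] exI[of _ V]) (simp add: disjnt_def)
qed

lemma compact_between_open:
  fixes K V :: "'x::t2_space set"
  assumes lc: "locally_compact_space (euclidean :: 'x topology)"
    and K: "compact K" and V: "open V" "K \<subseteq> V"
  obtains W L where "open W" "compact L" "K \<subseteq> W" "W \<subseteq> L" "L \<subseteq> V"
proof -
  have "neighbourhood_base_of (compactin euclidean) (euclidean :: 'x topology)"
    using lc locally_compact_space_neighbourhood_base[of "euclidean :: 'x topology"]
    by (simp add: Hausdorff_space_euclidean_t2)
  then have "\<forall>x\<in>K. \<exists>U C. open U \<and> compact C \<and> x \<in> U \<and> U \<subseteq> C \<and> C \<subseteq> V"
    using V unfolding neighbourhood_base_of by (simp add: subset_iff)
  then obtain U C where UC: "\<And>x. x \<in> K \<Longrightarrow> open (U x) \<and> compact (C x) \<and> x \<in> U x \<and> U x \<subseteq> C x \<and> C x \<subseteq> V"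
    by metis
  have "K \<subseteq> \<Union>(U ` K)" using UC by blast
  moreover have "\<And>B. B \<in> U ` K \<Longrightarrow> open B" using UC by blast
  ultimately obtain \<F> where F: "\<F> \<subseteq> U ` K" "finite \<F>" "K \<subseteq> \<Union>\<F>" using compactE[OF K] by metis
  then obtain N where N: "N \<subseteq> K" "finite N" "\<F> = U ` N" using finite_subset_image[of \<F> U K] by blast
  show ?thesis
  proof (rule that[of "\<Union>(U ` N)" "\<Union>(C ` N)"])
    show "open (\<Union>(U ` N))" using UC N by blast
    show "compact (\<Union>(C ` N))" using UC N by (intro compact_UN) auto
    show "K \<subseteq> \<Union>(U ` N)" using F N by simp
    show "\<Union>(U ` N) \<subseteq> \<Union>(C ` N)" "\<Union>(C ` N) \<subseteq> V" using UC N by blast+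
  qed
qed

text \<open>The order of quantifiers matters: L is fixed before the cover U. A bound for a weight on
  L is therefore available when the tolerance is chosen that determines U.\<close>

definition subordinate_partitions :: "'x::topological_space set \<Rightarrow> 'x set \<Rightarrow> bool" where
  "subordinate_partitions K L \<longleftrightarrow> (\<forall>U. (\<forall>z\<in>K. open (U z) \<and> z \<in> U z) \<longrightarrow>
     (\<exists>Z \<phi>. finite Z \<and> Z \<subseteq> K \<and> (\<forall>z\<in>Z. continuous_on UNIV (\<phi> z)) \<and>
        (\<forall>z\<in>Z. \<forall>x. 0 \<le> (\<phi> z x :: real) \<and> (\<phi> z x \<noteq> 0 \<longrightarrow> x \<in> U z \<inter> L)) \<and>
        (\<forall>x. (\<Sum>z\<in>Z. \<phi> z x) \<le> 1) \<and> (\<forall>x\<in>K. (\<Sum>z\<in>Z. \<phi> z x) = 1)))"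

text \<open>Finitely many bump functions, each equal to one at its centre, are rescaled so that their sum is
  at least one on \<open>K\<close>; dividing by the maximum of one and this sum makes the sum equal to one there.\<close>

lemma partition_of_unity_on_compact:
  fixes K V :: "'x::t2_space set"
  assumes lc: "locally_compact_space (euclidean :: 'x topology)"
    and K: "compact K" and V: "open V" "K \<subseteq> V"
  obtains L where "compact L" "L \<subseteq> V" "subordinate_partitions K L"
proof -
  obtain W L where WL: "open W" "compact L" "K \<subseteq> W" "W \<subseteq> L" "L \<subseteq> V"
    using compact_between_open[OF assms] .
  have cr: "completely_regular_space (euclidean :: 'x topology)"
    using lc by (intro locally_compact_regular_imp_completely_regular_space) (simp_all add: Hausdorff_space_euclidean_t2)
  show ?thesis
  proof (rule that[of L])
    show "compact L" "L \<subseteq> V" using WL by auto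
    show "subordinate_partitions K L" unfolding subordinate_partitions_def
    proof (intro allI impI)
      fix U assume "\<forall>z\<in>K. open (U z) \<and> z \<in> U z"
      then have U: "\<And>z. z \<in> K \<Longrightarrow> open (U z) \<and> z \<in> U z" by blast
      \<comment> \<open>Each bump vanishes off the open set W inside L. Since W is chosen before the
        cover, the common support L does not depend on U.\<close>
      have "\<exists>f. continuous_on UNIV f \<and> (\<forall>x. 0 \<le> f x) \<and> (\<forall>x. f x \<noteq> 0 \<longrightarrow> x \<in> U z \<inter> W) \<and> f z = (1::real)"
        if z: "z \<in> K" for z
      proof -
        have "closed (- (U z \<inter> W))" using U[OF z] WL(1) unfolding closed_def double_complement by (intro open_Int) auto
        moreover have "z \<in> U z \<inter> W" using U[OF z] WL z by blast
        ultimately obtain f where f: "continuous_map euclidean (subtopology euclidean {0..1::real}) f"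
          "f ` (- (U z \<inter> W)) \<subseteq> {0}" "f ` {z} \<subseteq> {1}"
          using Urysohn_completely_regular_compact_closed[OF zero_le_one cr, of "{z}" "- (U z \<inter> W)"] by auto
        then have "continuous_on UNIV f" "\<forall>x. f x \<in> {0..1}"
          by (auto simp: continuous_map_in_subtopology)
        then show ?thesis using f(2,3) by (intro exI[of _ f]) (auto simp: image_subset_iff)
      qed
      then obtain f where f: "\<And>z. z \<in> K \<Longrightarrow> continuous_on UNIV (f z)" "\<And>z x. z \<in> K \<Longrightarrow> 0 \<le> f z x"
        "\<And>z x. z \<in> K \<Longrightarrow> f z x \<noteq> 0 \<Longrightarrow> x \<in> U z \<inter> W" "\<And>z. z \<in> K \<Longrightarrow> f z z = (1::real)" by metis
      let ?B = "\<lambda>z. {x. 1/2 < f z x}"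
      have "open (?B z)" if "z \<in> K" for z using f(1)[OF that] by (intro open_Collect_less continuous_intros)
      then have "\<And>B. B \<in> ?B ` K \<Longrightarrow> open B" by blast
      moreover have "K \<subseteq> \<Union>(?B ` K)" using f(4) by force
      ultimately obtain \<F> where F: "\<F> \<subseteq> ?B ` K" "finite \<F>" "K \<subseteq> \<Union>\<F>" using compactE[OF K] by metis
      then obtain Z where Z: "Z \<subseteq> K" "finite Z" "\<F> = ?B ` Z" using finite_subset_image[of \<F> ?B K] by blast
      define s where "s x = (\<Sum>z\<in>Z. 2 * f z x)" for x
      define \<phi> where "\<phi> z x = 2 * f z x / max 1 (s x)" for z x
      have s: "continuous_on UNIV s" unfolding s_def using f Z by (intro continuous_intros) auto
      have m: "max 1 (s x) \<ge> 1" for x by simp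
      have sum: "(\<Sum>z\<in>Z. \<phi> z x) = s x / max 1 (s x)" for x
        unfolding \<phi>_def s_def by (simp add: sum_divide_distrib)
      have "continuous_on UNIV (\<phi> z)" if "z \<in> Z" for z
        unfolding \<phi>_def using f(1) s that Z by (intro continuous_intros) (auto simp: max_def)
      moreover have "0 \<le> \<phi> z x" if "z \<in> Z" for z x
        unfolding \<phi>_def using f(2) that Z by (intro divide_nonneg_pos mult_nonneg_nonneg) (auto simp: max_def)
      moreover have "x \<in> U z \<inter> L" if "z \<in> Z" "\<phi> z x \<noteq> 0" for z x
        using f(3)[of z x] that Z WL by (auto simp: \<phi>_def)
      moreover have "(\<Sum>z\<in>Z. \<phi> z x) \<le> 1" for x unfolding sum by (simp add: max_def)
      moreover have "(\<Sum>z\<in>Z. \<phi> z x) = 1" if "x \<in> K" for x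
      proof -
        have "x \<in> \<Union>(?B ` Z)" using F(3) that unfolding Z(3) by (rule subsetD)
        then obtain z where z: "z \<in> Z" "1/2 < f z x" by blast
        then have "2 * f z x \<le> s x" unfolding s_def using Z f by (intro member_le_sum) auto
        then show ?thesis using z unfolding sum by (simp add: max_def)
      qed
      ultimately show "\<exists>Z \<phi>. finite Z \<and> Z \<subseteq> K \<and> (\<forall>z\<in>Z. continuous_on UNIV (\<phi> z)) \<and>
          (\<forall>z\<in>Z. \<forall>x. 0 \<le> (\<phi> z x :: real) \<and> (\<phi> z x \<noteq> 0 \<longrightarrow> x \<in> U z \<inter> L)) \<and>
          (\<forall>x. (\<Sum>z\<in>Z. \<phi> z x) \<le> 1) \<and> (\<forall>x\<in>K. (\<Sum>z\<in>Z. \<phi> z x) = 1)"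
        using Z by (intro exI[of _ Z] exI[of _ \<phi>]) blast
    qed
  qed
qed

section \<open>Weighted spaces as spaces with a fundamental system of seminorms\<close>

context seminormed_space
begin

lemma continuous_map_plus:
  assumes "continuous_map T (vtop X) f" "continuous_map T (vtop X) g"
  shows "continuous_map T (vtop X) (\<lambda>t. f t + g t)"
  unfolding continuous_map_into_iff
proof (intro conjI ballI allI impI)
  have m: "f \<in> topspace T \<rightarrow> vsp X" "g \<in> topspace T \<rightarrow> vsp X"
    using assms unfolding continuous_map_into_iff by auto
  then show "(\<lambda>t. f t + g t) \<in> topspace T \<rightarrow> vsp X" by (auto intro: add_mem)
  fix t \<alpha> and \<epsilon> :: real assume t: "t \<in> topspace T" "\<alpha> \<in> A" "\<epsilon> > 0"
  then have e: "\<epsilon> / 2 > 0" by simp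
  obtain U where U: "openin T U" "t \<in> U" "\<forall>s\<in>U. p \<alpha> (f s - f t) < \<epsilon> / 2"
    using assms(1) t e unfolding continuous_map_into_iff by blast
  obtain V where V: "openin T V" "t \<in> V" "\<forall>s\<in>V. p \<alpha> (g s - g t) < \<epsilon> / 2"
    using assms(2) t e unfolding continuous_map_into_iff by blast
  have "p \<alpha> ((f s + g s) - (f t + g t)) < \<epsilon>" if s: "s \<in> U \<inter> V" for s
  proof -
    have "s \<in> topspace T" using s U(1) openin_subset by blast
    then have fg: "f s \<in> vsp X" "g s \<in> vsp X" "f t \<in> vsp X" "g t \<in> vsp X" using m t by auto
    have "p \<alpha> ((f s - f t) + (g s - g t)) \<le> p \<alpha> (f s - f t) + p \<alpha> (g s - g t)"
      using fg t by (intro p_add diff_mem)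
    also have "\<dots> < \<epsilon> / 2 + \<epsilon> / 2" using U V s by (intro add_strict_mono) auto
    finally show ?thesis by (simp add: algebra_simps)
  qed
  then show "\<exists>U. openin T U \<and> t \<in> U \<and> (\<forall>s\<in>U. p \<alpha> ((f s + g s) - (f t + g t)) < \<epsilon>)"
    using U V by (intro exI[of _ "U \<inter> V"]) auto
qed

lemma continuous_map_scl:
  assumes "continuous_map T (vtop X) f"
  shows "continuous_map T (vtop X) (\<lambda>t. scl X c (f t))"
  unfolding continuous_map_into_iff
proof (intro conjI ballI allI impI)
  have m: "f \<in> topspace T \<rightarrow> vsp X" using assms unfolding continuous_map_into_iff by auto
  then show "(\<lambda>t. scl X c (f t)) \<in> topspace T \<rightarrow> vsp X" by (auto intro: scl_mem)
  fix t \<alpha> and \<epsilon> :: real assume t: "t \<in> topspace T" "\<alpha> \<in> A" "\<epsilon> > 0"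
  then have "\<epsilon> / (norm c + 1) > 0" by (simp add: add_nonneg_pos)
  then obtain U where U: "openin T U" "t \<in> U" "\<forall>s\<in>U. p \<alpha> (f s - f t) < \<epsilon> / (norm c + 1)"
    using assms(1) t unfolding continuous_map_into_iff by blast
  have "p \<alpha> (scl X c (f s) - scl X c (f t)) < \<epsilon>" if s: "s \<in> U" for s
  proof -
    have "s \<in> topspace T" using s U(1) openin_subset by blast
    then have f: "f s - f t \<in> vsp X" using m t by (auto intro: diff_mem)
    have pos: "norm c + 1 > 0" by (simp add: add_nonneg_pos)
    have "p \<alpha> (scl X c (f s) - scl X c (f t)) = norm c * p \<alpha> (f s - f t)"
      using p_scl[OF t(2) f] by (simp add: V.scale_right_diff_distrib)
    also have "\<dots> \<le> (norm c + 1) * p \<alpha> (f s - f t)"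
      using p_nonneg[OF t(2) f] by (intro mult_right_mono) auto
    also have "\<dots> < \<epsilon>" using U(3) s pos by (simp add: field_simps)
    finally show ?thesis .
  qed
  then show "\<exists>U. openin T U \<and> t \<in> U \<and> (\<forall>s\<in>U. p \<alpha> (scl X c (f s) - scl X c (f t)) < \<epsilon>)"
    using U by blast
qed

lemma continuous_map_zero: "continuous_map T (vtop X) (\<lambda>t. 0)"
  using zero_mem by (simp add: vsp_def)

lemma continuous_map_scalar_mult:
  assumes \<phi>: "continuous_map T euclidean \<phi>" and e: "e \<in> vsp X"
  shows "continuous_map T (vtop X) (\<lambda>x. scl X (\<phi> x) e)"
  unfolding continuous_map_into_iff
proof (intro conjI ballI allI impI)
  show "(\<lambda>x. scl X (\<phi> x) e) \<in> topspace T \<rightarrow> vsp X" using e by (auto intro: scl_mem)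
  fix t \<alpha> and \<epsilon> :: real assume t: "t \<in> topspace T" "\<alpha> \<in> A" "\<epsilon> > 0"
  define \<delta> where "\<delta> = \<epsilon> / (p \<alpha> e + 1)"
  have pos: "p \<alpha> e + 1 > 0" using p_nonneg[OF t(2) e] by simp
  have \<delta>: "\<delta> > 0" unfolding \<delta>_def using t pos by simp
  have "openin T {s \<in> topspace T. \<phi> s \<in> ball (\<phi> t) \<delta>}"
    by (rule openin_continuous_map_preimage[OF \<phi>]) simp
  moreover have "p \<alpha> (scl X (\<phi> s) e - scl X (\<phi> t) e) < \<epsilon>" if "\<phi> s \<in> ball (\<phi> t) \<delta>" for s
  proof -
    have "p \<alpha> (scl X (\<phi> s) e - scl X (\<phi> t) e) = norm (\<phi> s - \<phi> t) * p \<alpha> e"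
      using p_scl[OF t(2) e] by (simp add: V.scale_left_diff_distrib[symmetric])
    also have "\<dots> \<le> norm (\<phi> s - \<phi> t) * (p \<alpha> e + 1)" by (intro mult_left_mono) auto
    also have "\<dots> < \<epsilon>" using that pos by (simp add: \<delta>_def dist_norm norm_minus_commute field_simps)
    finally show ?thesis .
  qed
  ultimately show "\<exists>U. openin T U \<and> t \<in> U \<and> (\<forall>s\<in>U. p \<alpha> (scl X (\<phi> s) e - scl X (\<phi> t) e) < \<epsilon>)"
    using \<delta> t by (intro exI[of _ "{s \<in> topspace T. \<phi> s \<in> ball (\<phi> t) \<delta>}"]) auto
qed

lemma continuous_map_sum:
  assumes "\<And>i. i \<in> I \<Longrightarrow> continuous_map T (vtop X) (f i)"
  shows "continuous_map T (vtop X) (\<lambda>t. \<Sum>i\<in>I. f i t)"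
  using assms
  by (induction I rule: infinite_finite_induct)
    (use continuous_map_zero[of T] in \<open>auto intro: continuous_map_plus\<close>)

text \<open>The restricted seminorms define a space ?Y of their own, where \<open>openin_iff\<close>
  is available. Its topology is the subspace topology because an open set of ?Y is covered by traces
  of balls of X.\<close>

lemma subspace_seminormed_space:
  assumes S: "module.subspace (scl X) S" "S \<subseteq> vsp X"
  shows "seminormed_space (subspace_tvs X S) A p"
proof -
  let ?Y = "\<lparr>scl = scl X, vtop = seminorm_topology S (p ` A)\<rparr>"
  have vspY: "vsp ?Y = S" by (simp add: vsp_def seminorm_topology_def)
  have Y: "seminormed_space ?Y A p"
  proof (rule seminormed_space.intro)
    show "vector_space (scl ?Y)" using vector_space_scl by simp
    show "module.subspace (scl ?Y) (vsp ?Y)" using S vspY by simp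
    have "seminorm_on ?Y (p \<alpha>)" if "\<alpha> \<in> A" for \<alpha>
      using seminorm[OF that] S vspY unfolding seminorm_on_def by (auto simp: subset_iff)
    moreover have "\<exists>\<gamma>\<in>A. \<exists>C>0. \<forall>v\<in>S. p \<alpha> v \<le> C * p \<gamma> v \<and> p \<beta> v \<le> C * p \<gamma> v"
      if ab: "\<alpha> \<in> A" "\<beta> \<in> A" for \<alpha> \<beta>
    proof -
      obtain \<gamma> C where "\<gamma> \<in> A" "C > 0" "\<forall>v\<in>vsp X. p \<alpha> v \<le> C * p \<gamma> v \<and> p \<beta> v \<le> C * p \<gamma> v"
        using directed[OF ab] by blast
      then show ?thesis using S(2) by (intro bexI[of _ \<gamma>] exI[of _ C]) auto
    qed
    ultimately show "fundamental_seminorms ?Y A p"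
      using index_nonempty vspY unfolding fundamental_seminorms_def by simp
  qed
  interpret Y: seminormed_space ?Y A p by (rule Y)
  have "openin (vtop ?Y) U \<longleftrightarrow> openin (subtopology (vtop X) S) U" for U
  proof
    assume "openin (vtop ?Y) U"
    then have U: "U \<subseteq> S" "\<forall>x\<in>U. \<exists>\<alpha>\<in>A. \<exists>r>0. \<forall>y\<in>S. p \<alpha> (y - x) < r \<longrightarrow> y \<in> U"
      unfolding Y.openin_iff vspY by auto
    have "\<exists>W. openin (vtop X) W \<and> x \<in> W \<and> W \<inter> S \<subseteq> U" if x: "x \<in> U" for x
    proof -
      obtain \<alpha> r where a: "\<alpha> \<in> A" "r > 0" "\<forall>y\<in>S. p \<alpha> (y - x) < r \<longrightarrow> y \<in> U" using U x by blast
      have xX: "x \<in> vsp X" using x U S by blast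
      then show ?thesis using a p_zero openin_ball[OF a(1) xX, of r]
        by (intro exI[of _ "{v \<in> vsp X. p \<alpha> (v - x) < r}"]) auto
    qed
    then obtain W where W: "\<And>x. x \<in> U \<Longrightarrow> openin (vtop X) (W x) \<and> x \<in> W x \<and> W x \<inter> S \<subseteq> U" by metis
    have "openin (vtop X) (\<Union>(W ` U))" using W by blast
    moreover have "U = \<Union>(W ` U) \<inter> S" using W U(1) by blast
    ultimately show "openin (subtopology (vtop X) S) U" unfolding openin_subtopology by blast
  next
    assume "openin (subtopology (vtop X) S) U"
    then obtain T where T: "openin (vtop X) T" "U = T \<inter> S" unfolding openin_subtopology by blast
    then show "openin (vtop ?Y) U" unfolding Y.openin_iff vspY using S(2)
      unfolding openin_iff by blast
  qed
  then have "vtop ?Y = subtopology (vtop X) S" by (simp add: topology_eq)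
  then have "?Y = subspace_tvs X S" by (simp add: subspace_tvs_def)
  then show ?thesis using Y by simp
qed

end

text \<open>Finiteness is essential here, since \<open>enn2real\<close> maps infinity to 0.\<close>

lemma wsup_upper:
  assumes "wsup M w q f < top" "x \<in> M"
  shows "q (f x) * w x \<le> enn2real (wsup M w q f)"
proof -
  have "ennreal (q (f x) * w x) \<le> wsup M w q f" unfolding wsup_def using assms(2) by (rule SUP_upper)
  then have "enn2real (ennreal (q (f x) * w x)) \<le> enn2real (wsup M w q f)"
    using assms(1) by (intro enn2real_mono) auto
  \<comment> \<open>A negative product is sent to 0 by \<open>ennreal\<close>, and 0 still lies
    above it.\<close>
  moreover have "q (f x) * w x \<le> enn2real (ennreal (q (f x) * w x))"
    using enn2real_nonneg[of "ennreal (q (f x) * w x)"] by (cases "0 \<le> q (f x) * w x") (simp, linarith)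
  ultimately show ?thesis by linarith
qed

lemma wsup_least: "(\<And>x. x \<in> M \<Longrightarrow> q (f x) * w x \<le> c) \<Longrightarrow> wsup M w q f \<le> ennreal c"
  unfolding wsup_def by (intro SUP_least ennreal_leI)

lemma wsup_finite_iff: "wsup M w q f < top \<longleftrightarrow> (\<exists>c. \<forall>x\<in>M. q (f x) * w x \<le> c)"
proof
  assume "\<exists>c. \<forall>x\<in>M. q (f x) * w x \<le> c"
  then obtain c where "wsup M w q f \<le> ennreal c" using wsup_least by metis
  then show "wsup M w q f < top" by (rule order_le_less_trans) simp
next
  assume "wsup M w q f < top"
  then have "\<forall>x\<in>M. q (f x) * w x \<le> enn2real (wsup M w q f)" by (intro ballI wsup_upper)
  then show "\<exists>c. \<forall>x\<in>M. q (f x) * w x \<le> c" ..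
qed

text \<open>A seminorm of a weighted space depends on a weight and on a seminorm of the range;
  pairing the two makes J \<times> A the single index set that \<open>seminormed_space\<close>
  expects.\<close>

definition wnorm :: "('j \<Rightarrow> 'x \<Rightarrow> real) \<Rightarrow> ('a \<Rightarrow> 'v \<Rightarrow> real) \<Rightarrow> 'j \<times> 'a \<Rightarrow> ('x \<Rightarrow> 'v) \<Rightarrow> real" where
  "wnorm \<nu> p i f = enn2real (wsup UNIV (\<nu> (fst i)) (p (snd i)) f)"

locale weights =
  fixes J :: "'j set" and \<nu> :: "'j \<Rightarrow> 'x::t2_space \<Rightarrow> real"
  assumes loc_compact: "locally_compact_space (euclidean :: 'x topology)"
    and family: "weight_family J \<nu>"
    and bounded: "locally_bounded_weights J \<nu>"
    and away: "locally_bounded_away_from_zero J \<nu>"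
begin

lemma nu_nonneg: "j \<in> J \<Longrightarrow> 0 \<le> \<nu> j x" using family by (simp add: weight_family_def)

lemma nu_directed: "i \<in> J \<Longrightarrow> j \<in> J \<Longrightarrow> \<exists>k\<in>J. \<exists>C>0. \<forall>x. \<nu> i x \<le> C * \<nu> k x \<and> \<nu> j x \<le> C * \<nu> k x"
  using family by (simp add: weight_family_def)

lemma nu_positive: "\<exists>j\<in>J. 0 < \<nu> j x" using family by (simp add: weight_family_def)

lemma nu_bounded:
  assumes "compact K" "j \<in> J"
  obtains C where "C > 0" "\<And>x. x \<in> K \<Longrightarrow> \<nu> j x \<le> C"
proof -
  \<comment> \<open>With the constant 1 in place of a seminorm, \<open>wsup\<close> is the supremum
    of the weight itself, so \<open>wsup_finite_iff\<close> yields a real bound.\<close>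
  have "wsup K (\<lambda>x. \<nu> j x) (\<lambda>_. 1) (\<lambda>x. x) < top"
    using assms bounded by (simp add: wsup_def locally_bounded_weights_def)
  then obtain c where "\<forall>x\<in>K. \<nu> j x \<le> c" unfolding wsup_finite_iff by auto
  then show ?thesis by (intro that[of "max c 1"]) auto
qed

lemma nu_away:
  assumes "compact K"
  obtains j c where "j \<in> J" "c > 0" "\<And>x. x \<in> K \<Longrightarrow> c \<le> \<nu> j x"
proof -
  obtain j where j: "j \<in> J" "(INF x\<in>K. ennreal (\<nu> j x)) > 0"
    using away assms by (auto simp: locally_bounded_away_from_zero_def)
  \<comment> \<open>The infimum over an empty K is infinite; the minimum with 1 keeps the bound a
    positive real number.\<close>
  define d where "d = min (INF x\<in>K. ennreal (\<nu> j x)) 1"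
  have d: "d < \<infinity>" "d > 0" using j unfolding d_def
    by (auto simp: min_def intro: order_le_less_trans)
  have "enn2real d \<le> \<nu> j x" if x: "x \<in> K" for x
  proof -
    have "d \<le> ennreal (\<nu> j x)" unfolding d_def using x by (intro min.coboundedI1 INF_lower)
    then have "enn2real d \<le> enn2real (ennreal (\<nu> j x))" by (intro enn2real_mono) auto
    then show ?thesis using nu_nonneg[OF j(1)] by simp
  qed
  then show ?thesis using that[OF j(1), of "enn2real d"] d by (simp add: enn2real_positive_iff)
qed

end

locale weighted_space = weights J \<nu> + E: seminormed_space E A p
  for J :: "'j set" and \<nu> :: "'j \<Rightarrow> 'x::t2_space \<Rightarrow> real"
    and E :: "('k::real_or_complex, 'v::ab_group_add) tvs" and A :: "'a set" and p :: "'a \<Rightarrow> 'v \<Rightarrow> real"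
begin

abbreviation "W \<equiv> CV0 J \<nu> E A p"
abbreviation "nrm \<equiv> wnorm \<nu> p"

lemma J_nonempty: "J \<noteq> {}" using nu_positive by blast

lemma vsp_CV_iff:
  "f \<in> vsp (CV J \<nu> E A p) \<longleftrightarrow> continuous_map euclidean (vtop E) f \<and>
     (\<forall>j\<in>J. \<forall>\<alpha>\<in>A. \<exists>c. \<forall>x. p \<alpha> (f x) * \<nu> j x \<le> c)"
  by (simp add: vsp_def CV_def seminorm_topology_def wsup_finite_iff)

lemma scl_CV: "scl (CV J \<nu> E A p) = (\<lambda>c f x. scl E c (f x))"
  by (simp add: CV_def)

lemma scl_W: "scl W = (\<lambda>c f x. scl E c (f x))"
  by (simp add: CV0_def subspace_tvs_def scl_CV)

lemma range_mem: "continuous_map euclidean (vtop E) f \<Longrightarrow> f x \<in> vsp E"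
  by (auto simp: E.continuous_map_into_iff)

lemma CV_seminormed_space: "seminormed_space (CV J \<nu> E A p) (J \<times> A) nrm"
proof (rule seminormed_space.intro)
  let ?X = "CV J \<nu> E A p"
  show vs: "vector_space (scl ?X)" unfolding scl_CV
    by unfold_locales (simp_all add: fun_eq_iff E.V.scale_right_distrib E.V.scale_left_distrib)
  interpret V: vector_space "scl ?X" by (rule vs)
  have add: "f + g \<in> vsp ?X" if f: "f \<in> vsp ?X" and g: "g \<in> vsp ?X" for f g
    unfolding vsp_CV_iff
  proof (intro conjI ballI)
    have fg: "continuous_map euclidean (vtop E) f" "continuous_map euclidean (vtop E) g"
      using f g by (auto simp: vsp_CV_iff)
    show "continuous_map euclidean (vtop E) (f + g)"
      unfolding plus_fun_def using fg by (rule E.continuous_map_plus)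
    fix j \<alpha> assume j: "j \<in> J" "\<alpha> \<in> A"
    obtain c where "\<forall>x. p \<alpha> (f x) * \<nu> j x \<le> c" using f j unfolding vsp_CV_iff by blast
    moreover obtain d where "\<forall>x. p \<alpha> (g x) * \<nu> j x \<le> d" using g j unfolding vsp_CV_iff by blast
    moreover have "p \<alpha> ((f + g) x) * \<nu> j x \<le> p \<alpha> (f x) * \<nu> j x + p \<alpha> (g x) * \<nu> j x" for x
      using mult_right_mono[OF E.p_add[OF j(2) range_mem[OF fg(1)] range_mem[OF fg(2)]] nu_nonneg[OF j(1)]]
      by (simp add: distrib_right)
    ultimately have "\<forall>x. p \<alpha> ((f + g) x) * \<nu> j x \<le> c + d" by (meson add_mono order_trans)
    then show "\<exists>c. \<forall>x. p \<alpha> ((f + g) x) * \<nu> j x \<le> c" by blast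
  qed
  have scl: "scl ?X a f \<in> vsp ?X" if f: "f \<in> vsp ?X" for a f
    unfolding vsp_CV_iff
  proof (intro conjI ballI)
    have fc: "continuous_map euclidean (vtop E) f" using f by (auto simp: vsp_CV_iff)
    show "continuous_map euclidean (vtop E) (scl ?X a f)"
      unfolding scl_CV using fc by (rule E.continuous_map_scl)
    fix j \<alpha> assume j: "j \<in> J" "\<alpha> \<in> A"
    then obtain c where "\<forall>x. p \<alpha> (f x) * \<nu> j x \<le> c" using f unfolding vsp_CV_iff by blast
    then have "\<forall>x. p \<alpha> (scl ?X a f x) * \<nu> j x \<le> norm a * c"
      using j fc by (auto simp: scl_CV E.p_scl range_mem mult.assoc intro: mult_left_mono)
    then show "\<exists>c. \<forall>x. p \<alpha> (scl ?X a f x) * \<nu> j x \<le> c" by blast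
  qed
  have "0 \<in> vsp ?X"
    using E.continuous_map_zero[of euclidean] by (auto simp: vsp_CV_iff zero_fun_def E.p_zero)
  then show "module.subspace (scl ?X) (vsp ?X)" using add scl by (simp add: V.subspace_def)
  have up: "p \<alpha> (f x) * \<nu> j x \<le> nrm (j, \<alpha>) f" if "f \<in> vsp ?X" "j \<in> J" "\<alpha> \<in> A" for f j \<alpha> x
    unfolding wnorm_def using that by (simp, intro wsup_upper) (auto simp: vsp_CV_iff wsup_finite_iff)
  have least: "nrm (j, \<alpha>) f \<le> c" if "\<And>x. p \<alpha> (f x) * \<nu> j x \<le> c" "0 \<le> c" for f j \<alpha> c
    unfolding wnorm_def using wsup_least[of UNIV "p \<alpha>" f "\<nu> j" c] that by (simp add: enn2real_leI)
  have Er: "f x \<in> vsp E" if "f \<in> vsp ?X" for f x using that unfolding vsp_CV_iff by (intro range_mem) simp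
  have sn: "seminorm_on ?X (nrm i)" if i: "i \<in> J \<times> A" for i
  proof -
    obtain j \<alpha> where ja: "i = (j, \<alpha>)" "j \<in> J" "\<alpha> \<in> A" using i by auto
    have nn: "0 \<le> nrm i f" for f by (simp add: wnorm_def)
    \<comment> \<open>Only this inequality is read off from the supremum. For a nonzero scalar,
      applying it to the inverse gives equality.\<close>
    have scl_le: "nrm i (scl ?X a f) \<le> norm a * nrm i f" if f: "f \<in> vsp ?X" for a f
      unfolding ja(1)
    proof (rule least)
      fix x
      show "p \<alpha> (scl ?X a f x) * \<nu> j x \<le> norm a * nrm (j, \<alpha>) f"
        using up[OF f ja(2,3), of x] ja(3) Er[OF f]
        by (simp add: scl_CV E.p_scl mult.assoc mult_left_mono)
    qed (simp add: wnorm_def)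
    have "nrm i (scl ?X a f) = norm a * nrm i f" if f: "f \<in> vsp ?X" for a f
    proof (cases "a = 0")
      case True
      then show ?thesis using scl_le[OF f, of 0] nn[of "scl ?X a f"] by auto
    next
      case False
      have "nrm i (scl ?X (inverse a) (scl ?X a f)) \<le> norm (inverse a) * nrm i (scl ?X a f)"
        by (intro scl_le scl f)
      then have "norm a * nrm i f \<le> nrm i (scl ?X a f)" using False by (simp add: norm_inverse norm_divide field_simps)
      then show ?thesis using scl_le[OF f, of a] by simp
    qed
    moreover have "nrm i (f + g) \<le> nrm i f + nrm i g" if f: "f \<in> vsp ?X" and g: "g \<in> vsp ?X" for f g
      unfolding ja(1)
    proof (rule least)
      fix x
      have "p \<alpha> ((f + g) x) * \<nu> j x \<le> (p \<alpha> (f x) + p \<alpha> (g x)) * \<nu> j x"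
        using E.p_add[OF ja(3) Er[OF f] Er[OF g]] nu_nonneg[OF ja(2)] by (simp add: mult_right_mono)
      then show "p \<alpha> ((f + g) x) * \<nu> j x \<le> nrm (j, \<alpha>) f + nrm (j, \<alpha>) g"
        using up[OF f ja(2,3), of x] up[OF g ja(2,3), of x] by (simp add: distrib_right)
    qed (simp add: wnorm_def)
    ultimately show ?thesis using nn by (simp add: seminorm_on_def)
  qed
  have dir: "\<exists>m\<in>J \<times> A. \<exists>C>0. \<forall>f\<in>vsp ?X. nrm i f \<le> C * nrm m f \<and> nrm k f \<le> C * nrm m f"
    if ik: "i \<in> J \<times> A" "k \<in> J \<times> A" for i k
  proof -
    obtain j \<alpha> j' \<alpha>' where ja: "i = (j, \<alpha>)" "j \<in> J" "\<alpha> \<in> A" "k = (j', \<alpha>')" "j' \<in> J" "\<alpha>' \<in> A"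
      using ik by auto
    obtain l C where l: "l \<in> J" "C > 0" "\<forall>x. \<nu> j x \<le> C * \<nu> l x \<and> \<nu> j' x \<le> C * \<nu> l x"
      using nu_directed[OF ja(2,5)] by blast
    obtain \<gamma> D where g: "\<gamma> \<in> A" "D > 0" "\<forall>v\<in>vsp E. p \<alpha> v \<le> D * p \<gamma> v \<and> p \<alpha>' v \<le> D * p \<gamma> v"
      using E.directed[OF ja(3,6)] by blast
    have main: "nrm (a, \<beta>) f \<le> (D * C) * nrm (l, \<gamma>) f"
      if f: "f \<in> vsp ?X" and a: "a \<in> J" "\<beta> \<in> A" "\<forall>x. \<nu> a x \<le> C * \<nu> l x" "\<forall>v\<in>vsp E. p \<beta> v \<le> D * p \<gamma> v" for f a \<beta>
    proof (rule least)
      fix x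
      have "p \<beta> (f x) * \<nu> a x \<le> (D * p \<gamma> (f x)) * (C * \<nu> l x)"
        using a g l Er[OF f] nu_nonneg E.p_nonneg by (intro mult_mono) auto
      also have "\<dots> = (D * C) * (p \<gamma> (f x) * \<nu> l x)" by simp
      also have "\<dots> \<le> (D * C) * nrm (l, \<gamma>) f" using up[OF f l(1) g(1), of x] g l by (intro mult_left_mono) auto
      finally show "p \<beta> (f x) * \<nu> a x \<le> (D * C) * nrm (l, \<gamma>) f" .
    qed (use g l in \<open>simp add: wnorm_def\<close>)
    show ?thesis
      using main[OF _ ja(2,3)] main[OF _ ja(5,6)] l g unfolding ja
      by (intro bexI[of _ "(l, \<gamma>)"] exI[of _ "D * C"]) auto
  qed
  have "{\<lambda>f. enn2real (wsup UNIV (\<nu> j) (p \<alpha>) f) | j \<alpha>. j \<in> J \<and> \<alpha> \<in> A} = nrm ` (J \<times> A)"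
  proof -
    have "(\<lambda>f. enn2real (wsup UNIV (\<nu> j) (p \<alpha>) f)) = nrm (j, \<alpha>)" for j \<alpha>
      by (simp add: wnorm_def fun_eq_iff)
    then show ?thesis by auto
  qed
  then have "vtop ?X = seminorm_topology (vsp ?X) (nrm ` (J \<times> A))"
    by (simp add: CV_def vsp_def seminorm_topology_def)
  then show "fundamental_seminorms ?X (J \<times> A) nrm"
    using sn dir J_nonempty E.index_nonempty by (simp add: fundamental_seminorms_def)
qed

text \<open>The boundedness demanded by \<open>CV\<close> is absorbed: off a compact set it follows
  from the vanishing condition with \<epsilon> = 1, and on that set from compactness of the image
  and local boundedness of the weight.\<close>

lemma vsp_W_iff:
  "f \<in> vsp W \<longleftrightarrow> continuous_map euclidean (vtop E) f \<and>
     (\<forall>j\<in>J. \<forall>\<alpha>\<in>A. \<forall>\<epsilon>>0. \<exists>K. compact K \<and> (\<forall>x. x \<notin> K \<longrightarrow> p \<alpha> (f x) * \<nu> j x \<le> \<epsilon>))" (is "_ \<longleftrightarrow> ?R")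
proof -
  have d: "f \<in> vsp W \<longleftrightarrow> f \<in> vsp (CV J \<nu> E A p) \<and>
      (\<forall>j\<in>J. \<forall>\<alpha>\<in>A. \<forall>\<epsilon>>0. \<exists>K. compact K \<and> wsup (- K) (\<nu> j) (p \<alpha>) f < ennreal \<epsilon>)"
    by (auto simp: vsp_def CV0_def subspace_tvs_def)
  show ?thesis
  proof
    assume L: "f \<in> vsp W"
    have "\<exists>K. compact K \<and> (\<forall>x. x \<notin> K \<longrightarrow> p \<alpha> (f x) * \<nu> j x \<le> \<epsilon>)"
      if h: "j \<in> J" "\<alpha> \<in> A" "\<epsilon> > 0" for j \<alpha> and \<epsilon> :: real
    proof -
      obtain K where K: "compact K" "wsup (- K) (\<nu> j) (p \<alpha>) f < ennreal \<epsilon>" using L d h by blast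
      have fin: "wsup (- K) (\<nu> j) (p \<alpha>) f < top" using K(2) by (rule order.strict_trans) simp
      have "enn2real (wsup (- K) (\<nu> j) (p \<alpha>) f) \<le> \<epsilon>" using K(2) h by (intro enn2real_leI) auto
      then have "p \<alpha> (f x) * \<nu> j x \<le> \<epsilon>" if "x \<notin> K" for x
        using wsup_upper[OF fin, of x] that by simp
      then show ?thesis using K(1) by blast
    qed
    then show ?R using L d by (simp add: vsp_CV_iff)
  next
    assume R: ?R
    have b: "\<exists>c. \<forall>x. p \<alpha> (f x) * \<nu> j x \<le> c" if h: "j \<in> J" "\<alpha> \<in> A" for j \<alpha>
    proof -
      obtain K where K: "compact K" "\<forall>x. x \<notin> K \<longrightarrow> p \<alpha> (f x) * \<nu> j x \<le> 1" using R h zero_less_one by blast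
      obtain C where C: "C > 0" "\<And>x. x \<in> K \<Longrightarrow> \<nu> j x \<le> C" using nu_bounded[OF K(1) h(1)] by blast
      have "compactin (vtop E) (f ` K)" using K(1) R by (intro image_compactin[of euclidean]) auto
      then obtain B where B: "B > 0" "\<And>v. v \<in> f ` K \<Longrightarrow> p \<alpha> v \<le> B" using E.compact_bounded h by blast
      have "p \<alpha> (f x) * \<nu> j x \<le> max 1 (B * C)" for x
      proof (cases "x \<in> K")
        case True
        then have "p \<alpha> (f x) * \<nu> j x \<le> B * C" using B C nu_nonneg[OF h(1)] by (intro mult_mono) auto
        then show ?thesis by simp
      next
        case False
        then show ?thesis using K(2) by (simp add: le_max_iff_disj)
      qed
      then show ?thesis by blast
    qed
    have "\<exists>K. compact K \<and> wsup (- K) (\<nu> j) (p \<alpha>) f < ennreal \<epsilon>"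
      if h: "j \<in> J" "\<alpha> \<in> A" "\<epsilon> > 0" for j \<alpha> and \<epsilon> :: real
    proof -
      have "\<epsilon> / 2 > 0" using h by simp
      then obtain K where K: "compact K" "\<forall>x. x \<notin> K \<longrightarrow> p \<alpha> (f x) * \<nu> j x \<le> \<epsilon> / 2" using R h by blast
      then have "wsup (- K) (\<nu> j) (p \<alpha>) f \<le> ennreal (\<epsilon> / 2)" by (intro wsup_least) auto
      also have "\<dots> < ennreal \<epsilon>" using h by (simp add: ennreal_less_iff)
      finally show ?thesis using K(1) by blast
    qed
    then show "f \<in> vsp W" unfolding d vsp_CV_iff using R b by blast
  qed
qed

lemma W_continuous: "f \<in> vsp W \<Longrightarrow> continuous_map euclidean (vtop E) f"
  by (simp add: vsp_W_iff)

lemma W_range: "f \<in> vsp W \<Longrightarrow> f x \<in> vsp E"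
  using range_mem W_continuous by blast

sublocale CV: seminormed_space "CV J \<nu> E A p" "J \<times> A" nrm
  by (rule CV_seminormed_space)

lemma W_subspace: "CV.V.subspace (vsp W)"
proof -
  have "0 \<in> vsp W" unfolding vsp_W_iff zero_fun_def
    using E.continuous_map_zero[of euclidean] by (auto simp: E.p_zero intro!: exI[of _ "{}"])
  moreover have "f + g \<in> vsp W" if f: "f \<in> vsp W" and g: "g \<in> vsp W" for f g
    unfolding vsp_W_iff
  proof (intro conjI ballI allI impI)
    show "continuous_map euclidean (vtop E) (f + g)" unfolding plus_fun_def
      using f g by (intro E.continuous_map_plus W_continuous)
    fix j \<alpha> and \<epsilon> :: real assume h: "j \<in> J" "\<alpha> \<in> A" "\<epsilon> > 0"
    then have e: "\<epsilon> / 2 > 0" by simp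
    obtain K where K: "compact K" "\<forall>x. x \<notin> K \<longrightarrow> p \<alpha> (f x) * \<nu> j x \<le> \<epsilon> / 2"
      using f h e unfolding vsp_W_iff by blast
    obtain K' where K': "compact K'" "\<forall>x. x \<notin> K' \<longrightarrow> p \<alpha> (g x) * \<nu> j x \<le> \<epsilon> / 2"
      using g h e unfolding vsp_W_iff by blast
    have "p \<alpha> ((f + g) x) * \<nu> j x \<le> \<epsilon>" if "x \<notin> K \<union> K'" for x
    proof -
      have "p \<alpha> ((f + g) x) * \<nu> j x \<le> (p \<alpha> (f x) + p \<alpha> (g x)) * \<nu> j x"
        using E.p_add[OF h(2) W_range[OF f] W_range[OF g]] nu_nonneg[OF h(1)] by (simp add: mult_right_mono)
      moreover have "p \<alpha> (f x) * \<nu> j x \<le> \<epsilon> / 2" "p \<alpha> (g x) * \<nu> j x \<le> \<epsilon> / 2" using K K' that by auto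
      ultimately show ?thesis by (simp add: distrib_right)
    qed
    then show "\<exists>K. compact K \<and> (\<forall>x. x \<notin> K \<longrightarrow> p \<alpha> ((f + g) x) * \<nu> j x \<le> \<epsilon>)"
      using K K' by (intro exI[of _ "K \<union> K'"]) auto
  qed
  moreover have "scl (CV J \<nu> E A p) a f \<in> vsp W" if f: "f \<in> vsp W" for a f
    unfolding vsp_W_iff scl_CV
  proof (intro conjI ballI allI impI)
    show "continuous_map euclidean (vtop E) (\<lambda>x. scl E a (f x))"
      using f by (intro E.continuous_map_scl W_continuous)
    fix j \<alpha> and \<epsilon> :: real assume h: "j \<in> J" "\<alpha> \<in> A" "\<epsilon> > 0"
    have pos: "norm a + 1 > 0" by (simp add: add_nonneg_pos)
    then have "\<epsilon> / (norm a + 1) > 0" using h by simp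
    then obtain K where K: "compact K" "\<forall>x. x \<notin> K \<longrightarrow> p \<alpha> (f x) * \<nu> j x \<le> \<epsilon> / (norm a + 1)"
      using f h unfolding vsp_W_iff by blast
    have "p \<alpha> (scl E a (f x)) * \<nu> j x \<le> \<epsilon>" if "x \<notin> K" for x
    proof -
      have "p \<alpha> (scl E a (f x)) * \<nu> j x = norm a * (p \<alpha> (f x) * \<nu> j x)"
        by (simp add: E.p_scl h W_range[OF f])
      also have "\<dots> \<le> (norm a + 1) * (p \<alpha> (f x) * \<nu> j x)"
        using E.p_nonneg[OF h(2) W_range[OF f]] nu_nonneg[OF h(1)] by (intro mult_right_mono) auto
      also have "\<dots> \<le> (norm a + 1) * (\<epsilon> / (norm a + 1))" using K that pos by (intro mult_left_mono) auto
      finally show ?thesis using pos by simp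
    qed
    then show "\<exists>K. compact K \<and> (\<forall>x. x \<notin> K \<longrightarrow> p \<alpha> (scl E a (f x)) * \<nu> j x \<le> \<epsilon>)" using K by blast
  qed
  ultimately show ?thesis by (simp add: CV.V.subspace_def)
qed

lemma W_subset_CV: "vsp W \<subseteq> vsp (CV J \<nu> E A p)"
  by (auto simp: vsp_def CV0_def subspace_tvs_def)

sublocale W: seminormed_space "CV0 J \<nu> E A p" "J \<times> A" "wnorm \<nu> p"
proof -
  let ?S = "{f \<in> vsp (CV J \<nu> E A p). \<forall>j\<in>J. \<forall>\<alpha>\<in>A. \<forall>\<epsilon>>0.
        \<exists>K. compact K \<and> wsup (- K) (\<nu> j) (p \<alpha>) f < ennreal \<epsilon>}"
  have "vsp W = ?S" by (auto simp: vsp_def CV0_def subspace_tvs_def)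
  then show "seminormed_space (CV0 J \<nu> E A p) (J \<times> A) (wnorm \<nu> p)"
    using CV.subspace_seminormed_space[OF _ W_subset_CV] W_subspace by (simp add: CV0_def)
qed

lemma nrm_upper: "f \<in> vsp W \<Longrightarrow> j \<in> J \<Longrightarrow> \<alpha> \<in> A \<Longrightarrow> p \<alpha> (f x) * \<nu> j x \<le> nrm (j, \<alpha>) f"
  unfolding wnorm_def using subsetD[OF W_subset_CV, of f]
  by (simp, intro wsup_upper) (auto simp: vsp_CV_iff wsup_finite_iff)

lemma nrm_least: "(\<And>x. p \<alpha> (f x) * \<nu> j x \<le> c) \<Longrightarrow> 0 \<le> c \<Longrightarrow> nrm (j, \<alpha>) f \<le> c"
  unfolding wnorm_def using wsup_least[of UNIV "p \<alpha>" f "\<nu> j" c] by (simp add: enn2real_leI)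

lemma lcHs_W:
  assumes "lcHs E" shows "lcHs W"
  unfolding W.lcHs_iff
proof (intro ballI impI)
  fix f assume f: "f \<in> vsp W" "\<forall>i\<in>J \<times> A. nrm i f = 0"
  have "f x = 0" for x
  proof -
    obtain j where j: "j \<in> J" "0 < \<nu> j x" using nu_positive by blast
    have "p \<alpha> (f x) = 0" if "\<alpha> \<in> A" for \<alpha>
    proof -
      have "p \<alpha> (f x) * \<nu> j x \<le> 0" using nrm_upper[OF f(1) j(1) that, of x] f(2) j that by simp
      then show ?thesis using j(2) E.p_nonneg[OF that W_range[OF f(1)]]
        by (metis antisym mult_le_0_iff not_less)
    qed
    then show ?thesis using assms W_range[OF f(1)] unfolding E.lcHs_iff by blast
  qed
  then show "f = 0" by (simp add: fun_eq_iff)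
qed

end

section \<open>Approximation by functions with compact support\<close>

lemma function_tensor_sum:
  assumes "finite I" "\<And>i. i \<in> I \<Longrightarrow> f i \<in> G" "\<And>i. i \<in> I \<Longrightarrow> e i \<in> vsp E"
  shows "(\<lambda>x. \<Sum>i\<in>I. scl E (f i x) (e i)) \<in> function_tensor G E"
proof -
  obtain N :: nat and b where b: "bij_betw b {..<N} I" using finite_enumeration[OF assms(1)] .
  have "(\<lambda>x. \<Sum>i\<in>I. scl E (f i x) (e i)) = (\<lambda>x. \<Sum>n<N. scl E (f (b n) x) (e (b n)))"
  proof
    show "(\<Sum>i\<in>I. scl E (f i x) (e i)) = (\<Sum>n<N. scl E (f (b n) x) (e (b n)))" for x
      using sum.reindex_bij_betw[OF b, of "\<lambda>i. scl E (f i x) (e i)"] by simp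
  qed
  moreover have "b n \<in> I" if "n < N" for n using b that by (auto simp: bij_betw_def)
  ultimately show ?thesis
    unfolding function_tensor_def using assms by (intro CollectI exI[of _ N] exI[of _ "\<lambda>n. f (b n)"] exI[of _ "\<lambda>n. e (b n)"]) simp
qed

lemma supp_subset:
  fixes L :: "'x::t2_space set"
  assumes "compact L" "\<And>x. f x \<noteq> 0 \<Longrightarrow> x \<in> L"
  shows "supp f \<subseteq> L" "compact (supp f)"
proof -
  show sub: "supp f \<subseteq> L" unfolding supp_def
    using assms by (intro closure_minimal compact_imp_closed) auto
  have "compact (L \<inter> supp f)" using assms(1) by (intro compact_Int_closed) (simp_all add: supp_def)
  then show "compact (supp f)" using sub by (simp add: inf.absorb2)
qed

lemma not_in_supp: "x \<notin> supp f \<Longrightarrow> f x = 0"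
  using closure_subset[of "{x. f x \<noteq> 0}"] by (auto simp: supp_def)

lemma Cc_scalars_of_real:
  fixes \<phi> :: "'x::t2_space \<Rightarrow> real"
  assumes "continuous_on UNIV \<phi>" "compact L" "\<And>x. \<phi> x \<noteq> 0 \<Longrightarrow> x \<in> L"
  shows "(\<lambda>x. of_real (\<phi> x)) \<in> Cc (scalars :: ('k::real_or_complex, 'k) tvs)"
  using assms supp_subset(2)[of L "\<lambda>x. of_real (\<phi> x) :: 'k"]
  by (auto simp: Cc_def scalars_def intro!: continuous_intros)

text \<open>The norm, indexed by a singleton, makes the scalars an instance of the locale, so the
  scalar weighted space becomes a case of the vector-valued one.\<close>

lemma scalars_seminormed_space:
  "seminormed_space (scalars :: ('k::real_or_complex, 'k) tvs) {()} (\<lambda>_. norm)"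
proof (rule seminormed_space.intro)
  show vs: "vector_space (scl (scalars :: ('k, 'k) tvs))"
    by unfold_locales (simp_all add: algebra_simps)
  interpret V: vector_space "scl (scalars :: ('k, 'k) tvs)" by (rule vs)
  show "module.subspace (scl scalars) (vsp (scalars :: ('k, 'k) tvs))" by (simp add: V.subspace_UNIV)
  have "openin euclidean U \<longleftrightarrow> openin (seminorm_topology UNIV {norm :: 'k \<Rightarrow> real}) U" for U :: "'k set"
  proof
    assume "openin (euclidean :: 'k topology) U"
    then have U: "\<forall>x\<in>U. \<exists>e>0. \<forall>y. dist y x < e \<longrightarrow> y \<in> U" by (simp add: open_dist)
    show "openin (seminorm_topology UNIV {norm :: 'k \<Rightarrow> real}) U"
      unfolding seminorm_topology_def openin_zero_nbhd_topology
    proof (intro conjI ballI)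
      fix x assume "x \<in> U"
      then obtain e where e: "e > 0" "\<forall>y. dist y x < e \<longrightarrow> y \<in> U" using U by blast
      then show "\<exists>\<F>. finite \<F> \<and> \<F> \<subseteq> {{v \<in> UNIV. p v < r} |p r. p \<in> {norm :: 'k \<Rightarrow> real} \<and> 0 < r} \<and>
          (\<forall>y\<in>UNIV. y - x \<in> \<Inter>\<F> \<longrightarrow> y \<in> U)"
        by (intro exI[of _ "{{v. norm v < e}}"]) (auto simp: dist_norm)
    qed simp
  next
    assume U: "openin (seminorm_topology UNIV {norm :: 'k \<Rightarrow> real}) U"
    show "openin euclidean U" unfolding open_openin[symmetric]
    proof (rule openI)
      fix x assume "x \<in> U"
      then obtain \<F> where F: "finite \<F>" "\<F> \<subseteq> {{v \<in> UNIV. p v < r} |p r. p \<in> {norm :: 'k \<Rightarrow> real} \<and> 0 < r}"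
        "\<forall>y. y - x \<in> \<Inter>\<F> \<longrightarrow> y \<in> U"
        using U unfolding seminorm_topology_def openin_zero_nbhd_topology by auto
      have "open (\<Inter>B\<in>\<F>. {y. y - x \<in> B})"
      proof (intro open_INT F(1) ballI)
        fix B assume "B \<in> \<F>"
        then obtain r where "B = {v. norm v < r}" using F(2) by blast
        then show "open {y. y - x \<in> B}" by (auto intro!: open_Collect_less continuous_intros)
      qed
      moreover have "x \<in> (\<Inter>B\<in>\<F>. {y. y - x \<in> B})" using F(2) by auto
      ultimately obtain e where "e > 0" "ball x e \<subseteq> (\<Inter>B\<in>\<F>. {y. y - x \<in> B})"
        by (meson openE)
      then show "\<exists>e>0. ball x e \<subseteq> U" using F(3) by (intro exI[of _ e]) auto
    qed
  qed
  then have "vtop scalars = seminorm_topology UNIV {norm :: 'k \<Rightarrow> real}"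
    by (simp add: scalars_def topology_eq)
  then show "fundamental_seminorms scalars {()} (\<lambda>_. norm :: 'k \<Rightarrow> real)"
    by (auto simp: fundamental_seminorms_def seminorm_on_def norm_triangle_ineq norm_mult intro!: exI[of _ 1])
qed

lemma vtop_scalars [simp]: "vtop scalars = euclidean"
  by (simp add: scalars_def)

text \<open>These are the properties that place approximants in the tensor product. The sign and sum
  conditions of a partition of unity are spent inside
  \<open>approximation_on_compact\<close>.\<close>

definition bump_family :: "'x::topological_space set \<Rightarrow> ('x \<Rightarrow> 'x \<Rightarrow> real) \<Rightarrow> 'x set \<Rightarrow> bool" where
  "bump_family Z \<phi> L \<longleftrightarrow> finite Z \<and> compact L \<and>
     (\<forall>z\<in>Z. continuous_on UNIV (\<phi> z) \<and> (\<forall>x. \<phi> z x \<noteq> 0 \<longrightarrow> x \<in> L))"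

context weighted_space
begin

definition approx :: "'x set \<Rightarrow> ('x \<Rightarrow> 'x \<Rightarrow> real) \<Rightarrow> ('x \<Rightarrow> 'v) \<Rightarrow> 'x \<Rightarrow> 'v" where
  "approx Z \<phi> h x = (\<Sum>z\<in>Z. scl E (of_real (\<phi> z x)) (h z))"

text \<open>With s the sum of the \<phi> z x, the error is (1 - s) h x plus the sum of \<phi> z x (h
  x - h z). The second part is at most \<delta>, since \<phi> z x is nonzero only for x in U z; the
  first vanishes on K and never exceeds p \<alpha> (h x).\<close>

lemma approximation_on_compact:
  assumes L: "compact L" "subordinate_partitions K L"
    and \<alpha>: "\<alpha> \<in> A" and M: "\<And>h x. h \<in> M \<Longrightarrow> h x \<in> vsp E" and \<delta>: "\<delta> > 0"
    and eq: "\<And>z. \<exists>U. open U \<and> z \<in> U \<and> (\<forall>h\<in>M. \<forall>x\<in>U. p \<alpha> (h x - h z) \<le> \<delta>)"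
  shows "\<exists>Z \<phi>. bump_family Z \<phi> L \<and>
    (\<forall>h\<in>M. \<forall>x\<in>K. p \<alpha> (h x - approx Z \<phi> h x) \<le> \<delta>) \<and>
    (\<forall>h\<in>M. \<forall>x. p \<alpha> (h x - approx Z \<phi> h x) \<le> p \<alpha> (h x) + \<delta>)"
proof -
  obtain U where U: "\<And>z. open (U z) \<and> z \<in> U z \<and> (\<forall>h\<in>M. \<forall>x\<in>U z. p \<alpha> (h x - h z) \<le> \<delta>)"
    using eq by metis
  then have "\<forall>z\<in>K. open (U z) \<and> z \<in> U z" by blast
  then obtain Z \<phi> where Z: "finite Z" "Z \<subseteq> K" "\<forall>z\<in>Z. continuous_on UNIV (\<phi> z)"
    "\<forall>z\<in>Z. \<forall>x. 0 \<le> (\<phi> z x :: real) \<and> (\<phi> z x \<noteq> 0 \<longrightarrow> x \<in> U z \<inter> L)"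
    "\<forall>x. (\<Sum>z\<in>Z. \<phi> z x) \<le> 1" "\<forall>x\<in>K. (\<Sum>z\<in>Z. \<phi> z x) = 1"
    using L(2)[unfolded subordinate_partitions_def, rule_format, of U] by blast
  have main: "p \<alpha> (h x - approx Z \<phi> h x) \<le> (1 - (\<Sum>z\<in>Z. \<phi> z x)) * p \<alpha> (h x) + \<delta>"
    if h: "h \<in> M" for h x
  proof -
    let ?s = "\<Sum>z\<in>Z. \<phi> z x"
    have "h x - approx Z \<phi> h x = scl E (of_real (1 - ?s)) (h x) + (\<Sum>z\<in>Z. scl E (of_real (\<phi> z x)) (h x - h z))"
      by (simp add: approx_def E.V.scale_right_diff_distrib E.V.scale_left_diff_distrib sum_subtractf E.V.scale_sum_left)
    also have "p \<alpha> \<dots> \<le> p \<alpha> (scl E (of_real (1 - ?s)) (h x)) + p \<alpha> (\<Sum>z\<in>Z. scl E (of_real (\<phi> z x)) (h x - h z))"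
      using \<alpha> M[OF h] by (intro E.p_add E.scl_mem E.sum_mem E.diff_mem)
    also have "p \<alpha> (scl E (of_real (1 - ?s)) (h x)) = (1 - ?s) * p \<alpha> (h x)"
      using E.p_scl[OF \<alpha> M[OF h]] Z(5) by (simp del: of_real_diff of_real_sum)
    also have "p \<alpha> (\<Sum>z\<in>Z. scl E (of_real (\<phi> z x)) (h x - h z)) \<le> (\<Sum>z\<in>Z. p \<alpha> (scl E (of_real (\<phi> z x)) (h x - h z)))"
      by (intro E.p_sum \<alpha> E.scl_mem E.diff_mem M[OF h])
    also have "\<dots> \<le> (\<Sum>z\<in>Z. \<phi> z x * \<delta>)"
    proof (rule sum_mono)
      fix z assume z: "z \<in> Z"
      have "p \<alpha> (scl E (of_real (\<phi> z x)) (h x - h z)) = \<phi> z x * p \<alpha> (h x - h z)"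
        using E.p_scl[OF \<alpha> E.diff_mem[OF M[OF h] M[OF h]]] Z(4) z by simp
      also have "\<dots> \<le> \<phi> z x * \<delta>"
      proof (cases "\<phi> z x = 0")
        case False
        then show ?thesis using Z(4) z U h by (intro mult_left_mono) blast+
      qed simp
      finally show "p \<alpha> (scl E (of_real (\<phi> z x)) (h x - h z)) \<le> \<phi> z x * \<delta>" .
    qed
    also have "\<dots> = ?s * \<delta>" by (simp add: sum_distrib_right)
    also have "\<dots> \<le> \<delta>" using Z(5) \<delta> by (intro mult_left_le_one_le sum_nonneg) (use Z(4) in auto)
    finally show ?thesis by simp
  qed
  have "p \<alpha> (h x - approx Z \<phi> h x) \<le> \<delta>" if "h \<in> M" "x \<in> K" for h x
    using main[OF that(1), of x] Z(6) that by simp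
  moreover have "p \<alpha> (h x - approx Z \<phi> h x) \<le> p \<alpha> (h x) + \<delta>" if "h \<in> M" for h x
  proof -
    have "0 \<le> (\<Sum>z\<in>Z. \<phi> z x)" using Z(4) by (intro sum_nonneg) auto
    then have "(1 - (\<Sum>z\<in>Z. \<phi> z x)) * p \<alpha> (h x) \<le> 1 * p \<alpha> (h x)"
      using E.p_nonneg[OF \<alpha> M[OF that]] by (intro mult_right_mono) auto
    then show ?thesis using main[OF that, of x] by simp
  qed
  ultimately show ?thesis
    using Z L(1) by (intro exI[of _ Z] exI[of _ \<phi>]) (auto simp: bump_family_def)
qed

text \<open>The compact sets belonging to the finitely many functions of a net are united; half of
  \<epsilon> pays for the distance to the net.\<close>

lemma compact_uniformly_vanishing:
  assumes M: "compactin (vtop W) M" and j: "j \<in> J" "\<alpha> \<in> A" "\<epsilon> > 0"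
  shows "\<exists>K. compact K \<and> (\<forall>h\<in>M. \<forall>x. x \<notin> K \<longrightarrow> p \<alpha> (h x) * \<nu> j x \<le> \<epsilon>)"
proof -
  have MW: "M \<subseteq> vsp W" using M by (simp add: compactin_def vsp_def)
  have e: "\<epsilon> / 2 > 0" using j by simp
  have i: "(j, \<alpha>) \<in> J \<times> A" using j by simp
  obtain N where N: "finite N" "N \<subseteq> M" "\<And>h. h \<in> M \<Longrightarrow> \<exists>n\<in>N. nrm (j, \<alpha>) (h - n) < \<epsilon> / 2"
    using W.compact_finite_net[OF M i e] by blast
  have "\<exists>K. compact K \<and> (\<forall>x. x \<notin> K \<longrightarrow> p \<alpha> (n x) * \<nu> j x \<le> \<epsilon> / 2)" if n: "n \<in> N" for n
  proof -
    have "n \<in> vsp W" using n N MW by blast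
    then show ?thesis using j e unfolding vsp_W_iff by metis
  qed
  then obtain K where K: "\<And>n. n \<in> N \<Longrightarrow> compact (K n) \<and> (\<forall>x. x \<notin> K n \<longrightarrow> p \<alpha> (n x) * \<nu> j x \<le> \<epsilon> / 2)"
    by metis
  show ?thesis
  proof (intro exI[of _ "\<Union>(K ` N)"] conjI ballI allI impI)
    show "compact (\<Union>(K ` N))" using N K by (intro compact_UN) auto
    fix h x assume h: "h \<in> M" and x: "x \<notin> \<Union>(K ` N)"
    obtain n where n: "n \<in> N" "nrm (j, \<alpha>) (h - n) < \<epsilon> / 2" using N h by blast
    have hn: "h \<in> vsp W" "n \<in> vsp W" using h n N MW by auto
    have "p \<alpha> (h x) \<le> p \<alpha> (h x - n x) + p \<alpha> (n x)"
      using E.p_add[OF j(2), of "h x - n x" "n x"] W_range hn by (simp add: E.diff_mem)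
    then have "p \<alpha> (h x) * \<nu> j x \<le> p \<alpha> ((h - n) x) * \<nu> j x + p \<alpha> (n x) * \<nu> j x"
      using mult_right_mono[OF _ nu_nonneg[OF j(1)]] by (fastforce simp: distrib_right)
    moreover have "p \<alpha> ((h - n) x) * \<nu> j x \<le> nrm (j, \<alpha>) (h - n)"
      using hn j by (intro nrm_upper W.diff_mem)
    moreover have "p \<alpha> (n x) * \<nu> j x \<le> \<epsilon> / 2" using K n x by blast
    ultimately show "p \<alpha> (h x) * \<nu> j x \<le> \<epsilon>" using n by linarith
  qed
qed

text \<open>Equicontinuity of a compact set at a point: on a compact neighbourhood some weight is bounded
  away from zero, so a finite net for that weight is a net for uniform convergence there.\<close>

lemma compact_equicontinuous:
  assumes M: "compactin (vtop W) M" and \<alpha>: "\<alpha> \<in> A" and e: "\<epsilon> > 0"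
  shows "\<exists>U. open U \<and> z \<in> U \<and> (\<forall>h\<in>M. \<forall>x\<in>U. p \<alpha> (h x - h z) \<le> \<epsilon>)"
proof -
  have MW: "M \<subseteq> vsp W" using M by (simp add: compactin_def vsp_def)
  obtain G L where G: "open G" "compact L" "{z} \<subseteq> G" "G \<subseteq> L"
    using compact_between_open[OF loc_compact, of "{z}" UNIV] by auto
  obtain j c where j: "j \<in> J" "c > 0" "\<And>x. x \<in> L \<Longrightarrow> c \<le> \<nu> j x" using nu_away[OF G(2)] by blast
  \<comment> \<open>Division by the lower bound c of the weight leaves \<epsilon> / 3 in p \<alpha>.
    The three thirds are the distance of h to n at x, the oscillation of n, and the distance of n to
    h at z.\<close>
  have ec: "\<epsilon> * c / 3 > 0" using e j by simp
  have i: "(j, \<alpha>) \<in> J \<times> A" using j \<alpha> by simp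
  obtain N where N: "finite N" "N \<subseteq> M" "\<And>h. h \<in> M \<Longrightarrow> \<exists>n\<in>N. nrm (j, \<alpha>) (h - n) < \<epsilon> * c / 3"
    using W.compact_finite_net[OF M i ec] by blast
  have "\<exists>U. open U \<and> z \<in> U \<and> (\<forall>x\<in>U. p \<alpha> (n x - n z) < \<epsilon> / 3)" if "n \<in> N" for n
  proof -
    have "continuous_map euclidean (vtop E) n" "\<epsilon> / 3 > 0" using that N MW W_continuous e by auto
    then show ?thesis using \<alpha> unfolding E.continuous_map_into_iff open_openin[symmetric] topspace_euclidean by blast
  qed
  then obtain U where U: "\<And>n. n \<in> N \<Longrightarrow> open (U n) \<and> z \<in> U n \<and> (\<forall>x\<in>U n. p \<alpha> (n x - n z) < \<epsilon> / 3)"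
    by metis
  show ?thesis
  proof (intro exI[of _ "G \<inter> \<Inter>(U ` N)"] conjI ballI)
    show "open (G \<inter> \<Inter>(U ` N))" using G U N by (intro open_Int open_INT) auto
    show "z \<in> G \<inter> \<Inter>(U ` N)" using G U by auto
    fix h x assume h: "h \<in> M" and x: "x \<in> G \<inter> \<Inter>(U ` N)"
    obtain n where n: "n \<in> N" "nrm (j, \<alpha>) (h - n) < \<epsilon> * c / 3" using N h by blast
    have hn: "h \<in> vsp W" "n \<in> vsp W" using h n N MW by auto
    have near: "p \<alpha> (h y - n y) \<le> \<epsilon> / 3" if y: "y \<in> L" for y
    proof -
      have "p \<alpha> (h y - n y) * c \<le> p \<alpha> ((h - n) y) * \<nu> j y"
        using j y E.p_nonneg[OF \<alpha>] W_range hn by (simp add: mult_left_mono E.diff_mem)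
      also have "\<dots> \<le> nrm (j, \<alpha>) (h - n)" using hn j \<alpha> by (intro nrm_upper W.diff_mem)
      also have "\<dots> < \<epsilon> / 3 * c" using n(2) by simp
      finally have "p \<alpha> (h y - n y) * c < \<epsilon> / 3 * c" .
      then show ?thesis using j(2) by (simp only: mult_less_cancel_right_pos less_imp_le)
    qed
    have m: "h y \<in> vsp E" "n y \<in> vsp E" for y using hn W_range by auto
    have "p \<alpha> (h x - h z) \<le> p \<alpha> (h x - n x) + p \<alpha> (n x - h z)" using m \<alpha> by (intro E.p_triangle)
    also have "p \<alpha> (n x - h z) \<le> p \<alpha> (n x - n z) + p \<alpha> (n z - h z)" using m \<alpha> by (intro E.p_triangle)
    finally have "p \<alpha> (h x - h z) \<le> p \<alpha> (h x - n x) + p \<alpha> (n x - n z) + p \<alpha> (h z - n z)"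
      using E.p_commute[OF \<alpha> m(1) m(2)] by simp
    moreover have "x \<in> L" "z \<in> L" using x G by auto
    moreover have "p \<alpha> (n x - n z) < \<epsilon> / 3" using U n x by blast
    ultimately show "p \<alpha> (h x - h z) \<le> \<epsilon>" using near[of x] near[of z] by linarith
  qed
qed

text \<open>Three regions are distinguished. On K the error is at most \<delta>; on L outside K it
  is at most p \<alpha> (h x) + \<delta>, where the weighted size of h is already small; off both
  sets the approximant is zero.\<close>

lemma approximation_uniform_on_compact:
  assumes M: "compactin (vtop W) M" and j: "j \<in> J" "\<alpha> \<in> A" "\<epsilon> > 0"
  shows "\<exists>Z \<phi> L. bump_family Z \<phi> L \<and> (\<forall>h\<in>M. \<forall>x. p \<alpha> (h x - approx Z \<phi> h x) * \<nu> j x \<le> \<epsilon>)"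
proof -
  have MW: "M \<subseteq> vsp W" using M by (simp add: compactin_def vsp_def)
  have e: "\<epsilon> / 2 > 0" using j by simp
  obtain K where K: "compact K" "\<forall>h\<in>M. \<forall>x. x \<notin> K \<longrightarrow> p \<alpha> (h x) * \<nu> j x \<le> \<epsilon> / 2"
    using compact_uniformly_vanishing[OF M j(1,2) e] by blast
  obtain L where L: "compact L" "subordinate_partitions K L"
    using partition_of_unity_on_compact[OF loc_compact K(1) open_UNIV subset_UNIV] by metis
  obtain C where C: "C > 0" "\<And>x. x \<in> K \<union> L \<Longrightarrow> \<nu> j x \<le> C"
    using nu_bounded[OF compact_Un[OF K(1) L(1)] j(1)] by blast
  \<comment> \<open>C bounds the weight on K and on L, so \<delta> costs \<epsilon> / 2; the other
    half is the weighted size of h off K. The cover is determined only after this choice.\<close>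
  define \<delta> where "\<delta> = \<epsilon> / (2 * C)"
  have \<delta>: "\<delta> > 0" "\<delta> * C = \<epsilon> / 2" using j C by (auto simp: \<delta>_def)
  have m: "h x \<in> vsp E" if "h \<in> M" for h x using that MW W_range by blast
  have "\<exists>Z \<phi>. bump_family Z \<phi> L \<and>
    (\<forall>h\<in>M. \<forall>x\<in>K. p \<alpha> (h x - approx Z \<phi> h x) \<le> \<delta>) \<and>
    (\<forall>h\<in>M. \<forall>x. p \<alpha> (h x - approx Z \<phi> h x) \<le> p \<alpha> (h x) + \<delta>)"
    by (intro approximation_on_compact compact_equicontinuous L j m \<delta> M)
  then obtain Z \<phi> where Z: "bump_family Z \<phi> L"
    "\<forall>h\<in>M. \<forall>x\<in>K. p \<alpha> (h x - approx Z \<phi> h x) \<le> \<delta>"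
    "\<forall>h\<in>M. \<forall>x. p \<alpha> (h x - approx Z \<phi> h x) \<le> p \<alpha> (h x) + \<delta>"
    by blast
  show ?thesis
  proof (rule exI[of _ Z], rule exI[of _ \<phi>], rule exI[of _ L], intro conjI Z(1) ballI allI)
    fix h x assume h: "h \<in> M"
    have nn: "0 \<le> \<nu> j x" by (rule nu_nonneg[OF j(1)])
    show "p \<alpha> (h x - approx Z \<phi> h x) * \<nu> j x \<le> \<epsilon>"
    proof (cases "x \<in> K")
      case True
      then have "p \<alpha> (h x - approx Z \<phi> h x) * \<nu> j x \<le> \<delta> * C"
        using Z(2)[rule_format, OF h True] C(2)[of x] nn True \<delta>(1) by (intro mult_mono) auto
      then show ?thesis using \<delta> j by simp
    next
      case False
      then have v: "p \<alpha> (h x) * \<nu> j x \<le> \<epsilon> / 2" by (rule K(2)[rule_format, OF h])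
      show ?thesis
      proof (cases "x \<in> L")
        case True
        have "p \<alpha> (h x - approx Z \<phi> h x) * \<nu> j x \<le> (p \<alpha> (h x) + \<delta>) * \<nu> j x"
          by (rule mult_right_mono[OF Z(3)[rule_format, OF h] nn])
        also have "\<dots> = p \<alpha> (h x) * \<nu> j x + \<delta> * \<nu> j x" by (rule distrib_right)
        also have "\<delta> * \<nu> j x \<le> \<delta> * C" using C(2)[of x] True \<delta>(1) by (intro mult_left_mono) auto
        finally show ?thesis using \<delta>(2) v by linarith
      next
        case False
        then have "approx Z \<phi> h x = 0" unfolding approx_def using Z(1) by (intro sum.neutral) (auto simp: bump_family_def)
        then show ?thesis using v j by simp
      qed
    qed
  qed
qed

lemma approx_tensor:
  assumes "bump_family Z \<phi> L" "\<And>z. h z \<in> vsp E"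
  shows "approx Z \<phi> h \<in> function_tensor (Cc (scalars :: ('k, 'k) tvs)) E"
proof -
  have "(\<lambda>x. \<Sum>z\<in>Z. scl E (of_real (\<phi> z x)) (h z)) \<in> function_tensor (Cc (scalars :: ('k, 'k) tvs)) E"
    using assms by (intro function_tensor_sum Cc_scalars_of_real[of _ L]) (auto simp: bump_family_def)
  moreover have "approx Z \<phi> h = (\<lambda>x. \<Sum>z\<in>Z. scl E (of_real (\<phi> z x)) (h z))"
    by (simp add: approx_def fun_eq_iff)
  ultimately show ?thesis by simp
qed

lemma compactly_supported_mem:
  assumes "continuous_map euclidean (vtop E) f" "compact K" "\<And>x. x \<notin> K \<Longrightarrow> f x = 0"
  shows "f \<in> vsp W"
  unfolding vsp_W_iff using assms by (auto simp: E.p_zero intro!: exI[of _ K])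

lemma Cc_subset: "Cc E \<subseteq> vsp W"
proof
  fix f :: "'x \<Rightarrow> 'v" assume "f \<in> Cc E"
  then have f: "continuous_map euclidean (vtop E) f" "compact (supp f)" by (auto simp: Cc_def)
  show "f \<in> vsp W" by (rule compactly_supported_mem[OF f]) (rule not_in_supp)
qed

lemma function_tensor_subset: "function_tensor (Cc (scalars :: ('k, 'k) tvs)) E \<subseteq> vsp W"
proof
  fix g :: "'x \<Rightarrow> 'v" assume "g \<in> function_tensor (Cc (scalars :: ('k, 'k) tvs)) E"
  then obtain N :: nat and f e where g: "g = (\<lambda>x. \<Sum>n<N. scl E (f n x) (e n))"
    and f: "\<And>n. n < N \<Longrightarrow> f n \<in> Cc (scalars :: ('k, 'k) tvs)" and e: "\<And>n. n < N \<Longrightarrow> e n \<in> vsp E"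
    unfolding function_tensor_def by auto
  show "g \<in> vsp W"
  proof (rule compactly_supported_mem)
    have "continuous_map euclidean euclidean (f n)" if "n < N" for n
      using f[OF that] by (simp add: Cc_def)
    then show "continuous_map euclidean (vtop E) g" unfolding g
      using e by (intro E.continuous_map_sum E.continuous_map_scalar_mult) auto
    show "compact (\<Union>n<N. supp (f n))" using f by (intro compact_UN) (auto simp: Cc_def)
    fix x assume "x \<notin> (\<Union>n<N. supp (f n))"
    then have "f n x = 0" if "n < N" for n using not_in_supp[of x "f n"] that by blast
    then show "g x = 0" unfolding g by (intro sum.neutral) simp
  qed
qed

theorem function_tensor_dense:
  "vtop W closure_of function_tensor (Cc (scalars :: ('k, 'k) tvs)) E = vsp W"
proof (intro equalityI subsetI)
  fix f assume "f \<in> vtop W closure_of function_tensor (Cc (scalars :: ('k, 'k) tvs)) E"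
  then show "f \<in> vsp W" unfolding W.closure_iff by blast
next
  fix f assume f: "f \<in> vsp W"
  show "f \<in> vtop W closure_of function_tensor (Cc (scalars :: ('k, 'k) tvs)) E"
    unfolding W.closure_iff
  proof (intro conjI ballI allI impI f)
    fix i and \<epsilon> :: real assume i: "i \<in> J \<times> A" and \<epsilon>: "\<epsilon> > 0"
    obtain j \<alpha> where ja: "i = (j, \<alpha>)" "j \<in> J" "\<alpha> \<in> A" using i by auto
    have e: "\<epsilon> / 2 > 0" using \<epsilon> by simp
    have "compactin (vtop W) {f}" using f by (simp add: vsp_def)
    then obtain Z \<phi> L where Z: "bump_family Z \<phi> L"
      "\<forall>x. p \<alpha> (f x - approx Z \<phi> f x) * \<nu> j x \<le> \<epsilon> / 2"
      using approximation_uniform_on_compact[OF _ ja(2,3) e, of "{f}"] by auto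
    define g where "g = approx Z \<phi> f"
    have g: "g \<in> function_tensor (Cc (scalars :: ('k, 'k) tvs)) E"
      unfolding g_def using Z(1) W_range[OF f] by (rule approx_tensor)
    then have gW: "g \<in> vsp W" using function_tensor_subset by blast
    have "nrm i (f - g) \<le> \<epsilon> / 2" unfolding ja(1)
      using Z(2) e by (intro nrm_least) (auto simp: g_def)
    then have "nrm i (g - f) < \<epsilon>" using W.p_commute[OF i gW f] \<epsilon> by simp
    then show "\<exists>y\<in>function_tensor (Cc (scalars :: ('k, 'k) tvs)) E \<inter> vsp W. nrm i (y - f) < \<epsilon>"
      using g gW by blast
  qed
qed

theorem Cc_approximation:
  assumes f: "f \<in> Cc E" and V: "open V" "supp f \<subseteq> V" and \<epsilon>: "\<epsilon> > 0" and j: "j \<in> J" "\<alpha> \<in> A"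
  shows "\<exists>g\<in>function_tensor (Cc (scalars :: ('k, 'k) tvs)) E. supp g \<subseteq> V \<and>
    wsup UNIV (\<nu> j) (p \<alpha>) (f - g) \<le> ennreal \<epsilon>"
proof -
  have fW: "f \<in> vsp W" using f Cc_subset by blast
  have K: "compact (supp f)" using f by (simp add: Cc_def)
  obtain L where L: "compact L" "L \<subseteq> V" "subordinate_partitions (supp f) L"
    using partition_of_unity_on_compact[OF loc_compact K V] by blast
  obtain C where C: "C > 0" "\<And>x. x \<in> supp f \<union> L \<Longrightarrow> \<nu> j x \<le> C"
    using nu_bounded[OF compact_Un[OF K L(1)] j(1)] by blast
  \<comment> \<open>No halving here: off the support f vanishes, so the bound p \<alpha> (f x) +
    \<delta> reduces to \<delta> there.\<close>
  define \<delta> where "\<delta> = \<epsilon> / C"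
  have \<delta>: "\<delta> > 0" "\<delta> * C = \<epsilon>" using \<epsilon> C by (auto simp: \<delta>_def)
  have c: "compactin (vtop W) {f}" using fW by (simp add: vsp_def)
  have m: "h x \<in> vsp E" if "h \<in> {f}" for h x using that W_range[OF fW] by simp
  have "\<exists>Z \<phi>. bump_family Z \<phi> L \<and>
    (\<forall>h\<in>{f}. \<forall>x\<in>supp f. p \<alpha> (h x - approx Z \<phi> h x) \<le> \<delta>) \<and>
    (\<forall>h\<in>{f}. \<forall>x. p \<alpha> (h x - approx Z \<phi> h x) \<le> p \<alpha> (h x) + \<delta>)"
    by (intro approximation_on_compact compact_equicontinuous L j m \<delta> c)
  then obtain Z \<phi> where Z: "bump_family Z \<phi> L"
    "\<forall>x\<in>supp f. p \<alpha> (f x - approx Z \<phi> f x) \<le> \<delta>"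
    "\<forall>x. p \<alpha> (f x - approx Z \<phi> f x) \<le> p \<alpha> (f x) + \<delta>"
    by auto
  define g where "g = approx Z \<phi> f"
  have zero: "g x = 0" if "x \<notin> L" for x
    unfolding g_def approx_def using Z(1) that by (intro sum.neutral) (auto simp: bump_family_def)
  have "supp g \<subseteq> L" using zero by (intro supp_subset(1) L(1)) auto
  then have "supp g \<subseteq> V" using L(2) by blast
  moreover have "g \<in> function_tensor (Cc (scalars :: ('k, 'k) tvs)) E"
    unfolding g_def using Z(1) W_range[OF fW] by (rule approx_tensor)
  moreover have "wsup UNIV (\<nu> j) (p \<alpha>) (f - g) \<le> ennreal \<epsilon>"
  proof (rule wsup_least)
    fix x
    show "p \<alpha> ((f - g) x) * \<nu> j x \<le> \<epsilon>"
    proof (cases "x \<in> supp f \<union> L")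
      case True
      have "p \<alpha> ((f - g) x) \<le> \<delta>"
        using Z(2)[rule_format, of x] Z(3)[rule_format, of x] not_in_supp[of x f] E.p_zero[OF j(2)]
        by (cases "x \<in> supp f") (auto simp: g_def)
      then have "p \<alpha> ((f - g) x) * \<nu> j x \<le> \<delta> * C"
        using C(2)[OF True] nu_nonneg[OF j(1)] \<delta>(1) by (intro mult_mono) auto
      then show ?thesis using \<delta>(2) by simp
    next
      case False
      then show ?thesis using not_in_supp[of x f] zero[of x] \<epsilon> by (simp add: E.p_zero[OF j(2)])
    qed
  qed
  ultimately show ?thesis by blast
qed

end

section \<open>Continuous linear maps\<close>

context seminormed_space
begin

lemma cont_lin_range: "u \<in> cont_lin Z X \<Longrightarrow> u v \<in> vsp X"
  by (cases "v \<in> vsp Z") (auto simp: cont_lin_def continuous_map_def vsp_def[symmetric])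

lemma cont_lin_add:
  assumes "u \<in> cont_lin Z X" "w \<in> cont_lin Z X"
  shows "u + w \<in> cont_lin Z X"
  using assms continuous_map_plus[of "vtop Z" u w]
  by (simp add: cont_lin_def linear_on_def plus_fun_def V.scale_right_distrib algebra_simps)

lemma cont_lin_scl:
  assumes "u \<in> cont_lin Z X"
  shows "(\<lambda>v. scl X c (u v)) \<in> cont_lin Z X"
  using assms continuous_map_scl[of "vtop Z" u c]
  by (simp add: cont_lin_def linear_on_def V.scale_right_distrib mult.commute)

lemma cont_lin_diff:
  assumes "u \<in> cont_lin Z X" "w \<in> cont_lin Z X"
  shows "u - w \<in> cont_lin Z X"
proof -
  have eq: "u - w = u + (\<lambda>v. scl X (- 1) (w v))" by (simp add: fun_eq_iff)
  show ?thesis unfolding eq by (intro cont_lin_add cont_lin_scl assms)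
qed

lemma cont_lin_zero: "0 \<in> cont_lin Z X"
  using continuous_map_zero[of "vtop Z"] by (simp add: cont_lin_def linear_on_def zero_fun_def)

lemma cont_lin_sum:
  assumes "\<And>i. i \<in> I \<Longrightarrow> y i \<in> cont_lin Z scalars" "\<And>i. i \<in> I \<Longrightarrow> e i \<in> vsp X"
  shows "(\<lambda>v. \<Sum>i\<in>I. scl X (y i v) (e i)) \<in> cont_lin Z X"
proof -
  have y: "continuous_map (vtop Z) euclidean (y i)" "\<And>v w. v \<in> vsp Z \<Longrightarrow> w \<in> vsp Z \<Longrightarrow> y i (v + w) = y i v + y i w"
    "\<And>c v. v \<in> vsp Z \<Longrightarrow> y i (scl Z c v) = c * y i v" "\<And>v. v \<notin> vsp Z \<Longrightarrow> y i v = 0"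
    if "i \<in> I" for i
    using assms(1)[OF that] by (auto simp: cont_lin_def linear_on_def)
  have "continuous_map (vtop Z) (vtop X) (\<lambda>v. \<Sum>i\<in>I. scl X (y i v) (e i))"
    using y(1) assms(2) by (intro continuous_map_sum continuous_map_scalar_mult)
  then show ?thesis
    by (simp add: cont_lin_def linear_on_def y V.scale_left_distrib sum.distrib V.scale_sum_right)
qed

text \<open>The finite family \<T> is kept and not replaced by its union, which may leave \<SS>: a
  union of absolutely convex sets need not be absolutely convex. As in
  \<open>ball_in_finite_Inter\<close>, directedness leaves one seminorm and one radius.\<close>

lemma cont_lin_nbhd:
  assumes "finite \<F>"
    "\<F> \<subseteq> {{u \<in> cont_lin Z X. \<forall>v\<in>M. u v \<in> V} | M V. M \<in> \<SS> \<and> openin (vtop X) V \<and> 0 \<in> V}"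
  shows "\<exists>\<T> \<alpha> r. finite \<T> \<and> \<T> \<subseteq> \<SS> \<and> \<alpha> \<in> A \<and> r > 0 \<and>
    (\<forall>u\<in>cont_lin Z X. (\<forall>v\<in>\<Union>\<T>. p \<alpha> (u v) < r) \<longrightarrow> u \<in> \<Inter>\<F>)"
  using assms
proof (induction \<F>)
  case empty
  obtain \<alpha> where "\<alpha> \<in> A" using index_nonempty by blast
  then show ?case by (intro exI[of _ "{}"] exI[of _ \<alpha>] exI[of _ 1]) simp
next
  case (insert B \<F>)
  then obtain \<T> \<alpha> r where 1: "finite \<T>" "\<T> \<subseteq> \<SS>" "\<alpha> \<in> A" "r > 0"
    "\<forall>u\<in>cont_lin Z X. (\<forall>v\<in>\<Union>\<T>. p \<alpha> (u v) < r) \<longrightarrow> u \<in> \<Inter>\<F>" by auto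
  obtain M V where B: "B = {u \<in> cont_lin Z X. \<forall>v\<in>M. u v \<in> V}" "M \<in> \<SS>" "openin (vtop X) V" "0 \<in> V"
    using insert.prems by auto
  obtain \<beta> s where 2: "\<beta> \<in> A" "s > 0" "\<forall>y\<in>vsp X. p \<beta> (y - 0) < s \<longrightarrow> y \<in> V"
    using B(3,4) unfolding openin_iff by blast
  obtain \<gamma> C where 3: "\<gamma> \<in> A" "C > 0" "\<forall>v\<in>vsp X. p \<alpha> v \<le> C * p \<gamma> v \<and> p \<beta> v \<le> C * p \<gamma> v"
    using directed 1(3) 2(1) by blast
  have "u \<in> \<Inter>(insert B \<F>)"
    if u: "u \<in> cont_lin Z X" "\<forall>v\<in>\<Union>(insert M \<T>). p \<gamma> (u v) < min r s / C" for u
  proof -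
    have le: "p \<alpha> (u v) < r" "p \<beta> (u v) < s" if "v \<in> \<Union>(insert M \<T>)" for v
    proof -
      have "C * p \<gamma> (u v) < min r s" using u(2) that 3(2) by (simp add: field_simps)
      moreover have "p \<alpha> (u v) \<le> C * p \<gamma> (u v)" "p \<beta> (u v) \<le> C * p \<gamma> (u v)"
        using 3(3) cont_lin_range[OF u(1)] by auto
      ultimately show "p \<alpha> (u v) < r" "p \<beta> (u v) < s" by linarith+
    qed
    have "u \<in> \<Inter>\<F>" using 1(5) u(1) le(1) by auto
    moreover have "u \<in> B" unfolding B(1) using u(1) le(2) 2(3) cont_lin_range[OF u(1)] by auto
    ultimately show ?thesis by auto
  qed
  then have "\<forall>u\<in>cont_lin Z X. (\<forall>v\<in>\<Union>(insert M \<T>). p \<gamma> (u v) < min r s / C) \<longrightarrow> u \<in> \<Inter>(insert B \<F>)"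
    by blast
  moreover have "finite (insert M \<T>)" "insert M \<T> \<subseteq> \<SS>" "min r s / C > 0" using 1 2 3 B(2) by simp_all
  ultimately show ?case using 3(1)
    by (intro exI[of _ "insert M \<T>"] exI[of _ \<gamma>] exI[of _ "min r s / C"] conjI)
qed

lemma dual_add: "y \<in> dual X \<Longrightarrow> v \<in> vsp X \<Longrightarrow> w \<in> vsp X \<Longrightarrow> y (v + w) = y v + y w"
  and dual_scl: "y \<in> dual X \<Longrightarrow> v \<in> vsp X \<Longrightarrow> y (scl X c v) = c * y v"
  by (auto simp: dual_def cont_lin_def linear_on_def)

lemma dual_zero: "y \<in> dual X \<Longrightarrow> y 0 = 0"
  using dual_scl[of y 0 0] by simp

lemma dual_diff: "y \<in> dual X \<Longrightarrow> v \<in> vsp X \<Longrightarrow> w \<in> vsp X \<Longrightarrow> y (v - w) = y v - y w"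
  using dual_add[of y "v - w" w] diff_mem by simp

lemma dual_sum: "y \<in> dual X \<Longrightarrow> (\<And>i. i \<in> I \<Longrightarrow> v i \<in> vsp X) \<Longrightarrow> y (sum v I) = (\<Sum>i\<in>I. y (v i))"
  by (induction I rule: infinite_finite_induct) (auto simp: dual_zero dual_add sum_mem)

text \<open>Equicontinuity at 0 is combined with homogeneity. If p \<alpha> v vanishes, all
  multiples of v stay in the ball and y v must be 0; otherwise v is rescaled to size r / 2, whence
  the constant 2 / r.\<close>

lemma equicontinuous_bound:
  assumes H: "H \<in> equicontinuous_sets X"
  shows "\<exists>\<alpha>\<in>A. \<exists>C>0. \<forall>y\<in>H. \<forall>v\<in>vsp X. norm (y v) \<le> C * p \<alpha> v"
proof -
  have Hd: "y \<in> dual X" if "y \<in> H" for y using that H by (auto simp: equicontinuous_sets_def)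
  have "\<forall>v\<in>vsp X. \<forall>\<epsilon>>0. \<exists>U. openin (vtop X) U \<and> v \<in> U \<and> (\<forall>w\<in>U. \<forall>y\<in>H. norm (y w - y v) < \<epsilon>)"
    using H by (simp add: equicontinuous_sets_def)
  from this[rule_format, OF zero_mem zero_less_one]
  obtain U where U: "openin (vtop X) U" "0 \<in> U" "\<forall>w\<in>U. \<forall>y\<in>H. norm (y w - y 0) < 1" by blast
  then obtain \<alpha> r where a: "\<alpha> \<in> A" "r > 0" "\<forall>v\<in>vsp X. p \<alpha> (v - 0) < r \<longrightarrow> v \<in> U"
    unfolding openin_iff by blast
  have "norm (y v) \<le> 2 / r * p \<alpha> v" if y: "y \<in> H" and v: "v \<in> vsp X" for y v
  proof -
    have small: "norm (y w) < 1" if "w \<in> vsp X" "p \<alpha> w < r" for w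
    proof -
      have "w \<in> U" using a(3) that by simp
      then have "norm (y w - y 0) < 1" using U(3) y by blast
      then show ?thesis by (simp add: dual_zero[OF Hd[OF y]])
    qed
    show ?thesis
    proof (cases "p \<alpha> v = 0")
      case True
      have "norm (y v) * n < 1" for n :: nat
        using small[of "scl X (of_nat n) v"] True v a
        by (simp add: scl_mem p_scl dual_scl[OF Hd[OF y]] norm_mult mult.commute)
      then have "norm (y v) = 0"
        by (metis ex_less_of_nat_mult less_asym mult.commute norm_ge_zero order_le_less)
      then show ?thesis using True by simp
    next
      case False
      then have pos: "p \<alpha> v > 0" using p_nonneg[OF a(1) v] by simp
      define c where "c = r / (2 * p \<alpha> v)"
      have c: "c > 0" using pos a by (simp add: c_def)
      have "p \<alpha> (scl X (of_real c) v) < r" using a v c pos by (simp add: p_scl) (simp add: c_def)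
      then have "norm (y (scl X (of_real c) v)) < 1" using small[OF scl_mem[OF v]] by blast
      then have "c * norm (y v) < 1" using c by (simp add: dual_scl[OF Hd[OF y] v] norm_mult)
      then show ?thesis using pos a by (simp add: c_def field_simps)
    qed
  qed
  then show ?thesis using a by (intro bexI[of _ \<alpha>] exI[of _ "2 / r"]) auto
qed

lemma equicontinuousI:
  assumes "H \<subseteq> dual X" "\<alpha> \<in> A" "C > 0" "\<And>y v. y \<in> H \<Longrightarrow> v \<in> vsp X \<Longrightarrow> norm (y v) \<le> C * p \<alpha> v"
  shows "H \<in> equicontinuous_sets X"
  unfolding equicontinuous_sets_def
proof (intro CollectI conjI ballI allI impI assms(1))
  fix v and \<epsilon> :: real assume v: "v \<in> vsp X" and e: "\<epsilon> > 0"
  have "norm (y w - y v) < \<epsilon>" if "w \<in> vsp X" "p \<alpha> (w - v) < \<epsilon> / C" "y \<in> H" for w y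
  proof -
    have "norm (y w - y v) \<le> C * p \<alpha> (w - v)"
      using assms(4)[OF that(3) diff_mem[OF that(1) v]] dual_diff[of y w v] assms(1) that v by auto
    also have "\<dots> < \<epsilon>" using that assms(3) by (simp add: field_simps)
    finally show ?thesis .
  qed
  then show "\<exists>U. openin (vtop X) U \<and> v \<in> U \<and> (\<forall>w\<in>U. \<forall>y\<in>H. norm (y w - y v) < \<epsilon>)"
    using openin_ball[OF assms(2) v, of "\<epsilon> / C"] v e assms(2,3) p_zero
    by (intro exI[of _ "{w \<in> vsp X. p \<alpha> (w - v) < \<epsilon> / C}"]) auto
qed

lemma singleton_equicontinuous:
  assumes "y \<in> dual X" shows "{y} \<in> equicontinuous_sets X"
  unfolding equicontinuous_sets_def
proof (intro CollectI conjI ballI allI impI)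
  fix v and \<epsilon> :: real assume v: "v \<in> vsp X" and e: "\<epsilon> > 0"
  have "continuous_map (vtop X) euclidean y" using assms by (simp add: dual_def cont_lin_def)
  then have "openin (vtop X) {w \<in> topspace (vtop X). y w \<in> ball (y v) \<epsilon>}"
    by (rule openin_continuous_map_preimage) simp
  then show "\<exists>U. openin (vtop X) U \<and> v \<in> U \<and> (\<forall>w\<in>U. \<forall>y\<in>{y}. norm (y w - y v) < \<epsilon>)"
    using v e by (intro exI[of _ "{w \<in> topspace (vtop X). y w \<in> ball (y v) \<epsilon>}"])
      (auto simp: vsp_def dist_norm norm_minus_commute)
qed (use assms in auto)

end

lemma vsp_dual_kappa [simp]: "vsp (dual_kappa X) = dual X"
  by (simp add: vsp_def dual_kappa_def cont_lin_tvs_def dual_def)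

lemma scl_dual_kappa [simp]: "scl (dual_kappa X) = (\<lambda>c y f. c * y f)"
  by (simp add: dual_kappa_def cont_lin_tvs_def)

lemma vsp_eps_product [simp]: "vsp (X \<epsilon>\<^sub>t Y) = cont_lin (dual_kappa X) Y"
  by (simp add: vsp_def eps_product_def cont_lin_tvs_def)

lemma scl_eps_product [simp]: "scl (X \<epsilon>\<^sub>t Y) = (\<lambda>c u y. scl Y c (u y))"
  by (simp add: eps_product_def cont_lin_tvs_def)

section \<open>The \<open>\<epsilon>\<close>-product of a weighted space\<close>

lemma sum_fun_apply: "sum f I x = (\<Sum>i\<in>I. f i x)"
  by (induction I rule: infinite_finite_induct) auto

text \<open>The same weights carry two spaces, one with values in E and one with scalar values. Both
  are needed at once, since operators on the dual of the second produce members of the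
  first.\<close>

locale eps_setting = weighted_space J \<nu> E A p +
    F: weighted_space J \<nu> "scalars :: ('k, 'k) tvs" "{()}" "\<lambda>_::unit. norm"
  for J :: "'j set" and \<nu> :: "'j \<Rightarrow> 'x::t2_space \<Rightarrow> real"
    and E :: "('k::real_or_complex, 'v::ab_group_add) tvs" and A :: "'a set" and p :: "'a \<Rightarrow> 'v \<Rightarrow> real" +
  assumes lcHs_E: "lcHs E"
begin

abbreviation "FF \<equiv> CV0 J \<nu> (scalars :: ('k, 'k) tvs) {()} (\<lambda>_::unit. norm)"
abbreviation "DK \<equiv> dual_kappa FF"

definition delta :: "'x \<Rightarrow> ('x \<Rightarrow> 'k) \<Rightarrow> 'k" where
  "delta x h = (if h \<in> vsp FF then h x else 0)"

definition bump :: "('x \<Rightarrow> 'x \<Rightarrow> real) \<Rightarrow> 'x \<Rightarrow> 'x \<Rightarrow> 'k" where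
  "bump \<phi> z x = of_real (\<phi> z x)"

lemma delta_apply [simp]: "h \<in> vsp FF \<Longrightarrow> delta x h = h x"
  by (simp add: delta_def)

lemma delta_dual: "delta x \<in> dual FF"
proof -
  obtain j where j: "j \<in> J" "0 < \<nu> j x" using nu_positive by blast
  have "continuous_map (vtop FF) (vtop scalars) (delta x)"
    unfolding F.E.continuous_map_into_iff
  proof (intro conjI ballI allI impI)
    fix h and \<epsilon> :: real assume "h \<in> topspace (vtop FF)" and e: "\<epsilon> > 0"
    then have h: "h \<in> vsp FF" by (simp add: vsp_def)
    have "norm (delta x g - delta x h) < \<epsilon>" if g: "g \<in> vsp FF" "F.nrm (j, ()) (g - h) < \<epsilon> * \<nu> j x" for g
    proof -
      have "norm ((g - h) x) * \<nu> j x \<le> F.nrm (j, ()) (g - h)"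
        using F.nrm_upper[OF F.W.diff_mem[OF g(1) h] j(1), of "()" x] by simp
      then have "norm (g x - h x) * \<nu> j x < \<epsilon> * \<nu> j x" using g(2) by simp
      then show ?thesis using j g h by simp
    qed
    then show "\<exists>U. openin (vtop FF) U \<and> h \<in> U \<and> (\<forall>s\<in>U. norm (delta x s - delta x h) < \<epsilon>)"
      using F.W.openin_ball[of "(j, ())" h "\<epsilon> * \<nu> j x"] h e j F.W.p_zero[of "(j, ())"]
      by (intro exI[of _ "{g \<in> vsp FF. F.nrm (j, ()) (g - h) < \<epsilon> * \<nu> j x}"]) auto
  qed simp
  then show ?thesis
    by (simp add: dual_def cont_lin_def linear_on_def delta_def F.W.mems F.scl_W)
      (simp add: F.W.scl_mem[unfolded F.scl_W, simplified])
qed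

lemma bump_mem: "bump_family Z \<phi> L \<Longrightarrow> z \<in> Z \<Longrightarrow> bump \<phi> z \<in> vsp FF"
  using F.Cc_subset Cc_scalars_of_real[of "\<phi> z" L, where 'k='k]
  by (auto simp: bump_family_def bump_def[abs_def])

lemma approx_eq: "F.approx Z \<phi> h = (\<Sum>z\<in>Z. scl FF (h z) (bump \<phi> z))"
  by (rule ext) (simp add: F.approx_def F.scl_W bump_def mult.commute sum_fun_apply)

lemma approx_mem: "bump_family Z \<phi> L \<Longrightarrow> F.approx Z \<phi> h \<in> vsp FF"
  unfolding approx_eq by (intro F.W.sum_mem F.W.scl_mem bump_mem)

text \<open>Equicontinuity bounds all y in H by one seminorm, so approximating h to within
  \<epsilon> / C in that seminorm serves every y simultaneously. The value of y at the approximant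
  is the value at h of a combination of point functionals.\<close>

lemma dual_approx:
  assumes M: "compactin (vtop FF) M" and H: "H \<in> equicontinuous_sets FF" and \<epsilon>: "\<epsilon> > 0"
  shows "\<exists>Z \<phi> L. bump_family Z \<phi> L \<and> (\<forall>y\<in>H. \<forall>h\<in>M. norm (y h - (\<Sum>z\<in>Z. y (bump \<phi> z) * h z)) \<le> \<epsilon>)"
proof -
  obtain i C where i: "i \<in> J \<times> {()}" "C > 0" "\<forall>y\<in>H. \<forall>h\<in>vsp FF. norm (y h) \<le> C * F.nrm i h"
    using F.W.equicontinuous_bound[OF H] by blast
  then obtain j where j: "i = (j, ())" "j \<in> J" by auto
  have e: "\<epsilon> / C > 0" using \<epsilon> i by simp
  obtain Z \<phi> L where Z: "bump_family Z \<phi> L" "\<forall>h\<in>M. \<forall>x. norm (h x - F.approx Z \<phi> h x) * \<nu> j x \<le> \<epsilon> / C"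
    using F.approximation_uniform_on_compact[OF M j(2) singletonI e] by blast
  have "norm (y h - (\<Sum>z\<in>Z. y (bump \<phi> z) * h z)) \<le> \<epsilon>" if y: "y \<in> H" and h: "h \<in> M" for y h
  proof -
    have yd: "y \<in> dual FF" using y H by (auto simp: equicontinuous_sets_def)
    have hF: "h \<in> vsp FF" using h M by (auto simp: compactin_def vsp_def)
    have "y (F.approx Z \<phi> h) = (\<Sum>z\<in>Z. y (bump \<phi> z) * h z)"
      unfolding approx_eq using bump_mem[OF Z(1)]
      by (subst F.W.dual_sum[OF yd]) (auto simp: F.W.scl_mem F.W.dual_scl[OF yd] mult.commute)
    then have "y h - (\<Sum>z\<in>Z. y (bump \<phi> z) * h z) = y (h - F.approx Z \<phi> h)"
      using F.W.dual_diff[OF yd hF approx_mem[OF Z(1)]] by simp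
    moreover have "norm (y (h - F.approx Z \<phi> h)) \<le> C * F.nrm i (h - F.approx Z \<phi> h)"
      using i(3) y F.W.diff_mem[OF hF approx_mem[OF Z(1)]] by blast
    moreover have "F.nrm i (h - F.approx Z \<phi> h) \<le> \<epsilon> / C"
      unfolding j(1) using Z(2) h \<epsilon> i(2) by (intro F.nrm_least) auto
    ultimately show ?thesis using i(2) by (simp add: field_simps)
  qed
  then show ?thesis using Z(1) by blast
qed

theorem approximation_property_FF: "approximation_property FF"
  unfolding approximation_property_def in_closure_of
proof (intro conjI allI impI)
  let ?id = "\<lambda>v. if v \<in> vsp FF then v else 0"
  let ?T = "cont_lin_tvs FF FF (abs_convex_compacts FF)"
  have id: "?id \<in> cont_lin FF FF"
  proof -
    have "continuous_map (vtop FF) (vtop FF) (\<lambda>v. v)" using continuous_map_id by (simp add: id_def)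
    then have "continuous_map (vtop FF) (vtop FF) ?id"
      by (rule continuous_map_eq) (simp add: vsp_def)
    then show ?thesis by (simp add: cont_lin_def linear_on_def F.W.mems)
  qed
  then show "?id \<in> topspace (vtop ?T)" by (simp add: cont_lin_tvs_def)
  fix T assume T: "?id \<in> T \<and> openin (vtop ?T) T"
  let ?B = "{{u \<in> cont_lin FF FF. \<forall>v\<in>M. u v \<in> V} | M V.
      M \<in> abs_convex_compacts FF \<and> openin (vtop FF) V \<and> 0 \<in> V}"
  from T obtain \<F> where F: "finite \<F>" "\<F> \<subseteq> ?B" "\<forall>u\<in>cont_lin FF FF. u - ?id \<in> \<Inter>\<F> \<longrightarrow> u \<in> T"
    unfolding cont_lin_tvs_def tvs.simps openin_zero_nbhd_topology by blast
  obtain \<T> i r where t: "finite \<T>" "\<T> \<subseteq> abs_convex_compacts FF" "i \<in> J \<times> {()}" "r > 0"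
    "\<forall>u\<in>cont_lin FF FF. (\<forall>v\<in>\<Union>\<T>. F.nrm i (u v) < r) \<longrightarrow> u \<in> \<Inter>\<F>"
    using F.W.cont_lin_nbhd[OF F(1,2)] by blast
  obtain j where j: "i = (j, ())" "j \<in> J" using t(3) by auto
  \<comment> \<open>A finite union of absolutely convex compact sets is still compact, and the
    approximation is uniform on compact sets.\<close>
  have M: "compactin (vtop FF) (\<Union>\<T>)"
    using t(1,2) by (intro compactin_Union) (auto simp: abs_convex_compacts_def)
  have e: "r / 2 > 0" using t by simp
  obtain Z \<phi> L where Z: "bump_family Z \<phi> L"
    "\<forall>h\<in>\<Union>\<T>. \<forall>x. norm (h x - F.approx Z \<phi> h x) * \<nu> j x \<le> r / 2"
    using F.approximation_uniform_on_compact[OF M j(2) singletonI e] by blast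
  \<comment> \<open>Written with \<open>delta\<close> instead of plain evaluation so that u vanishes
    off the space, as \<open>cont_lin\<close> demands; on the space it is the partition
    operator.\<close>
  define u where "u h = (\<Sum>z\<in>Z. scl FF (delta z h) (bump \<phi> z))" for h
  have u: "u \<in> cont_lin FF FF" unfolding u_def
    using delta_dual bump_mem[OF Z(1)] by (intro F.W.cont_lin_sum) (auto simp: dual_def)
  moreover have "u ` vsp FF \<subseteq> module.span (scl FF) (bump \<phi> ` Z)"
    unfolding u_def by (intro image_subsetI F.W.V.span_sum F.W.V.span_scale F.W.V.span_base imageI)
  ultimately have fr: "u \<in> finite_rank FF"
    using Z(1) by (auto simp: finite_rank_def bump_family_def intro!: exI[of _ "bump \<phi> ` Z"])
  have small: "F.nrm i ((u - ?id) h) < r" if h: "h \<in> \<Union>\<T>" for h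
  proof -
    have hF: "h \<in> vsp FF" using h M by (auto simp: compactin_def vsp_def)
    have "u h = F.approx Z \<phi> h" unfolding approx_eq u_def using hF by simp
    moreover have "F.nrm i (h - F.approx Z \<phi> h) \<le> r / 2"
      unfolding j(1) using Z(2) h t(4) by (intro F.nrm_least) auto
    ultimately show ?thesis
      using F.W.p_commute[OF t(3) hF approx_mem[OF Z(1)]] hF t(4) by simp
  qed
  have "u - ?id \<in> \<Inter>\<F>" by (rule t(5)[rule_format, OF F.W.cont_lin_diff[OF u id] small])
  then show "\<exists>u. u \<in> finite_rank FF \<and> u \<in> T" using F(3) u fr by blast
qed

text \<open>Continuity at zero, made homogeneous: p \<alpha> (u y) is at most C times the supremum
  of norm (y f) over one compact M. Any positive bound t stands in for the supremum; positivity
  allows y to be rescaled by r / (2 * t).\<close>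

lemma kappa_bound:
  assumes u: "u \<in> cont_lin DK E" and \<alpha>: "\<alpha> \<in> A"
  shows "\<exists>M C. compactin (vtop FF) M \<and> C > 0 \<and>
    (\<forall>y\<in>dual FF. \<forall>t>0. (\<forall>f\<in>M. norm (y f) \<le> t) \<longrightarrow> p \<alpha> (u y) \<le> C * t)"
proof -
  have lin: "u (\<lambda>f. c * y f) = scl E c (u y)" if "y \<in> dual FF" for c y
    using u that by (auto simp: cont_lin_def linear_on_def)
  have zero_dual: "0 \<in> dual FF" unfolding dual_def by (rule F.E.cont_lin_zero)
  have "u (\<lambda>f. 0 * (0 :: ('x \<Rightarrow> 'k) \<Rightarrow> 'k) f) = scl E 0 (u 0)" by (rule lin[OF zero_dual])
  then have u0: "u 0 = 0" by (simp add: zero_fun_def)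
  define G where "G = {y \<in> topspace (vtop DK). u y \<in> {v \<in> vsp E. p \<alpha> (v - 0) < 1}}"
  have "openin (vtop DK) G" unfolding G_def
    using u \<alpha> by (intro openin_continuous_map_preimage[where Y="vtop E"] E.openin_ball) (auto simp: cont_lin_def)
  moreover have "0 \<in> G" using zero_dual u0 E.p_zero[OF \<alpha>] by (simp add: G_def vsp_def[symmetric])
  ultimately obtain \<F> where F: "finite \<F>"
    "\<F> \<subseteq> {{u \<in> cont_lin FF scalars. \<forall>v\<in>M. u v \<in> V} | M V.
      M \<in> abs_convex_compacts FF \<and> openin (vtop scalars) V \<and> 0 \<in> V}"
    "\<forall>y\<in>cont_lin FF scalars. y - 0 \<in> \<Inter>\<F> \<longrightarrow> y \<in> G"
    unfolding dual_kappa_def cont_lin_tvs_def tvs.simps openin_zero_nbhd_topology by blast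
  obtain \<T> i r where t: "finite \<T>" "\<T> \<subseteq> abs_convex_compacts FF" "i \<in> {()}" "r > 0"
    "\<forall>y\<in>cont_lin FF scalars. (\<forall>v\<in>\<Union>\<T>. norm (y v) < r) \<longrightarrow> y \<in> \<Inter>\<F>"
    using F.E.cont_lin_nbhd[OF F(1,2)] by blast
  have M: "compactin (vtop FF) (\<Union>\<T>)"
    using t(1,2) by (intro compactin_Union) (auto simp: abs_convex_compacts_def)
  have "p \<alpha> (u y) \<le> 2 / r * s" if y: "y \<in> dual FF" and s: "s > 0" "\<forall>f\<in>\<Union>\<T>. norm (y f) \<le> s" for y s
  proof -
    define c where "c = r / (2 * s)"
    have c: "c > 0" using t s by (simp add: c_def)
    define y' where "y' f = of_real c * y f" for f
    have y': "y' \<in> cont_lin FF scalars"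
      using F.E.cont_lin_scl[of y FF "of_real c"] y unfolding y'_def dual_def by simp
    have small: "norm (y' f) < r" if "f \<in> \<Union>\<T>" for f
    proof -
      have "norm (y' f) = c * norm (y f)" using c by (simp add: y'_def norm_mult)
      also have "\<dots> \<le> c * s" using s that c by (intro mult_left_mono) auto
      also have "\<dots> < r" using s t by (simp add: c_def)
      finally show ?thesis .
    qed
    have "y' \<in> \<Inter>\<F>" by (rule t(5)[rule_format, OF y' small])
    then have "y' \<in> G" using F(3)[rule_format, OF y'] by (simp only: diff_zero)
    then have "p \<alpha> (u y') < 1" by (simp add: G_def)
    moreover have "u y' = scl E (of_real c) (u y)" unfolding y'_def by (rule lin[OF y])
    ultimately have "c * p \<alpha> (u y) < 1" using c by (simp add: E.p_scl[OF \<alpha> E.cont_lin_range[OF u]])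
    then show ?thesis using s t by (simp add: c_def field_simps)
  qed
  then show ?thesis using M t(4) by (intro exI[of _ "\<Union>\<T>"] exI[of _ "2 / r"]) auto
qed

end

section \<open>Absolutely convex lines, rescaled polars and separation of points\<close>

context seminormed_space
begin

text \<open>The smallest absolutely convex set containing v. It is what allows a neighbourhood of
  zero in \<open>dual_kappa\<close> to control the single value y v, and hence makes elementary
  tensors continuous.\<close>

lemma line_abs_convex_compact:
  assumes v: "v \<in> vsp X"
  shows "(\<lambda>c. scl X c v) ` cball 0 1 \<in> abs_convex_compacts X"
  unfolding abs_convex_compacts_def abs_convex_def
proof (intro CollectI conjI ballI allI impI)
  show "(\<lambda>c. scl X c v) ` cball 0 1 \<subseteq> vsp X" using v by (auto intro: scl_mem)
  have "continuous_map euclidean (vtop X) (\<lambda>c. scl X c v)"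
    using v by (intro continuous_map_scalar_mult) auto
  then show "compactin (vtop X) ((\<lambda>c. scl X c v) ` cball 0 1)"
    by (rule image_compactin[rotated]) (simp add: compact_cball_scalar)
next
  fix w w' and a b :: 'k
  assume w: "w \<in> (\<lambda>c. scl X c v) ` cball 0 1" "w' \<in> (\<lambda>c. scl X c v) ` cball 0 1" and ab: "norm a + norm b \<le> 1"
  obtain c where c: "w = scl X c v" "c \<in> cball 0 1" using w(1) by blast
  obtain d where d: "w' = scl X d v" "d \<in> cball 0 1" using w(2) by blast
  have cd: "norm c \<le> 1" "norm d \<le> 1" using c d by auto
  have "norm (a * c + b * d) \<le> norm a * norm c + norm b * norm d"
    by (metis norm_mult norm_triangle_ineq)
  also have "\<dots> \<le> norm a * 1 + norm b * 1" using cd by (intro add_mono mult_left_mono) auto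
  finally have "a * c + b * d \<in> cball 0 1" using ab by simp
  moreover have "scl X a w + scl X b w' = scl X (a * c + b * d) v"
    by (simp add: c(1) d(1) V.scale_left_distrib)
  ultimately show "scl X a w + scl X b w' \<in> (\<lambda>c. scl X c v) ` cball 0 1" by blast
qed

text \<open>Comparison of seminorms holds only up to a constant, so passing to a dominating seminorm
  rescales the functional.\<close>

lemma polar_subset_scale:
  assumes "l \<in> polar \<alpha>" "C > 0" "\<forall>v\<in>vsp X. p \<alpha> v \<le> C * p \<gamma> v"
  shows "(\<lambda>v. of_real (1 / C) * l v) \<in> polar \<gamma>"
proof -
  have "norm (of_real (1 / C) * l v) \<le> p \<gamma> v" if v: "v \<in> vsp X" for v
  proof -
    have "norm (l v) \<le> C * p \<gamma> v" using polar_le[OF assms(1) v] assms(3) v by fastforce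
    moreover have eq: "norm (of_real (1 / C) * l v) = norm (l v) / C" using assms(2) by (simp add: norm_mult norm_divide)
    ultimately show ?thesis unfolding eq using assms(2) by (simp add: pos_divide_le_eq mult.commute)
  qed
  then show ?thesis using assms(1) by (simp add: polar_def linear_on_def add_divide_distrib)
qed

lemma polar_separates:
  assumes "lcHs X" "v \<in> vsp X" "w \<in> vsp X" "\<And>\<alpha> l. \<alpha> \<in> A \<Longrightarrow> l \<in> polar \<alpha> \<Longrightarrow> l v = l w"
  shows "v = w"
proof -
  have "p \<alpha> (v - w) = 0" if a: "\<alpha> \<in> A" for \<alpha>
  proof -
    obtain l where l: "l \<in> polar \<alpha>" "norm (l (v - w)) = p \<alpha> (v - w)"
      by (rule hahn_banach[OF a diff_mem[OF assms(2,3)]])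
    then show ?thesis using polar_diff[OF l(1) assms(2,3)] assms(4)[OF a l(1)] by simp
  qed
  then have "v - w = 0" using assms(1) diff_mem[OF assms(2,3)] unfolding lcHs_iff by blast
  then show ?thesis by simp
qed

end

text \<open>Tensors are defined with initial segments of the natural numbers as index sets, whereas
  sums over centres of bumps or over disjoint unions use other finite sets.\<close>

lemma tensor_operators_sum:
  assumes "finite I" "\<And>i. i \<in> I \<Longrightarrow> f i \<in> vsp F" "\<And>i. i \<in> I \<Longrightarrow> e i \<in> vsp E"
  shows "(\<lambda>y. if y \<in> dual F then \<Sum>i\<in>I. scl E (y (f i)) (e i) else 0) \<in> tensor_operators F E"
proof -
  obtain N :: nat and b where b: "bij_betw b {..<N} I" using finite_enumeration[OF assms(1)] .
  have eq: "(\<Sum>i\<in>I. scl E (y (f i)) (e i)) = (\<Sum>n<N. scl E (y (f (b n))) (e (b n)))" for y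
    using sum.reindex_bij_betw[OF b, of "\<lambda>i. scl E (y (f i)) (e i)"] by simp
  have "b n \<in> I" if "n < N" for n using b that by (auto simp: bij_betw_def)
  then show ?thesis unfolding tensor_operators_def eq using assms
    by (intro CollectI exI[of _ N] exI[of _ "\<lambda>n. f (b n)"] exI[of _ "\<lambda>n. e (b n)"]) simp
qed

section \<open>Operators on the dual and their values at point functionals\<close>

context eps_setting
begin

lemma eps_add: "u \<in> cont_lin DK E \<Longrightarrow> y \<in> dual FF \<Longrightarrow> y' \<in> dual FF \<Longrightarrow> u (y + y') = u y + u y'"
  and eps_scl: "u \<in> cont_lin DK E \<Longrightarrow> y \<in> dual FF \<Longrightarrow> u (\<lambda>f. c * y f) = scl E c (u y)"
  and eps_outside: "u \<in> cont_lin DK E \<Longrightarrow> y \<notin> dual FF \<Longrightarrow> u y = 0"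
  by (auto simp: cont_lin_def linear_on_def)

lemma dual_mems: "y \<in> dual FF \<Longrightarrow> y' \<in> dual FF \<Longrightarrow> y + y' \<in> dual FF"
  "y \<in> dual FF \<Longrightarrow> y' \<in> dual FF \<Longrightarrow> y - y' \<in> dual FF"
  "y \<in> dual FF \<Longrightarrow> (\<lambda>f. c * y f) \<in> dual FF" "0 \<in> dual FF"
  using F.E.cont_lin_scl[of y FF c] unfolding dual_def
  by (simp_all add: F.E.cont_lin_add F.E.cont_lin_diff F.E.cont_lin_zero)

lemma eps_diff:
  "u \<in> cont_lin DK E \<Longrightarrow> y \<in> dual FF \<Longrightarrow> y' \<in> dual FF \<Longrightarrow> u (y - y') = u y - u y'"
  using eps_add[of u "y - y'" y'] dual_mems(2)[of y y'] by simp

lemma eps_zero: "u \<in> cont_lin DK E \<Longrightarrow> u 0 = 0"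
  using eps_diff[of u 0 0] dual_mems(4) by simp

lemma dual_combination: "(\<And>z. z \<in> Z \<Longrightarrow> y z \<in> dual FF) \<Longrightarrow> (\<Sum>z\<in>Z. (\<lambda>f. c z * y z f)) \<in> dual FF"
  by (induction Z rule: infinite_finite_induct) (auto intro: dual_mems)

lemma eps_combination:
  assumes "u \<in> cont_lin DK E" "\<And>z. z \<in> Z \<Longrightarrow> y z \<in> dual FF"
  shows "u (\<Sum>z\<in>Z. (\<lambda>f. c z * y z f)) = (\<Sum>z\<in>Z. scl E (c z) (u (y z)))"
  using assms(2)
proof (induction Z rule: infinite_finite_induct)
  case (insert x Z)
  have 1: "u ((\<lambda>f. c x * y x f) + (\<Sum>z\<in>Z. (\<lambda>f. c z * y z f))) = u (\<lambda>f. c x * y x f) + u (\<Sum>z\<in>Z. (\<lambda>f. c z * y z f))"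
    using insert.prems by (intro eps_add assms(1) dual_mems dual_combination) auto
  have 2: "u (\<lambda>f. c x * y x f) = scl E (c x) (u (y x))" by (intro eps_scl assms(1) insert.prems) simp
  have 3: "u (\<Sum>z\<in>Z. (\<lambda>f. c z * y z f)) = (\<Sum>z\<in>Z. scl E (c z) (u (y z)))" using insert by simp
  show ?case by (simp only: sum.insert[OF insert.hyps(1,2)] 1 2 3)
qed (simp_all add: eps_zero[OF assms(1)])

text \<open>Converse of \<open>kappa_bound\<close>. Here the sets have to be absolutely convex,
  because neighbourhoods in \<open>dual_kappa\<close> must be produced and not merely
  exploited.\<close>

lemma kappa_cont_linI:
  assumes lin: "linear_on DK E u" and out: "\<And>y. y \<notin> dual FF \<Longrightarrow> u y = 0"
    and mem: "\<And>y. y \<in> dual FF \<Longrightarrow> u y \<in> vsp E"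
    and bnd: "\<And>\<alpha>. \<alpha> \<in> A \<Longrightarrow> \<exists>\<T> C. finite \<T> \<and> \<T> \<subseteq> abs_convex_compacts FF \<and> C > 0 \<and>
      (\<forall>y\<in>dual FF. \<forall>t>0. (\<forall>f\<in>\<Union>\<T>. norm (y f) \<le> t) \<longrightarrow> p \<alpha> (u y) \<le> C * t)"
  shows "u \<in> cont_lin DK E"
proof -
  have sub: "u (y - y') = u y - u y'" if "y \<in> dual FF" "y' \<in> dual FF" for y y'
  proof -
    have "u ((y - y') + y') = u (y - y') + u y'" using lin that dual_mems(2)[OF that] unfolding linear_on_def vsp_dual_kappa by blast
    then show ?thesis by simp
  qed
  have "continuous_map (vtop DK) (vtop E) u"
    unfolding E.continuous_map_into_iff
  proof (intro conjI ballI allI impI)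
    have top: "topspace (vtop DK) = dual FF" using vsp_dual_kappa[of FF] by (simp add: vsp_def)
    show "u \<in> topspace (vtop DK) \<rightarrow> vsp E" using mem by (simp add: top)
    fix y0 \<alpha> and \<epsilon> :: real assume "y0 \<in> topspace (vtop DK)" and \<alpha>: "\<alpha> \<in> A" and e: "\<epsilon> > 0"
    then have y0: "y0 \<in> dual FF" by (simp add: top)
    obtain \<T> C where t: "finite \<T>" "\<T> \<subseteq> abs_convex_compacts FF" "C > 0"
      "\<forall>y\<in>dual FF. \<forall>t>0. (\<forall>f\<in>\<Union>\<T>. norm (y f) \<le> t) \<longrightarrow> p \<alpha> (u y) \<le> C * t"
      using bnd[OF \<alpha>] by blast
    define U where "U = {y \<in> dual FF. p \<alpha> (u y - u y0) < \<epsilon>}"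
    \<comment> \<open>Basic neighbourhoods of zero need not be open, so openness of U is verified at
      each of its points y1, with the slack \<rho> that remains there.\<close>
    have "openin (vtop DK) U" unfolding dual_kappa_def cont_lin_tvs_def tvs.simps openin_zero_nbhd_topology
    proof (intro conjI ballI)
      show "U \<subseteq> cont_lin FF scalars" by (auto simp: U_def dual_def)
      fix y1 assume y1: "y1 \<in> U"
      define \<rho> where "\<rho> = \<epsilon> - p \<alpha> (u y1 - u y0)"
      define s where "s = \<rho> / (2 * C)"
      have \<rho>: "\<rho> > 0" using y1 by (simp add: U_def \<rho>_def)
      have s: "s > 0" "C * s < \<rho>" using \<rho> t(3) by (auto simp: s_def)
      let ?N = "\<lambda>M. {y \<in> cont_lin FF scalars. \<forall>f\<in>M. y f \<in> ball 0 s}"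
      have "y \<in> U" if y: "y \<in> cont_lin FF scalars" "y - y1 \<in> \<Inter>(?N ` \<T>)" for y
      proof -
        have d: "y \<in> dual FF" "y1 \<in> dual FF" using y y1 by (auto simp: U_def dual_def)
        have "\<forall>f\<in>\<Union>\<T>. norm ((y - y1) f) \<le> s"
        proof
          fix f assume "f \<in> \<Union>\<T>"
          then obtain M where "M \<in> \<T>" "f \<in> M" by blast
          then have "(y - y1) f \<in> ball 0 s" using y(2) by blast
          then show "norm ((y - y1) f) \<le> s" by simp
        qed
        then have "p \<alpha> (u (y - y1)) \<le> C * s" using t(4) dual_mems(2)[OF d] s(1) by blast
        then have "p \<alpha> (u y - u y1) < \<rho>" using s(2) sub[OF d] by simp
        moreover have "p \<alpha> (u y - u y0) \<le> p \<alpha> (u y - u y1) + p \<alpha> (u y1 - u y0)"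
          using d y0 mem by (intro E.p_triangle \<alpha>) auto
        ultimately show ?thesis using d by (simp add: U_def \<rho>_def)
      qed
      moreover have "?N ` \<T> \<subseteq> {{u \<in> cont_lin FF scalars. \<forall>v\<in>M. u v \<in> V} | M V.
          M \<in> abs_convex_compacts FF \<and> openin (vtop scalars) V \<and> 0 \<in> V}"
      proof (rule image_subsetI)
        fix M assume "M \<in> \<T>"
        then have "M \<in> abs_convex_compacts FF" using t(2) by blast
        moreover have "openin (vtop scalars) (ball (0 :: 'k) s)" "0 \<in> ball (0 :: 'k) s" using s by simp_all
        ultimately show "?N M \<in> {{u \<in> cont_lin FF scalars. \<forall>v\<in>M. u v \<in> V} | M V.
          M \<in> abs_convex_compacts FF \<and> openin (vtop scalars) V \<and> 0 \<in> V}"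
          by (intro CollectI exI[of _ M] exI[of _ "ball (0 :: 'k) s"] conjI refl)
      qed
      ultimately show "\<exists>\<F>. finite \<F> \<and> \<F> \<subseteq> {{u \<in> cont_lin FF scalars. \<forall>v\<in>M. u v \<in> V} | M V.
          M \<in> abs_convex_compacts FF \<and> openin (vtop scalars) V \<and> 0 \<in> V} \<and>
          (\<forall>y\<in>cont_lin FF scalars. y - y1 \<in> \<Inter>\<F> \<longrightarrow> y \<in> U)"
        using t(1) by (intro exI[of _ "?N ` \<T>"] conjI finite_imageI ballI impI)
    qed
    then show "\<exists>U. openin (vtop DK) U \<and> y0 \<in> U \<and> (\<forall>y\<in>U. p \<alpha> (u y - u y0) < \<epsilon>)"
      using y0 e by (intro exI[of _ U]) (auto simp: U_def E.p_zero[OF \<alpha>])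
  qed
  then show ?thesis using lin out by (simp add: cont_lin_def)
qed

lemma tensor_cont_lin:
  assumes I: "finite I" and f: "\<And>i. i \<in> I \<Longrightarrow> f i \<in> vsp FF" and e: "\<And>i. i \<in> I \<Longrightarrow> e i \<in> vsp E"
  shows "(\<lambda>y. if y \<in> dual FF then \<Sum>i\<in>I. scl E (y (f i)) (e i) else 0) \<in> cont_lin DK E" (is "?u \<in> _")
proof (rule kappa_cont_linI)
  show "linear_on DK E ?u"
    by (simp add: linear_on_def dual_mems E.V.scale_left_distrib sum.distrib E.V.scale_sum_right)
  show "?u y \<in> vsp E" if "y \<in> dual FF" for y using that e by (auto intro!: E.sum_mem E.scl_mem)
  fix \<alpha> assume \<alpha>: "\<alpha> \<in> A"
  let ?M = "\<lambda>i. (\<lambda>c. scl FF c (f i)) ` cball 0 1"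
  define C where "C = 1 + (\<Sum>i\<in>I. p \<alpha> (e i))"
  have nn: "(\<Sum>i\<in>I. p \<alpha> (e i)) \<ge> 0" using e by (intro sum_nonneg E.p_nonneg \<alpha>)
  have "p \<alpha> (?u y) \<le> C * t" if y: "y \<in> dual FF" and t: "t > 0" "\<forall>h\<in>\<Union>(?M ` I). norm (y h) \<le> t" for y t
  proof -
    have le: "norm (y (f i)) \<le> t" if "i \<in> I" for i
    proof -
      have "scl FF 1 (f i) \<in> ?M i" by (rule imageI) simp
      then have "norm (y (scl FF 1 (f i))) \<le> t" using t(2) that by blast
      then show ?thesis by simp
    qed
    have "p \<alpha> (?u y) \<le> (\<Sum>i\<in>I. p \<alpha> (scl E (y (f i)) (e i)))"
      using y e by (auto intro!: E.p_sum E.scl_mem \<alpha>)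
    also have "\<dots> \<le> (\<Sum>i\<in>I. t * p \<alpha> (e i))"
      using le e by (intro sum_mono) (simp add: E.p_scl[OF \<alpha>] mult_right_mono E.p_nonneg[OF \<alpha>])
    also have "\<dots> \<le> C * t" using t by (simp add: C_def sum_distrib_left[symmetric] distrib_right mult.commute)
    finally show ?thesis .
  qed
  moreover have "?M ` I \<subseteq> abs_convex_compacts FF" using f F.W.line_abs_convex_compact by blast
  moreover have "C > 0" using nn by (simp add: C_def)
  ultimately show "\<exists>\<T> C. finite \<T> \<and> \<T> \<subseteq> abs_convex_compacts FF \<and> C > 0 \<and>
      (\<forall>y\<in>dual FF. \<forall>t>0. (\<forall>f\<in>\<Union>\<T>. norm (y f) \<le> t) \<longrightarrow> p \<alpha> (?u y) \<le> C * t)"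
    using I by (intro exI[of _ "?M ` I"] exI[of _ C] conjI finite_imageI ballI allI impI)
qed simp

definition eval_delta :: "((('x \<Rightarrow> 'k) \<Rightarrow> 'k) \<Rightarrow> 'v) \<Rightarrow> 'x \<Rightarrow> 'v" where
  "eval_delta u x = u (delta x)"

text \<open>By \<open>kappa_bound\<close>, u is controlled on one compact M. Equicontinuity of M
  makes delta x - delta z small on M for x near z; uniform vanishing of M makes \<nu> j x times
  delta x small on M for x off a compact set.\<close>

lemma eval_delta_mem:
  assumes u: "u \<in> cont_lin DK E"
  shows "eval_delta u \<in> vsp W"
  unfolding vsp_W_iff E.continuous_map_into_iff
proof (intro conjI ballI allI impI)
  show "eval_delta u \<in> topspace euclidean \<rightarrow> vsp E" using E.cont_lin_range[OF u] by (simp add: eval_delta_def)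
  fix z \<alpha> and \<epsilon> :: real assume \<alpha>: "\<alpha> \<in> A" and e: "\<epsilon> > 0"
  obtain M C where M: "compactin (vtop FF) M" "C > 0"
    "\<forall>y\<in>dual FF. \<forall>t>0. (\<forall>f\<in>M. norm (y f) \<le> t) \<longrightarrow> p \<alpha> (u y) \<le> C * t"
    using kappa_bound[OF u \<alpha>] by blast
  have MF: "M \<subseteq> vsp FF" using M(1) by (simp add: compactin_def vsp_def)
  define t where "t = \<epsilon> / (2 * C)"
  have t: "t > 0" "C * t < \<epsilon>" using e M(2) by (auto simp: t_def)
  obtain U where U: "open U" "z \<in> U" "\<forall>f\<in>M. \<forall>x\<in>U. norm (f x - f z) \<le> t"
    using F.compact_equicontinuous[OF M(1) singletonI t(1), of z] by blast
  have "p \<alpha> (eval_delta u x - eval_delta u z) < \<epsilon>" if x: "x \<in> U" for x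
  proof -
    have "\<forall>f\<in>M. norm ((delta x - delta z) f) \<le> t" using U(3) x MF by auto
    then have "p \<alpha> (u (delta x - delta z)) \<le> C * t"
      using M(3) t(1) dual_mems(2)[OF delta_dual delta_dual] by blast
    then show ?thesis using t(2) eps_diff[OF u delta_dual delta_dual] by (simp add: eval_delta_def)
  qed
  then show "\<exists>U. openin euclidean U \<and> z \<in> U \<and> (\<forall>s\<in>U. p \<alpha> (eval_delta u s - eval_delta u z) < \<epsilon>)"
    using U by auto
next
  fix j \<alpha> and \<epsilon> :: real assume j: "j \<in> J" and \<alpha>: "\<alpha> \<in> A" and e: "\<epsilon> > 0"
  obtain M C where M: "compactin (vtop FF) M" "C > 0"
    "\<forall>y\<in>dual FF. \<forall>t>0. (\<forall>f\<in>M. norm (y f) \<le> t) \<longrightarrow> p \<alpha> (u y) \<le> C * t"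
    using kappa_bound[OF u \<alpha>] by blast
  have MF: "M \<subseteq> vsp FF" using M(1) by (simp add: compactin_def vsp_def)
  have t: "\<epsilon> / C > 0" using e M(2) by simp
  obtain K where K: "compact K" "\<forall>f\<in>M. \<forall>x. x \<notin> K \<longrightarrow> norm (f x) * \<nu> j x \<le> \<epsilon> / C"
    using F.compact_uniformly_vanishing[OF M(1) j singletonI t] by blast
  have "p \<alpha> (eval_delta u x) * \<nu> j x \<le> \<epsilon>" if x: "x \<notin> K" for x
  proof -
    have "norm (of_real (\<nu> j x) * delta x f) \<le> \<epsilon> / C" if "f \<in> M" for f
      using K(2) x MF that nu_nonneg[OF j] by (auto simp: norm_mult mult.commute)
    then have "p \<alpha> (u (\<lambda>f. of_real (\<nu> j x) * delta x f)) \<le> C * (\<epsilon> / C)"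
      by (intro M(3)[rule_format] dual_mems(3) delta_dual t)
    then show ?thesis using M(2) nu_nonneg[OF j]
      by (simp add: eps_scl[OF u delta_dual] E.p_scl[OF \<alpha> E.cont_lin_range[OF u]] eval_delta_def mult.commute)
  qed
  then show "\<exists>K. compact K \<and> (\<forall>x. x \<notin> K \<longrightarrow> p \<alpha> (eval_delta u x) * \<nu> j x \<le> \<epsilon>)"
    using K(1) by blast
qed

text \<open>One partition of unity has to serve two compact sets: the set M behind the continuity of
  u and the set M' of test functions. Hence the approximation is taken on their union, with t below
  both tolerances.\<close>

lemma eps_approx:
  assumes u: "u \<in> cont_lin DK E" and H: "H \<in> equicontinuous_sets FF" and M': "compactin (vtop FF) M'"
    and \<alpha>: "\<alpha> \<in> A" and \<epsilon>: "\<epsilon> > 0"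
  shows "\<exists>Z \<phi> L. bump_family Z \<phi> L \<and>
    (\<forall>y\<in>H. p \<alpha> (u y - (\<Sum>z\<in>Z. scl E (y (bump \<phi> z)) (u (delta z)))) \<le> \<epsilon>) \<and>
    (\<forall>y\<in>H. \<forall>h\<in>M'. norm (y h - (\<Sum>z\<in>Z. y (bump \<phi> z) * h z)) \<le> \<epsilon>)"
proof -
  obtain M C where M: "compactin (vtop FF) M" "C > 0"
    "\<forall>y\<in>dual FF. \<forall>t>0. (\<forall>f\<in>M. norm (y f) \<le> t) \<longrightarrow> p \<alpha> (u y) \<le> C * t"
    using kappa_bound[OF u \<alpha>] by blast
  have MF: "M \<subseteq> vsp FF" using M(1) by (simp add: compactin_def vsp_def)
  define t where "t = min \<epsilon> (\<epsilon> / C)"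
  have t: "t > 0" "t \<le> \<epsilon>" "C * t \<le> \<epsilon>" using \<epsilon> M(2) by (auto simp: t_def min_def field_simps)
  obtain Z \<phi> L where Z: "bump_family Z \<phi> L"
    "\<forall>y\<in>H. \<forall>h\<in>M \<union> M'. norm (y h - (\<Sum>z\<in>Z. y (bump \<phi> z) * h z)) \<le> t"
    using dual_approx[OF compactin_Un[OF M(1) M'] H t(1)] by blast
  have "p \<alpha> (u y - (\<Sum>z\<in>Z. scl E (y (bump \<phi> z)) (u (delta z)))) \<le> \<epsilon>" if y: "y \<in> H" for y
  proof -
    have yd: "y \<in> dual FF" using y H by (auto simp: equicontinuous_sets_def)
    define y' where "y' = (\<Sum>z\<in>Z. (\<lambda>f. y (bump \<phi> z) * delta z f))"
    have y': "y' \<in> dual FF" unfolding y'_def by (intro dual_combination delta_dual)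
    have "\<forall>f\<in>M. norm ((y - y') f) \<le> t"
      using Z(2) y MF by (auto simp: y'_def sum_fun_apply subset_iff)
    then have "p \<alpha> (u (y - y')) \<le> C * t" using M(3) t(1) dual_mems(2)[OF yd y'] by blast
    moreover have "u y' = (\<Sum>z\<in>Z. scl E (y (bump \<phi> z)) (u (delta z)))"
      unfolding y'_def by (intro eps_combination u delta_dual)
    ultimately show ?thesis using t(3) eps_diff[OF u yd y'] by simp
  qed
  moreover have "norm (y h - (\<Sum>z\<in>Z. y (bump \<phi> z) * h z)) \<le> \<epsilon>" if "y \<in> H" "h \<in> M'" for y h
    using Z(2) that t(2) by (meson UnI2 order_trans)
  ultimately show ?thesis using Z(1) by blast
qed

lemma polar_comp:
  assumes f: "f \<in> vsp W" and \<alpha>: "\<alpha> \<in> A" and l: "l \<in> E.polar \<alpha>"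
  shows "(\<lambda>x. l (f x)) \<in> vsp FF"
  unfolding F.vsp_W_iff F.E.continuous_map_into_iff
proof (intro conjI ballI allI impI)
  fix x i and \<epsilon> :: real assume e: "\<epsilon> > 0"
  obtain U where U: "openin euclidean U" "x \<in> U" "\<forall>s\<in>U. p \<alpha> (f s - f x) < \<epsilon>"
    using W_continuous[OF f, unfolded E.continuous_map_into_iff, THEN conjunct2, rule_format, OF _ \<alpha> e, of x]
    by auto
  have "norm (l (f s) - l (f x)) < \<epsilon>" if "s \<in> U" for s
  proof -
    have "norm (l (f s) - l (f x)) = norm (l (f s - f x))" by (simp add: E.polar_diff[OF l] W_range[OF f])
    also have "\<dots> \<le> p \<alpha> (f s - f x)" by (intro E.polar_le[OF l] E.diff_mem W_range[OF f])
    finally show ?thesis using U(3) that by fastforce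
  qed
  then show "\<exists>U. openin euclidean U \<and> x \<in> U \<and> (\<forall>s\<in>U. norm (l (f s) - l (f x)) < \<epsilon>)" using U by blast
next
  fix j i and \<epsilon> :: real assume j: "j \<in> J" and e: "\<epsilon> > 0"
  obtain K where K: "compact K" "\<forall>x. x \<notin> K \<longrightarrow> p \<alpha> (f x) * \<nu> j x \<le> \<epsilon>"
    using f[unfolded vsp_W_iff, THEN conjunct2, rule_format, OF j \<alpha> e] by blast
  have "norm (l (f x)) * \<nu> j x \<le> \<epsilon>" if "x \<notin> K" for x
    using mult_right_mono[OF E.polar_le[OF l W_range[OF f, of x]] nu_nonneg[OF j, of x]] K(2) that by fastforce
  then show "\<exists>K. compact K \<and> (\<forall>x. x \<notin> K \<longrightarrow> norm (l (f x)) * \<nu> j x \<le> \<epsilon>)" using K(1) by blast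
qed simp

lemma polar_comp_le:
  assumes f: "f \<in> vsp W" and \<alpha>: "\<alpha> \<in> A" and l: "l \<in> E.polar \<alpha>" and j: "j \<in> J"
  shows "F.nrm (j, ()) (\<lambda>x. l (f x)) \<le> nrm (j, \<alpha>) f"
proof (rule F.nrm_least)
  fix x
  have "norm (l (f x)) * \<nu> j x \<le> p \<alpha> (f x) * \<nu> j x"
    by (intro mult_right_mono E.polar_le[OF l] W_range[OF f] nu_nonneg[OF j])
  then show "norm (l (f x)) * \<nu> j x \<le> nrm (j, \<alpha>) f" using nrm_upper[OF f j \<alpha>, of x] by linarith
qed (use W.p_nonneg[of "(j, \<alpha>)" f] f j \<alpha> in auto)

text \<open>The functional l \<circ> u on the dual is evaluation at one concrete function. For
  combinations of point functionals this is linearity; \<open>eps_approx\<close> controls both sides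
  when y is replaced by such a combination.\<close>

lemma eps_identity:
  assumes u: "u \<in> cont_lin DK E" and \<alpha>: "\<alpha> \<in> A" and l: "l \<in> E.polar \<alpha>" and y: "y \<in> dual FF"
  shows "l (u y) = y (\<lambda>x. l (eval_delta u x))"
proof -
  let ?h = "\<lambda>x. l (eval_delta u x)"
  have h: "?h \<in> vsp FF" by (intro polar_comp[OF _ \<alpha> l] eval_delta_mem u)
  have "norm (l (u y) - y ?h) \<le> \<epsilon>" if e: "\<epsilon> > 0" for \<epsilon>
  proof -
    have e2: "\<epsilon> / 2 > 0" using e by simp
    have c: "compactin (vtop FF) {?h}" using h by (simp add: vsp_def)
    obtain Z \<phi> L where Z: "bump_family Z \<phi> L"
      "\<forall>y\<in>{y}. p \<alpha> (u y - (\<Sum>z\<in>Z. scl E (y (bump \<phi> z)) (u (delta z)))) \<le> \<epsilon> / 2"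
      "\<forall>y\<in>{y}. \<forall>h\<in>{?h}. norm (y h - (\<Sum>z\<in>Z. y (bump \<phi> z) * h z)) \<le> \<epsilon> / 2"
      using eps_approx[OF u F.W.singleton_equicontinuous[OF y] c \<alpha> e2] by blast
    let ?s = "\<Sum>z\<in>Z. scl E (y (bump \<phi> z)) (u (delta z))"
    have m: "u y \<in> vsp E" "u (delta z) \<in> vsp E" "?s \<in> vsp E" for z
      using E.cont_lin_range[OF u] by (auto intro!: E.sum_mem E.scl_mem)
    have "l ?s = (\<Sum>z\<in>Z. y (bump \<phi> z) * ?h z)"
      by (simp add: E.polar_sum[OF l] E.scl_mem m E.polar_scl[OF l] eval_delta_def)
    then have "norm (y ?h - l ?s) \<le> \<epsilon> / 2" using Z(3) by simp
    moreover have "norm (l (u y) - l ?s) \<le> \<epsilon> / 2"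
    proof -
      have "norm (l (u y) - l ?s) = norm (l (u y - ?s))" using E.polar_diff[OF l m(1,3)] by simp
      also have "\<dots> \<le> p \<alpha> (u y - ?s)" by (intro E.polar_le[OF l] E.diff_mem m)
      finally show ?thesis using Z(2) by simp
    qed
    ultimately show ?thesis using norm_triangle_ineq4[of "l (u y) - l ?s" "y ?h - l ?s"] by simp
  qed
  then have "norm (l (u y) - y ?h) \<le> 0" by (rule field_le_epsilon[of _ 0, simplified])
  then show ?thesis by simp
qed

text \<open>Hahn-Banach provides l norming u y, and \<open>eps_identity\<close> moves the estimate
  to l \<circ> eval_delta u. This bound gives continuity of the inverse of
  \<open>eval_delta\<close>.\<close>

lemma eps_bound:
  assumes u: "u \<in> cont_lin DK E" and y: "y \<in> dual FF" and j: "j \<in> J" and \<alpha>: "\<alpha> \<in> A"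
    and c: "c > 0" "\<And>h. h \<in> vsp FF \<Longrightarrow> norm (y h) \<le> c * F.nrm (j, ()) h"
  shows "p \<alpha> (u y) \<le> c * nrm (j, \<alpha>) (eval_delta u)"
proof -
  obtain l where l: "l \<in> E.polar \<alpha>" "norm (l (u y)) = p \<alpha> (u y)"
    using E.hahn_banach[OF \<alpha> E.cont_lin_range[OF u]] by blast
  have "p \<alpha> (u y) = norm (y (\<lambda>x. l (eval_delta u x)))" using l eps_identity[OF u \<alpha> l(1) y] by simp
  also have "\<dots> \<le> c * F.nrm (j, ()) (\<lambda>x. l (eval_delta u x))"
    by (intro c polar_comp[OF _ \<alpha> l(1)] eval_delta_mem u)
  also have "\<dots> \<le> c * nrm (j, \<alpha>) (eval_delta u)"
    using c(1) by (intro mult_left_mono polar_comp_le[OF _ \<alpha> l(1) j] eval_delta_mem u) auto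
  finally show ?thesis .
qed

text \<open>Compactness is transported from the pointwise topology on the polar. Off a compact K the
  bound by p \<alpha> makes all l \<circ> f uniformly small; on K a finite net of the image of K
  suffices, since all l obey the same seminorm bound.\<close>

lemma polar_image_compact:
  assumes f: "f \<in> vsp W" and \<alpha>: "\<alpha> \<in> A"
  shows "(\<lambda>l x. l (f x)) ` E.polar \<alpha> \<in> abs_convex_compacts FF"
  unfolding abs_convex_compacts_def abs_convex_def
proof (intro CollectI conjI ballI allI impI)
  let ?g = "\<lambda>l x. l (f x) :: 'k"
  show "?g ` E.polar \<alpha> \<subseteq> vsp FF" using polar_comp[OF f \<alpha>] by blast
  have "continuous_map (top_of_set (E.polar \<alpha>)) (vtop FF) ?g"
    unfolding F.W.continuous_map_into_iff
  proof (intro conjI ballI allI impI)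
    show "?g \<in> topspace (top_of_set (E.polar \<alpha>)) \<rightarrow> vsp FF" using polar_comp[OF f \<alpha>] by auto
    fix l0 i and \<epsilon> :: real assume "l0 \<in> topspace (top_of_set (E.polar \<alpha>))" "i \<in> J \<times> {()}" and e: "\<epsilon> > 0"
    then obtain j where l0: "l0 \<in> E.polar \<alpha>" and j: "i = (j, ())" "j \<in> J" by auto
    have e8: "\<epsilon> / 4 > 0" using e by simp
    obtain K where K: "compact K" "\<forall>x. x \<notin> K \<longrightarrow> p \<alpha> (f x) * \<nu> j x \<le> \<epsilon> / 4"
      using f[unfolded vsp_W_iff, THEN conjunct2, rule_format, OF j(2) \<alpha> e8] by blast
    obtain C where C: "C > 0" "\<And>x. x \<in> K \<Longrightarrow> \<nu> j x \<le> C" using nu_bounded[OF K(1) j(2)] by blast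
    \<comment> \<open>Three errors of size \<delta>, two for passing to the net and one at a net
      point, cost \<epsilon> / 2 on K after weighting by C. Off K two terms of \<epsilon> / 4 give
      the same.\<close>
    define \<delta> where "\<delta> = \<epsilon> / (6 * C)"
    have \<delta>: "\<delta> > 0" "3 * \<delta> * C = \<epsilon> / 2" using e C by (auto simp: \<delta>_def)
    have "compactin (vtop E) (f ` K)" using K(1) W_continuous[OF f] by (intro image_compactin[of euclidean]) auto
    then obtain N where N: "finite N" "N \<subseteq> f ` K" "\<And>v. v \<in> f ` K \<Longrightarrow> \<exists>n\<in>N. p \<alpha> (v - n) < \<delta>"
      using E.compact_finite_net[OF _ \<alpha> \<delta>(1)] by blast
    have NE: "N \<subseteq> vsp E" using N(2) W_range[OF f] by blast
    define U where "U = E.polar \<alpha> \<inter> (\<Inter>n\<in>N. {l. dist (l n) (l0 n) < \<delta>})"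
    have "open (\<Inter>n\<in>N. {l :: 'v \<Rightarrow> 'k. dist (l n) (l0 n) < \<delta>})"
      using N(1) by (intro open_INT ballI open_Collect_less continuous_intros continuous_on_product_coordinates)
    then have "openin (top_of_set (E.polar \<alpha>)) U" unfolding U_def by (rule openin_open_Int)
    moreover have "l0 \<in> U" using l0 \<delta> by (simp add: U_def)
    moreover have "F.nrm i (?g l - ?g l0) < \<epsilon>" if l: "l \<in> U" for l
    proof -
      have lp: "l \<in> E.polar \<alpha>" using l by (simp add: U_def)
      have "F.nrm i (?g l - ?g l0) \<le> \<epsilon> / 2" unfolding j(1)
      proof (rule F.nrm_least)
        fix x
        show "norm ((?g l - ?g l0) x) * \<nu> j x \<le> \<epsilon> / 2"
        proof (cases "x \<in> K")
          case True
          then obtain n where n: "n \<in> N" "p \<alpha> (f x - n) < \<delta>" using N(3) by blast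
          have nE: "n \<in> vsp E" using n NE by blast
          have a: "norm (k (f x) - k n) \<le> \<delta>" if "k \<in> E.polar \<alpha>" for k
          proof -
            have "norm (k (f x) - k n) = norm (k (f x - n))" by (simp add: E.polar_diff[OF that] W_range[OF f] nE)
            also have "\<dots> \<le> p \<alpha> (f x - n)" by (intro E.polar_le[OF that] E.diff_mem W_range[OF f] nE)
            finally show ?thesis using n by simp
          qed
          have "norm (l n - l0 n) < \<delta>" using l n(1) by (simp add: U_def dist_norm)
          moreover have "norm (l (f x) - l0 (f x)) \<le> norm (l (f x) - l n) + norm (l n - l0 n) + norm (l0 (f x) - l0 n)"
            using norm_triangle_ineq4[of "(l (f x) - l n) + (l n - l0 n)" "l0 (f x) - l0 n"]
              norm_triangle_ineq[of "l (f x) - l n" "l n - l0 n"] by simp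
          ultimately have "norm (l (f x) - l0 (f x)) \<le> 3 * \<delta>" using a[OF lp] a[OF l0] by linarith
          then have "norm (l (f x) - l0 (f x)) * \<nu> j x \<le> (3 * \<delta>) * C"
            using C(2)[OF True] nu_nonneg[OF j(2)] \<delta>(1) by (intro mult_mono) auto
          then show ?thesis using \<delta>(2) by simp
        next
          case False
          have "norm (l (f x) - l0 (f x)) \<le> norm (l (f x)) + norm (l0 (f x))" by (rule norm_triangle_ineq4)
          also have "\<dots> \<le> p \<alpha> (f x) + p \<alpha> (f x)"
            by (intro add_mono E.polar_le[OF lp] E.polar_le[OF l0] W_range[OF f])
          finally have "norm (l (f x) - l0 (f x)) * \<nu> j x \<le> (p \<alpha> (f x) + p \<alpha> (f x)) * \<nu> j x"
            using nu_nonneg[OF j(2)] by (rule mult_right_mono)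
          moreover have "p \<alpha> (f x) * \<nu> j x \<le> \<epsilon> / 4" using K(2) False by blast
          ultimately show ?thesis by (simp add: distrib_right)
        qed
      qed (use e in simp)
      then show ?thesis using e by simp
    qed
    ultimately show "\<exists>U. openin (top_of_set (E.polar \<alpha>)) U \<and> l0 \<in> U \<and> (\<forall>s\<in>U. F.nrm i (?g s - ?g l0) < \<epsilon>)"
      by blast
  qed
  then show "compactin (vtop FF) (?g ` E.polar \<alpha>)"
    by (rule image_compactin[rotated]) (simp add: compactin_subtopology E.compact_polar)
next
  fix h k and a b :: 'k
  assume "h \<in> (\<lambda>l x. l (f x)) ` E.polar \<alpha>" "k \<in> (\<lambda>l x. l (f x)) ` E.polar \<alpha>" and ab: "norm a + norm b \<le> 1"
  then obtain l m where l: "l \<in> E.polar \<alpha>" "h = (\<lambda>x. l (f x))" and m: "m \<in> E.polar \<alpha>" "k = (\<lambda>x. m (f x))" by blast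
  have "norm (a * l v + b * m v) \<le> p \<alpha> v" if v: "v \<in> vsp E" for v
  proof -
    have "norm (a * l v + b * m v) \<le> norm a * norm (l v) + norm b * norm (m v)"
      by (metis norm_mult norm_triangle_ineq)
    also have "\<dots> \<le> norm a * p \<alpha> v + norm b * p \<alpha> v"
      using E.polar_le[OF l(1) v] E.polar_le[OF m(1) v] by (intro add_mono mult_left_mono) auto
    also have "\<dots> \<le> 1 * p \<alpha> v" unfolding distrib_right[symmetric]
      using ab E.p_nonneg[OF \<alpha> v] by (rule mult_right_mono)
    finally show ?thesis by simp
  qed
  then have "(\<lambda>v. a * l v + b * m v) \<in> E.polar \<alpha>"
    using l(1) m(1) by (simp add: E.polar_def linear_on_def algebra_simps)
  then show "scl FF a h + scl FF b k \<in> (\<lambda>l x. l (f x)) ` E.polar \<alpha>"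
    by (rule rev_image_eqI) (simp add: F.scl_W l(2) m(2) fun_eq_iff)
qed

end

section \<open>Finite unions of equicontinuous sets\<close>

context seminormed_space
begin

lemma equicontinuous_Un:
  assumes "H \<in> equicontinuous_sets X" "K \<in> equicontinuous_sets X"
  shows "H \<union> K \<in> equicontinuous_sets X"
proof -
  obtain \<alpha> C where 1: "\<alpha> \<in> A" "C > 0" "\<forall>y\<in>H. \<forall>v\<in>vsp X. norm (y v) \<le> C * p \<alpha> v"
    using equicontinuous_bound[OF assms(1)] by blast
  obtain \<beta> D where 2: "\<beta> \<in> A" "D > 0" "\<forall>y\<in>K. \<forall>v\<in>vsp X. norm (y v) \<le> D * p \<beta> v"
    using equicontinuous_bound[OF assms(2)] by blast
  obtain \<gamma> B where 3: "\<gamma> \<in> A" "B > 0" "\<forall>v\<in>vsp X. p \<alpha> v \<le> B * p \<gamma> v \<and> p \<beta> v \<le> B * p \<gamma> v"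
    using directed[OF 1(1) 2(1)] by blast
  show ?thesis
  proof (rule equicontinuousI[OF _ 3(1)])
    show "H \<union> K \<subseteq> dual X" using assms by (auto simp: equicontinuous_sets_def)
    show "(C + D) * B > 0" using 1 2 3 by simp
    fix y v assume y: "y \<in> H \<union> K" and v: "v \<in> vsp X"
    have nn: "0 \<le> p \<gamma> v" using 3 v by (simp add: p_nonneg)
    have "norm (y v) \<le> (C + D) * (B * p \<gamma> v)"
    proof (cases "y \<in> H")
      case True
      then have "norm (y v) \<le> C * p \<alpha> v" using 1 v by blast
      also have "\<dots> \<le> (C + D) * (B * p \<gamma> v)" using 1 2 3 v p_nonneg by (intro mult_mono) auto
      finally show ?thesis .
    next
      case False
      then have "norm (y v) \<le> D * p \<beta> v" using 2 v y by blast
      also have "\<dots> \<le> (C + D) * (B * p \<gamma> v)" using 1 2 3 v p_nonneg by (intro mult_mono) auto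
      finally show ?thesis .
    qed
    then show "norm (y v) \<le> (C + D) * B * p \<gamma> v" by (simp add: mult.assoc)
  qed
qed

lemma equicontinuous_Union:
  assumes "finite \<T>" "\<T> \<subseteq> equicontinuous_sets X"
  shows "\<Union>\<T> \<in> equicontinuous_sets X"
  using assms
proof (induction \<T>)
  case empty
  then show ?case by (auto simp: equicontinuous_sets_def vsp_def)
next
  case (insert H \<T>)
  then show ?case using equicontinuous_Un[of H "\<Union>\<T>"] by simp
qed

end

section \<open>The isomorphism with the \<open>\<epsilon>\<close>-product\<close>

context eps_setting
begin

lemma eval_delta_surj:
  assumes complete: "complete_tvs E" and f: "f \<in> vsp W"
  shows "\<exists>u\<in>cont_lin DK E. eval_delta u = f"
proof -
  have ex: "\<exists>e\<in>vsp E. \<forall>\<alpha>\<in>A. \<forall>l\<in>E.polar \<alpha>. l e = y (\<lambda>x. l (f x))" if y: "y \<in> dual FF" for y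
  proof -
    define I where "I = {i :: 'a \<times> real. fst i \<in> A \<and> snd i > 0}"
    \<comment> \<open>An index is a seminorm together with a tolerance. Uniformity over the whole
      polar is what makes G i small in that seminorm, by Hahn-Banach.\<close>
    define G where "G i = {e \<in> vsp E. \<forall>l\<in>E.polar (fst i). norm (l e - y (\<lambda>x. l (f x))) \<le> snd i}" for i
    have ne: "I \<noteq> {}"
    proof -
      obtain \<alpha> where "\<alpha> \<in> A" using E.index_nonempty by blast
      then have "(\<alpha>, 1) \<in> I" by (simp add: I_def)
      then show ?thesis by blast
    qed
    have G: "G i \<noteq> {} \<and> G i \<subseteq> vsp E" if i: "i \<in> I" for i
    proof -
      have a: "fst i \<in> A" "snd i > 0" using i by (auto simp: I_def)
      have M: "compactin (vtop FF) ((\<lambda>l x. l (f x)) ` E.polar (fst i))"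
        using polar_image_compact[OF f a(1)] by (simp add: abs_convex_compacts_def)
      obtain Z \<phi> L where Z: "bump_family Z \<phi> L"
        "\<forall>y'\<in>{y}. \<forall>h\<in>(\<lambda>l x. l (f x)) ` E.polar (fst i).
           norm (y' h - (\<Sum>z\<in>Z. y' (bump \<phi> z) * h z)) \<le> snd i"
        using dual_approx[OF M F.W.singleton_equicontinuous[OF y] a(2)] by blast
      \<comment> \<open>The transposed approximation applied to f: once y is replaced by the
        combination of point functionals with coefficients y (bump \<phi> z), the equation for e is
        solved exactly by this sum.\<close>
      let ?e = "\<Sum>z\<in>Z. scl E (y (bump \<phi> z)) (f z)"
      have "norm (l ?e - y (\<lambda>x. l (f x))) \<le> snd i" if l: "l \<in> E.polar (fst i)" for l
      proof -
        have "l ?e = (\<Sum>z\<in>Z. y (bump \<phi> z) * l (f z))"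
          by (simp add: E.polar_sum[OF l] E.scl_mem W_range[OF f] E.polar_scl[OF l])
        then show ?thesis using Z(2) l by (simp add: norm_minus_commute)
      qed
      then have "?e \<in> G i" using W_range[OF f] by (auto simp: G_def intro!: E.sum_mem E.scl_mem)
      then show ?thesis by (auto simp: G_def)
    qed
    have dir: "\<exists>m\<in>I. G m \<subseteq> G i \<inter> G k" if ik: "i \<in> I" "k \<in> I" for i k
    proof -
      have a: "fst i \<in> A" "fst k \<in> A" "snd i > 0" "snd k > 0" using ik by (auto simp: I_def)
      obtain \<gamma> C where g: "\<gamma> \<in> A" "C > 0" "\<forall>v\<in>vsp E. p (fst i) v \<le> C * p \<gamma> v \<and> p (fst k) v \<le> C * p \<gamma> v"
        using E.directed[OF a(1,2)] by blast
      \<comment> \<open>A member of either of the two polars enters the polar of \<gamma> after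
        division by C, and the tolerance has to be divided by C as well.\<close>
      define m where "m = (\<gamma>, min (snd i) (snd k) / C)"
      have mI: "m \<in> I" using a g by (simp add: m_def I_def)
      have le: "norm (l e - y (\<lambda>x. l (f x))) \<le> min (snd i) (snd k)"
        if e: "e \<in> G m" and l: "l \<in> E.polar \<beta>" "\<beta> \<in> A" "\<forall>v\<in>vsp E. p \<beta> v \<le> C * p \<gamma> v" for e l \<beta>
      proof -
        have lp: "(\<lambda>v. of_real (1 / C) * l v) \<in> E.polar (fst m)"
          using E.polar_subset_scale[OF l(1) g(2) l(3)] by (simp add: m_def)
        have all: "\<forall>l\<in>E.polar (fst m). norm (l e - y (\<lambda>x. l (f x))) \<le> snd m"
          using e by (simp add: G_def)
        have "norm (of_real (1 / C) * l e - y (\<lambda>x. of_real (1 / C) * l (f x))) \<le> snd m"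
          by (rule bspec[OF all lp])
        moreover have "y (\<lambda>x. of_real (1 / C) * l (f x)) = of_real (1 / C) * y (\<lambda>x. l (f x))"
          using F.W.dual_scl[OF y polar_comp[OF f l(2,1)], of "of_real (1 / C)"] by (simp add: F.scl_W)
        ultimately have "norm (of_real (1 / C) * (l e - y (\<lambda>x. l (f x)))) \<le> min (snd i) (snd k) / C"
          by (simp only: right_diff_distrib m_def snd_conv)
        then show ?thesis using g(2) by (simp add: norm_mult norm_divide divide_le_cancel)
      qed
      have "G m \<subseteq> G i \<inter> G k"
      proof
        fix e assume e: "e \<in> G m"
        have "norm (l e - y (\<lambda>x. l (f x))) \<le> snd i" if "l \<in> E.polar (fst i)" for l
          using le[OF e that a(1)] g(3) by simp
        moreover have "norm (l e - y (\<lambda>x. l (f x))) \<le> snd k" if "l \<in> E.polar (fst k)" for l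
          using le[OF e that a(2)] g(3) by simp
        ultimately show "e \<in> G i \<inter> G k" using e by (simp add: G_def)
      qed
      then show ?thesis using mI by blast
    qed
    have small: "\<exists>i\<in>I. \<forall>v\<in>G i. \<forall>w\<in>G i. p \<alpha> (v - w) < \<epsilon>" if a: "\<alpha> \<in> A" "\<epsilon> > 0" for \<alpha> \<epsilon>
    proof -
      have "p \<alpha> (v - w) < \<epsilon>" if vw: "v \<in> G (\<alpha>, \<epsilon> / 3)" "w \<in> G (\<alpha>, \<epsilon> / 3)" for v w
      proof -
        have vE: "v \<in> vsp E" "w \<in> vsp E" using vw by (auto simp: G_def)
        obtain l where l: "l \<in> E.polar \<alpha>" "norm (l (v - w)) = p \<alpha> (v - w)"
          by (rule E.hahn_banach[OF a(1) E.diff_mem[OF vE]])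
        have "norm (l v - y (\<lambda>x. l (f x))) \<le> \<epsilon> / 3" "norm (l w - y (\<lambda>x. l (f x))) \<le> \<epsilon> / 3"
          using vw l(1) by (auto simp: G_def)
        then have "norm (l v - l w) \<le> \<epsilon> / 3 + \<epsilon> / 3"
          using norm_triangle_ineq4[of "l v - y (\<lambda>x. l (f x))" "l w - y (\<lambda>x. l (f x))"] by simp
        then show ?thesis using l(2) E.polar_diff[OF l(1) vE] a(2) by simp
      qed
      moreover have "(\<alpha>, \<epsilon> / 3) \<in> I" using a by (simp add: I_def)
      ultimately show ?thesis by blast
    qed
    obtain e where e: "e \<in> vsp E"
      "\<And>i \<alpha> \<epsilon>. i \<in> I \<Longrightarrow> \<alpha> \<in> A \<Longrightarrow> \<epsilon> > 0 \<Longrightarrow> \<exists>v\<in>G i. p \<alpha> (v - e) < \<epsilon>"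
      using E.complete_limit[OF complete ne G dir small] by blast
    have "l e = y (\<lambda>x. l (f x))" if a: "\<alpha> \<in> A" and l: "l \<in> E.polar \<alpha>" for \<alpha> l
    proof -
      have "norm (l e - y (\<lambda>x. l (f x))) \<le> \<epsilon>" if \<epsilon>: "\<epsilon> > 0" for \<epsilon>
      proof -
        have "(\<alpha>, \<epsilon> / 2) \<in> I" "\<epsilon> / 2 > 0" using a \<epsilon> by (auto simp: I_def)
        then obtain v where v: "v \<in> G (\<alpha>, \<epsilon> / 2)" "p \<alpha> (v - e) < \<epsilon> / 2" using e(2) a by blast
        have vE: "v \<in> vsp E" using v by (simp add: G_def)
        have "norm (l v - l e) = norm (l (v - e))" using E.polar_diff[OF l vE e(1)] by simp
        also have "\<dots> \<le> p \<alpha> (v - e)" by (intro E.polar_le[OF l] E.diff_mem vE e(1))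
        finally have "norm (l v - l e) \<le> \<epsilon> / 2" using v(2) by simp
        moreover have "norm (l v - y (\<lambda>x. l (f x))) \<le> \<epsilon> / 2" using v(1) l by (simp add: G_def)
        ultimately show ?thesis
          using norm_triangle_ineq4[of "l v - y (\<lambda>x. l (f x))" "l v - l e"] by simp
      qed
      then have "norm (l e - y (\<lambda>x. l (f x))) \<le> 0" by (rule field_le_epsilon[of _ 0, simplified])
      then show ?thesis by simp
    qed
    then show ?thesis using e(1) by blast
  qed
  then obtain u0 where u0: "\<And>y. y \<in> dual FF \<Longrightarrow> u0 y \<in> vsp E"
    "\<And>y \<alpha> l. y \<in> dual FF \<Longrightarrow> \<alpha> \<in> A \<Longrightarrow> l \<in> E.polar \<alpha> \<Longrightarrow> l (u0 y) = y (\<lambda>x. l (f x))"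
    by metis
  define u where "u y = (if y \<in> dual FF then u0 y else 0)" for y
  have uE: "u y \<in> vsp E" for y using u0(1) by (simp add: u_def)
  have ul: "l (u y) = y (\<lambda>x. l (f x))" if "y \<in> dual FF" "\<alpha> \<in> A" "l \<in> E.polar \<alpha>" for y \<alpha> l
    using u0(2)[OF that] that(1) by (simp add: u_def)
  \<comment> \<open>The values of u come from a choice, but they are unique because polars separate
    points; linearity can therefore be tested on functionals.\<close>
  have lin: "linear_on DK E u" unfolding linear_on_def vsp_dual_kappa scl_dual_kappa
  proof (intro conjI ballI allI)
    fix y z assume yz: "y \<in> dual FF" "z \<in> dual FF"
    show "u (y + z) = u y + u z"
    proof (rule E.polar_separates[OF lcHs_E uE E.add_mem[OF uE uE]])
      fix \<alpha> l assume l: "\<alpha> \<in> A" "l \<in> E.polar \<alpha>"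
      show "l (u (y + z)) = l (u y + u z)"
        using ul[OF dual_mems(1)[OF yz] l] ul[OF yz(1) l] ul[OF yz(2) l] E.polar_add[OF l(2) uE uE] by simp
    qed
  next
    fix c y assume y: "y \<in> dual FF"
    show "u (\<lambda>f. c * y f) = scl E c (u y)"
    proof (rule E.polar_separates[OF lcHs_E uE E.scl_mem[OF uE]])
      fix \<alpha> l assume l: "\<alpha> \<in> A" "l \<in> E.polar \<alpha>"
      show "l (u (\<lambda>f. c * y f)) = l (scl E c (u y))"
        using ul[OF dual_mems(3)[OF y] l] ul[OF y l] E.polar_scl[OF l(2) uE] by simp
    qed
  qed
  have "u \<in> cont_lin DK E"
  proof (rule kappa_cont_linI[OF lin])
    fix \<alpha> assume \<alpha>: "\<alpha> \<in> A"
    let ?M = "(\<lambda>l x. l (f x)) ` E.polar \<alpha>"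
    \<comment> \<open>A norming l turns p \<alpha> (u y) into the absolute value of y at one member
      of ?M, so the absolutely convex compact set ?M controls u with constant 1.\<close>
    have "p \<alpha> (u y) \<le> 1 * t" if y: "y \<in> dual FF" "\<forall>h\<in>\<Union>{?M}. norm (y h) \<le> t" for y t
    proof -
      obtain l where l: "l \<in> E.polar \<alpha>" "norm (l (u y)) = p \<alpha> (u y)"
        by (rule E.hahn_banach[OF \<alpha> uE])
      have "(\<lambda>x. l (f x)) \<in> ?M" using l(1) by blast
      then have "norm (y (\<lambda>x. l (f x))) \<le> t" using y(2) by blast
      then show ?thesis using l(2) ul[OF y(1) \<alpha> l(1)] by simp
    qed
    then show "\<exists>\<T> C. finite \<T> \<and> \<T> \<subseteq> abs_convex_compacts FF \<and> C > 0 \<and>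
      (\<forall>y\<in>dual FF. \<forall>t>0. (\<forall>f\<in>\<Union>\<T>. norm (y f) \<le> t) \<longrightarrow> p \<alpha> (u y) \<le> C * t)"
      using polar_image_compact[OF f \<alpha>] by (intro exI[of _ "{?M}"] exI[of _ 1]) simp
  next
    show "u y = 0" if "y \<notin> dual FF" for y using that by (simp add: u_def)
  qed (rule uE)
  moreover have "eval_delta u = f"
  proof
    fix x
    show "eval_delta u x = f x" unfolding eval_delta_def
    proof (rule E.polar_separates[OF lcHs_E uE W_range[OF f]])
      fix \<alpha> l assume l: "\<alpha> \<in> A" "l \<in> E.polar \<alpha>"
      show "l (u (delta x)) = l (f x)" using ul[OF delta_dual l] polar_comp[OF f l] by simp
    qed
  qed
  ultimately show ?thesis by blast
qed

lemma eval_delta_inj: "inj_on eval_delta (cont_lin DK E)"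
proof (rule inj_onI)
  fix u w assume uw: "u \<in> cont_lin DK E" "w \<in> cont_lin DK E" "eval_delta u = eval_delta w"
  show "u = w"
  proof
    fix y
    show "u y = w y"
    proof (cases "y \<in> dual FF")
      case True
      show ?thesis
      proof (rule E.polar_separates[OF lcHs_E E.cont_lin_range[OF uw(1)] E.cont_lin_range[OF uw(2)]])
        fix \<alpha> l assume "\<alpha> \<in> A" "l \<in> E.polar \<alpha>"
        then show "l (u y) = l (w y)" using eps_identity True uw by metis
      qed
    qed (simp add: eps_outside uw(1,2))
  qed
qed

text \<open>Uniform convergence on this set is convergence of u (delta x) in the weight \<nu> j: by
  linearity u sends its member at x to \<nu> j x times u (delta x).\<close>

definition scaled_deltas :: "'j \<Rightarrow> (('x \<Rightarrow> 'k) \<Rightarrow> 'k) set" where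
  "scaled_deltas j = range (\<lambda>x f. of_real (\<nu> j x) * delta x f)"

lemma scaled_deltas_equicontinuous:
  assumes j: "j \<in> J" shows "scaled_deltas j \<in> equicontinuous_sets FF"
proof (rule F.W.equicontinuousI)
  show "scaled_deltas j \<subseteq> dual FF" unfolding scaled_deltas_def using dual_mems(3)[OF delta_dual] by blast
  show "(j, ()) \<in> J \<times> {()}" using j by simp
  fix y h assume "y \<in> scaled_deltas j" and h: "h \<in> vsp FF"
  then obtain x where "y = (\<lambda>f. of_real (\<nu> j x) * delta x f)" by (auto simp: scaled_deltas_def)
  then have "norm (y h) = norm (h x) * \<nu> j x" using h nu_nonneg[OF j] by (simp add: norm_mult)
  then show "norm (y h) \<le> 1 * F.nrm (j, ()) h" using F.nrm_upper[OF h j, of "()" x] by simp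
qed simp

lemma eval_delta_continuous: "continuous_map (vtop (FF \<epsilon>\<^sub>t E)) (vtop W) eval_delta"
  unfolding W.continuous_map_into_iff
proof (intro conjI ballI allI impI)
  have top: "topspace (vtop (FF \<epsilon>\<^sub>t E)) = cont_lin DK E" using vsp_eps_product[of FF E] by (simp add: vsp_def)
  show "eval_delta \<in> topspace (vtop (FF \<epsilon>\<^sub>t E)) \<rightarrow> vsp W" using eval_delta_mem by (simp add: top)
  fix u0 i and \<epsilon> :: real
  assume "u0 \<in> topspace (vtop (FF \<epsilon>\<^sub>t E))" and i: "i \<in> J \<times> A" and \<epsilon>: "\<epsilon> > 0"
  then have u0: "u0 \<in> cont_lin DK E" by (simp add: top)
  obtain j \<alpha> where ja: "i = (j, \<alpha>)" "j \<in> J" "\<alpha> \<in> A" using i by auto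
  define U where "U = {u \<in> cont_lin DK E. nrm i (eval_delta u - eval_delta u0) < \<epsilon>}"
  have "openin (vtop (FF \<epsilon>\<^sub>t E)) U"
    unfolding eps_product_def cont_lin_tvs_def tvs.simps openin_zero_nbhd_topology
  proof (intro conjI ballI)
    show "U \<subseteq> cont_lin DK E" by (auto simp: U_def)
    fix u1 assume u1: "u1 \<in> U"
    then have u1c: "u1 \<in> cont_lin DK E" by (simp add: U_def)
    define \<rho> where "\<rho> = \<epsilon> - nrm i (eval_delta u1 - eval_delta u0)"
    have \<rho>: "\<rho> / 2 > 0" using u1 by (simp add: U_def \<rho>_def)
    let ?V = "{v \<in> vsp E. p \<alpha> (v - 0) < \<rho> / 2}"
    let ?N = "{u \<in> cont_lin DK E. \<forall>y\<in>scaled_deltas j. u y \<in> ?V}"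
    have "u \<in> U" if u: "u \<in> cont_lin DK E" "u - u1 \<in> ?N" for u
    proof -
      have "nrm i (eval_delta u - eval_delta u1) \<le> \<rho> / 2" unfolding ja(1)
      proof (rule nrm_least)
        fix x
        let ?y = "\<lambda>f. of_real (\<nu> j x) * delta x f"
        have "?y \<in> scaled_deltas j" by (simp add: scaled_deltas_def)
        then have "p \<alpha> ((u - u1) ?y) < \<rho> / 2" using u(2) by auto
        moreover have "(u - u1) ?y = scl E (of_real (\<nu> j x)) ((u - u1) (delta x))"
          by (intro eps_scl E.cont_lin_diff u u1c delta_dual)
        ultimately show "p \<alpha> ((eval_delta u - eval_delta u1) x) * \<nu> j x \<le> \<rho> / 2"
          using nu_nonneg[OF ja(2), of x] E.cont_lin_range[OF E.cont_lin_diff[OF u(1) u1c], of "delta x"]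
          by (simp add: E.p_scl[OF ja(3)] eval_delta_def mult.commute)
      qed (use \<rho> in simp)
      moreover have "nrm i (eval_delta u - eval_delta u0) \<le>
          nrm i (eval_delta u - eval_delta u1) + nrm i (eval_delta u1 - eval_delta u0)"
        by (intro W.p_triangle i eval_delta_mem u u1c u0)
      ultimately show ?thesis using u(1) \<rho> by (simp add: U_def \<rho>_def)
    qed
    moreover have "{?N} \<subseteq> {{u \<in> cont_lin DK E. \<forall>v\<in>M. u v \<in> V} | M V.
        M \<in> equicontinuous_sets FF \<and> openin (vtop E) V \<and> 0 \<in> V}"
    proof -
      have V: "openin (vtop E) ?V" by (intro E.openin_ball ja) simp
      have V0: "0 \<in> ?V" using \<rho> by (simp add: E.p_zero[OF ja(3)])
      have "?N \<in> {{u \<in> cont_lin DK E. \<forall>v\<in>M. u v \<in> V} | M V.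
        M \<in> equicontinuous_sets FF \<and> openin (vtop E) V \<and> 0 \<in> V}"
        by (rule CollectI, rule exI[of _ "scaled_deltas j"], rule exI[of _ ?V],
            rule conjI[OF refl conjI[OF scaled_deltas_equicontinuous[OF ja(2)] conjI[OF V V0]]])
      then show ?thesis by simp
    qed
    ultimately show "\<exists>\<F>. finite \<F> \<and> \<F> \<subseteq> {{u \<in> cont_lin DK E. \<forall>v\<in>M. u v \<in> V} | M V.
        M \<in> equicontinuous_sets FF \<and> openin (vtop E) V \<and> 0 \<in> V} \<and>
        (\<forall>u\<in>cont_lin DK E. u - u1 \<in> \<Inter>\<F> \<longrightarrow> u \<in> U)"
      by (intro exI[of _ "{?N}"] conjI ballI impI) auto
  qed
  then show "\<exists>U. openin (vtop (FF \<epsilon>\<^sub>t E)) U \<and> u0 \<in> U \<and> (\<forall>u\<in>U. nrm i (eval_delta u - eval_delta u0) < \<epsilon>)"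
    using u0 \<epsilon> by (intro exI[of _ U]) (auto simp: U_def W.p_zero[OF i])
qed

text \<open>The inverse of \<open>eval_delta\<close> exists by injectivity and surjectivity, and
  \<open>eps_bound\<close> makes it continuous. Both maps appear in the conclusion because
  \<open>transfer_seminormed_space\<close> pulls seminorms back along
  \<open>eval_delta\<close>.\<close>

theorem eps_isomorphism:
  assumes complete: "complete_tvs E"
  obtains R where "linear_on W (FF \<epsilon>\<^sub>t E) R" "homeomorphic_maps (vtop W) (vtop (FF \<epsilon>\<^sub>t E)) R eval_delta"
proof -
  define R where "R = inv_into (cont_lin DK E) eval_delta"
  have R: "R f \<in> cont_lin DK E" "eval_delta (R f) = f" if "f \<in> vsp W" for f
  proof -
    have "f \<in> eval_delta ` cont_lin DK E" using eval_delta_surj[OF complete that] by blast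
    then show "R f \<in> cont_lin DK E" "eval_delta (R f) = f"
      unfolding R_def by (rule inv_into_into, rule f_inv_into_f)
  qed
  have RS: "R (eval_delta u) = u" if "u \<in> cont_lin DK E" for u
    unfolding R_def using eval_delta_inj that by (rule inv_into_f_f)
  have lin: "linear_on W (FF \<epsilon>\<^sub>t E) R" unfolding linear_on_def
  proof (intro conjI ballI allI)
    fix f g assume fg: "f \<in> vsp W" "g \<in> vsp W"
    have "eval_delta (R f + R g) = f + g" using R(2)[OF fg(1)] R(2)[OF fg(2)] by (auto simp: eval_delta_def fun_eq_iff)
    then show "R (f + g) = R f + R g" using RS[OF E.cont_lin_add[OF R(1)[OF fg(1)] R(1)[OF fg(2)]]] by simp
  next
    fix c f assume f: "f \<in> vsp W"
    have "eval_delta (\<lambda>y. scl E c (R f y)) = scl W c f" using R(2)[OF f] by (auto simp: eval_delta_def fun_eq_iff scl_W)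
    then show "R (scl W c f) = scl (FF \<epsilon>\<^sub>t E) c (R f)" using RS[OF E.cont_lin_scl[OF R(1)[OF f]], of c] by simp
  qed
  have "continuous_map (vtop W) (vtop (FF \<epsilon>\<^sub>t E)) R" unfolding continuous_map_def
  proof (intro conjI allI impI)
    have top: "topspace (vtop (FF \<epsilon>\<^sub>t E)) = cont_lin DK E" using vsp_eps_product[of FF E] by (simp add: vsp_def)
    show "R \<in> topspace (vtop W) \<rightarrow> topspace (vtop (FF \<epsilon>\<^sub>t E))" using R(1) by (simp add: top vsp_def)
    fix U assume U: "openin (vtop (FF \<epsilon>\<^sub>t E)) U"
    show "openin (vtop W) {f \<in> topspace (vtop W). R f \<in> U}" unfolding W.openin_iff
    proof (intro conjI ballI)
      fix f0 assume "f0 \<in> {f \<in> topspace (vtop W). R f \<in> U}"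
      then have f0: "f0 \<in> vsp W" "R f0 \<in> U" by (auto simp: vsp_def)
      obtain \<F> where F: "finite \<F>" "\<F> \<subseteq> {{u \<in> cont_lin DK E. \<forall>v\<in>M. u v \<in> V} | M V.
          M \<in> equicontinuous_sets FF \<and> openin (vtop E) V \<and> 0 \<in> V}"
        "\<forall>u\<in>cont_lin DK E. u - R f0 \<in> \<Inter>\<F> \<longrightarrow> u \<in> U"
        using U f0(2) unfolding eps_product_def cont_lin_tvs_def tvs.simps openin_zero_nbhd_topology by blast
      obtain \<T> \<alpha> r where t: "finite \<T>" "\<T> \<subseteq> equicontinuous_sets FF" "\<alpha> \<in> A" "r > 0"
        "\<forall>u\<in>cont_lin DK E. (\<forall>v\<in>\<Union>\<T>. p \<alpha> (u v) < r) \<longrightarrow> u \<in> \<Inter>\<F>"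
        using E.cont_lin_nbhd[OF F(1,2)] by blast
      have H: "\<Union>\<T> \<in> equicontinuous_sets FF" by (rule F.W.equicontinuous_Union[OF t(1,2)])
      obtain i c where i: "i \<in> J \<times> {()}" "c > 0" "\<forall>y\<in>\<Union>\<T>. \<forall>h\<in>vsp FF. norm (y h) \<le> c * F.nrm i h"
        using F.W.equicontinuous_bound[OF H] by blast
      then obtain j where j: "i = (j, ())" "j \<in> J" by auto
      have "R f \<in> U" if f: "f \<in> vsp W" "nrm (j, \<alpha>) (f - f0) < r / c" for f
      proof -
        have d: "R f - R f0 \<in> cont_lin DK E" by (intro E.cont_lin_diff R f f0)
        have ed: "eval_delta (R f - R f0) = f - f0"
          using R(2)[OF f(1)] R(2)[OF f0(1)] by (auto simp: eval_delta_def fun_eq_iff)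
        have small: "p \<alpha> ((R f - R f0) y) < r" if y: "y \<in> \<Union>\<T>" for y
        proof -
          have yd: "y \<in> dual FF" using y H by (auto simp: equicontinuous_sets_def)
          have "p \<alpha> ((R f - R f0) y) \<le> c * nrm (j, \<alpha>) (eval_delta (R f - R f0))"
            using i(3) y j(1) by (intro eps_bound[OF d yd j(2) t(3) i(2)]) blast
          also have "\<dots> < r" using f(2) i(2) by (simp add: ed field_simps)
          finally show ?thesis .
        qed
        have "R f - R f0 \<in> \<Inter>\<F>" by (rule t(5)[rule_format, OF d small])
        then show ?thesis using F(3) R(1)[OF f(1)] by blast
      qed
      then show "\<exists>i\<in>J \<times> A. \<exists>r>0. \<forall>f\<in>vsp W. nrm i (f - f0) < r \<longrightarrow> f \<in> {f \<in> topspace (vtop W). R f \<in> U}"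
        using j(2) t(3,4) i(2) by (intro bexI[of _ "(j, \<alpha>)"] exI[of _ "r / c"]) (auto simp: vsp_def)
    qed (auto simp: vsp_def)
  qed
  then have "homeomorphic_maps (vtop W) (vtop (FF \<epsilon>\<^sub>t E)) R eval_delta"
    using eval_delta_continuous R(2) RS vsp_eps_product[of FF E]
    by (auto simp: homeomorphic_maps_def vsp_def)
  then show ?thesis using that lin by blast
qed

text \<open>\<open>eps_approx\<close> is used with an empty set of test functions; its approximating
  sums are the tensors with factors \<open>bump \<phi> z\<close> and
  \<open>u (delta z)\<close>.\<close>

lemma tensor_operators_dense:
  "vtop (FF \<epsilon>\<^sub>t E) closure_of (cont_lin DK E \<inter> tensor_operators FF E) = cont_lin DK E"
proof (intro equalityI subsetI)
  have top: "topspace (vtop (FF \<epsilon>\<^sub>t E)) = cont_lin DK E" using vsp_eps_product[of FF E] by (simp add: vsp_def)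
  {
    fix u assume "u \<in> vtop (FF \<epsilon>\<^sub>t E) closure_of (cont_lin DK E \<inter> tensor_operators FF E)"
    then show "u \<in> cont_lin DK E" by (simp add: in_closure_of top)
  }
  fix u assume u: "u \<in> cont_lin DK E"
  show "u \<in> vtop (FF \<epsilon>\<^sub>t E) closure_of (cont_lin DK E \<inter> tensor_operators FF E)"
    unfolding in_closure_of top
  proof (intro conjI allI impI u)
    fix U assume U: "u \<in> U \<and> openin (vtop (FF \<epsilon>\<^sub>t E)) U"
    then obtain \<F> where F: "finite \<F>" "\<F> \<subseteq> {{u \<in> cont_lin DK E. \<forall>v\<in>M. u v \<in> V} | M V.
        M \<in> equicontinuous_sets FF \<and> openin (vtop E) V \<and> 0 \<in> V}"
      "\<forall>w\<in>cont_lin DK E. w - u \<in> \<Inter>\<F> \<longrightarrow> w \<in> U"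
      unfolding eps_product_def cont_lin_tvs_def tvs.simps openin_zero_nbhd_topology by blast
    obtain \<T> \<alpha> r where t: "finite \<T>" "\<T> \<subseteq> equicontinuous_sets FF" "\<alpha> \<in> A" "r > 0"
      "\<forall>u\<in>cont_lin DK E. (\<forall>v\<in>\<Union>\<T>. p \<alpha> (u v) < r) \<longrightarrow> u \<in> \<Inter>\<F>"
      using E.cont_lin_nbhd[OF F(1,2)] by blast
    define H where "H = \<Union>\<T>"
    have H: "H \<in> equicontinuous_sets FF" unfolding H_def by (rule F.W.equicontinuous_Union[OF t(1,2)])
    have r: "r / 2 > 0" using t by simp
    have c: "compactin (vtop FF) {}" by simp
    obtain Z \<phi> L where Z: "bump_family Z \<phi> L"
      "\<forall>y\<in>H. p \<alpha> (u y - (\<Sum>z\<in>Z. scl E (y (bump \<phi> z)) (u (delta z)))) \<le> r / 2"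
      using eps_approx[OF u H c t(3) r] by blast
    define w where "w y = (if y \<in> dual FF then \<Sum>z\<in>Z. scl E (y (bump \<phi> z)) (u (delta z)) else 0)" for y
    have fin: "finite Z" using Z(1) by (simp add: bump_family_def)
    have wc: "w \<in> cont_lin DK E" unfolding w_def
      by (intro tensor_cont_lin fin bump_mem[OF Z(1)] E.cont_lin_range[OF u])
    have wt: "w \<in> tensor_operators FF E" unfolding w_def
      by (intro tensor_operators_sum fin bump_mem[OF Z(1)] E.cont_lin_range[OF u])
    have small: "p \<alpha> ((w - u) y) < r" if "y \<in> \<Union>\<T>" for y
    proof -
      have y: "y \<in> H" using that by (simp only: H_def)
      then have yd: "y \<in> dual FF" using H by (auto simp: equicontinuous_sets_def)
      have "p \<alpha> (u y - w y) \<le> r / 2" using Z(2) y yd by (simp add: w_def)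
      then show ?thesis
        using E.p_commute[OF t(3) E.cont_lin_range[OF u] E.cont_lin_range[OF wc], of y y] r by simp
    qed
    have "w - u \<in> \<Inter>\<F>" by (rule t(5)[rule_format, OF E.cont_lin_diff[OF wc u] small])
    then show "\<exists>w. w \<in> cont_lin DK E \<inter> tensor_operators FF E \<and> w \<in> U" using F(3) wc wt by blast
  qed
qed

text \<open>The limit is taken pointwise, some weight being positive at each point, and is then
  uniform in every weighted seminorm. Near a point a weight bounded away from zero turns this into
  locally uniform convergence, hence continuity.\<close>

lemma complete_W:
  assumes complete: "complete_tvs E"
  shows "complete_tvs W"
proof (rule W.completeI)
  fix \<F> :: "('x \<Rightarrow> 'v) filter"
  assume ne: "\<F> \<noteq> bot" and ev: "eventually (\<lambda>f. f \<in> vsp W) \<F>"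
    and cau: "\<And>i \<epsilon>. i \<in> J \<times> A \<Longrightarrow> \<epsilon> > 0 \<Longrightarrow> \<exists>Q. eventually Q \<F> \<and>
      (\<forall>f g. Q f \<longrightarrow> Q g \<longrightarrow> f \<in> vsp W \<and> g \<in> vsp W \<and> nrm i (f - g) < \<epsilon>)"
  have lim: "\<exists>e. e \<in> vsp E \<and> (\<forall>\<alpha>\<in>A. \<forall>\<epsilon>>0. eventually (\<lambda>f. f x \<in> vsp E \<and> p \<alpha> (f x - e) < \<epsilon>) \<F>)" for x
  proof -
    have "cauchy_filter_on E (filtermap (\<lambda>f. f x) \<F>)" unfolding E.cauchy_filter_on_iff
    proof (intro conjI ballI allI impI)
      show "filtermap (\<lambda>f. f x) \<F> \<noteq> bot" using ne by (simp add: filtermap_bot_iff)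
      show "eventually (\<lambda>v. v \<in> vsp E) (filtermap (\<lambda>f. f x) \<F>)"
        unfolding eventually_filtermap using ev by eventually_elim (rule W_range)
      fix \<alpha> and \<epsilon> :: real assume a: "\<alpha> \<in> A" "\<epsilon> > 0"
      obtain j where j: "j \<in> J" "0 < \<nu> j x" using nu_positive by blast
      have "(j, \<alpha>) \<in> J \<times> A" "\<epsilon> * \<nu> j x > 0" using a j by auto
      then obtain Q where Q: "eventually Q \<F>"
        "\<forall>f g. Q f \<longrightarrow> Q g \<longrightarrow> f \<in> vsp W \<and> g \<in> vsp W \<and> nrm (j, \<alpha>) (f - g) < \<epsilon> * \<nu> j x"
        using cau by blast
      have "p \<alpha> (f x - g x) < \<epsilon>" if "Q f" "Q g" for f g
      proof -
        have fg: "f \<in> vsp W" "g \<in> vsp W" "nrm (j, \<alpha>) (f - g) < \<epsilon> * \<nu> j x" using Q(2) that by auto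
        have "p \<alpha> ((f - g) x) * \<nu> j x \<le> nrm (j, \<alpha>) (f - g)" using fg j a by (intro nrm_upper W.diff_mem)
        then have "p \<alpha> (f x - g x) * \<nu> j x < \<epsilon> * \<nu> j x" using fg(3) by simp
        then show ?thesis using j(2) by simp
      qed
      then have "\<forall>v w. (\<exists>f. Q f \<and> v = f x) \<longrightarrow> (\<exists>f. Q f \<and> w = f x) \<longrightarrow> v \<in> vsp E \<and> w \<in> vsp E \<and> p \<alpha> (v - w) < \<epsilon>"
        using Q(2) W_range by blast
      moreover have "eventually (\<lambda>v. \<exists>f. Q f \<and> v = f x) (filtermap (\<lambda>f. f x) \<F>)"
        unfolding eventually_filtermap using Q(1) by eventually_elim blast
      ultimately show "\<exists>Q. eventually Q (filtermap (\<lambda>f. f x) \<F>) \<and>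
          (\<forall>v w. Q v \<longrightarrow> Q w \<longrightarrow> v \<in> vsp E \<and> w \<in> vsp E \<and> p \<alpha> (v - w) < \<epsilon>)" by blast
    qed
    then obtain e where "limitin (vtop E) (\<lambda>v. v) e (filtermap (\<lambda>f. f x) \<F>)"
      using complete unfolding complete_tvs_def by blast
    then show ?thesis unfolding E.limitin_iff eventually_filtermap by blast
  qed
  have "\<exists>g. \<forall>x. g x \<in> vsp E \<and> (\<forall>\<alpha>\<in>A. \<forall>\<epsilon>>0. eventually (\<lambda>f. f x \<in> vsp E \<and> p \<alpha> (f x - g x) < \<epsilon>) \<F>)"
    by (intro choice allI lim)
  then obtain g where g: "\<And>x. g x \<in> vsp E"
    "\<And>x \<alpha> \<epsilon>. \<alpha> \<in> A \<Longrightarrow> \<epsilon> > 0 \<Longrightarrow> eventually (\<lambda>f. f x \<in> vsp E \<and> p \<alpha> (f x - g x) < \<epsilon>) \<F>"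
    by blast
  have unif: "\<exists>Q. eventually Q \<F> \<and> (\<forall>f. Q f \<longrightarrow> f \<in> vsp W \<and> (\<forall>x. p \<alpha> (f x - g x) * \<nu> j x \<le> \<epsilon>))"
    if a: "j \<in> J" "\<alpha> \<in> A" "\<epsilon> > 0" for j \<alpha> \<epsilon>
  proof -
    have "(j, \<alpha>) \<in> J \<times> A" using a by simp
    then obtain Q where Q: "eventually Q \<F>"
      "\<forall>f g. Q f \<longrightarrow> Q g \<longrightarrow> f \<in> vsp W \<and> g \<in> vsp W \<and> nrm (j, \<alpha>) (f - g) < \<epsilon>"
      using cau a(3) by blast
    have "p \<alpha> (f x - g x) * \<nu> j x \<le> \<epsilon>" if f: "Q f" for f x
    proof (rule field_le_epsilon)
      fix \<eta> :: real assume \<eta>: "\<eta> > 0"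
      have nn: "0 \<le> \<nu> j x" by (rule nu_nonneg[OF a(1)])
      \<comment> \<open>The added 1 avoids division by a weight that may vanish at x and still gives
        \<delta> * \<nu> j x \<le> \<eta>.\<close>
      define \<delta> where "\<delta> = \<eta> / (\<nu> j x + 1)"
      have \<delta>: "\<delta> > 0" using nn \<eta> by (simp add: \<delta>_def)
      have "\<delta> * \<nu> j x \<le> \<delta> * (\<nu> j x + 1)" using \<delta> by (intro mult_left_mono) auto
      also have "\<dots> = \<eta>" using nn by (simp add: \<delta>_def)
      finally have \<delta>\<eta>: "\<delta> * \<nu> j x \<le> \<eta>" .
      have "eventually (\<lambda>h. Q h \<and> p \<alpha> (h x - g x) < \<delta>) \<F>"
        using Q(1) g(2)[OF a(2) \<delta>, of x] by eventually_elim blast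
      then obtain h where h: "Q h" "p \<alpha> (h x - g x) < \<delta>"
        using ne eventually_happens'[OF ne] by blast
      have fh: "f \<in> vsp W" "h \<in> vsp W" "nrm (j, \<alpha>) (f - h) < \<epsilon>" using Q(2) f h(1) by auto
      have "p \<alpha> (f x - g x) \<le> p \<alpha> (f x - h x) + p \<alpha> (h x - g x)"
        using W_range fh g(1) by (intro E.p_triangle a(2)) auto
      also have "\<dots> \<le> p \<alpha> ((f - h) x) + \<delta>" using h(2) by simp
      finally have "p \<alpha> (f x - g x) * \<nu> j x \<le> (p \<alpha> ((f - h) x) + \<delta>) * \<nu> j x"
        using nn by (rule mult_right_mono)
      also have "\<dots> = p \<alpha> ((f - h) x) * \<nu> j x + \<delta> * \<nu> j x" by (rule distrib_right)
      also have "p \<alpha> ((f - h) x) * \<nu> j x \<le> nrm (j, \<alpha>) (f - h)" using fh a by (intro nrm_upper W.diff_mem)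
      finally show "p \<alpha> (f x - g x) * \<nu> j x \<le> \<epsilon> + \<eta>" using fh(3) \<delta>\<eta> by linarith
    qed
    then show ?thesis using Q by (intro exI[of _ Q]) blast
  qed
  have pick: "\<exists>f\<in>vsp W. \<forall>x. p \<alpha> (f x - g x) * \<nu> j x \<le> \<epsilon>" if a: "j \<in> J" "\<alpha> \<in> A" "\<epsilon> > 0" for j \<alpha> \<epsilon>
    using unif[OF a] eventually_happens'[OF ne] by blast
  have gW: "g \<in> vsp W" unfolding vsp_W_iff E.continuous_map_into_iff
  proof (intro conjI ballI allI impI)
    show "g \<in> topspace euclidean \<rightarrow> vsp E" using g(1) by simp
    fix x0 :: 'x and \<alpha> and \<epsilon> :: real assume \<alpha>: "\<alpha> \<in> A" and \<epsilon>: "\<epsilon> > 0"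
    obtain G L where G: "open G" "compact L" "{x0} \<subseteq> G" "G \<subseteq> L"
      using compact_between_open[OF loc_compact, of "{x0}" UNIV] by auto
    obtain j c where j: "j \<in> J" "c > 0" "\<And>x. x \<in> L \<Longrightarrow> c \<le> \<nu> j x" using nu_away[OF G(2)] by blast
    \<comment> \<open>Division by the lower bound c leaves \<epsilon> / 4 at each of the two points,
      and continuity of f adds a third quarter.\<close>
    have ec: "\<epsilon> / 4 * c > 0" using \<epsilon> j by simp
    obtain f where f: "f \<in> vsp W" "\<forall>x. p \<alpha> (f x - g x) * \<nu> j x \<le> \<epsilon> / 4 * c"
      using pick[OF j(1) \<alpha> ec] by blast
    have near: "p \<alpha> (f x - g x) \<le> \<epsilon> / 4" if x: "x \<in> L" for x
    proof -
      have "p \<alpha> (f x - g x) * c \<le> p \<alpha> (f x - g x) * \<nu> j x"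
        by (intro mult_left_mono j(3) x E.p_nonneg[OF \<alpha>] E.diff_mem W_range[OF f(1)] g(1))
      also have "\<dots> \<le> \<epsilon> / 4 * c" using f(2) by blast
      finally show ?thesis using j(2) by simp
    qed
    have e4: "\<epsilon> / 4 > 0" using \<epsilon> by simp
    obtain U where U: "openin euclidean U" "x0 \<in> U" "\<forall>s\<in>U. p \<alpha> (f s - f x0) < \<epsilon> / 4"
      using W_continuous[OF f(1), unfolded E.continuous_map_into_iff, THEN conjunct2, rule_format, OF _ \<alpha> e4, of x0]
      by auto
    have "p \<alpha> (g s - g x0) < \<epsilon>" if s: "s \<in> U \<inter> G" for s
    proof -
      have "p \<alpha> (g s - g x0) \<le> p \<alpha> (g s - f s) + p \<alpha> (f s - g x0)"
        by (intro E.p_triangle \<alpha> g W_range[OF f(1)])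
      also have "p \<alpha> (f s - g x0) \<le> p \<alpha> (f s - f x0) + p \<alpha> (f x0 - g x0)"
        by (intro E.p_triangle \<alpha> g W_range[OF f(1)])
      also have "p \<alpha> (g s - f s) = p \<alpha> (f s - g s)" by (intro E.p_commute \<alpha> g W_range[OF f(1)])
      finally have "p \<alpha> (g s - g x0) \<le> p \<alpha> (f s - g s) + (p \<alpha> (f s - f x0) + p \<alpha> (f x0 - g x0))" by simp
      moreover have "s \<in> L" "x0 \<in> L" using s G by auto
      moreover have "p \<alpha> (f s - f x0) < \<epsilon> / 4" using U(3) s by blast
      ultimately show ?thesis using near[of s] near[of x0] \<epsilon> by linarith
    qed
    then show "\<exists>U. openin euclidean U \<and> x0 \<in> U \<and> (\<forall>s\<in>U. p \<alpha> (g s - g x0) < \<epsilon>)"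
      using U G by (intro exI[of _ "U \<inter> G"]) auto
  next
    fix j \<alpha> and \<epsilon> :: real assume j: "j \<in> J" and \<alpha>: "\<alpha> \<in> A" and \<epsilon>: "\<epsilon> > 0"
    have e2: "\<epsilon> / 2 > 0" using \<epsilon> by simp
    obtain f where f: "f \<in> vsp W" "\<forall>x. p \<alpha> (f x - g x) * \<nu> j x \<le> \<epsilon> / 2"
      using pick[OF j \<alpha> e2] by blast
    obtain K where K: "compact K" "\<forall>x. x \<notin> K \<longrightarrow> p \<alpha> (f x) * \<nu> j x \<le> \<epsilon> / 2"
      using f(1)[unfolded vsp_W_iff, THEN conjunct2, rule_format, OF j \<alpha> e2] by blast
    have "p \<alpha> (g x) * \<nu> j x \<le> \<epsilon>" if x: "x \<notin> K" for x
    proof -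
      have "p \<alpha> (f x - (f x - g x)) \<le> p \<alpha> (f x) + p \<alpha> (f x - g x)"
        by (intro E.p_diff \<alpha> E.diff_mem W_range[OF f(1)] g(1))
      then have "p \<alpha> (g x) * \<nu> j x \<le> (p \<alpha> (f x) + p \<alpha> (f x - g x)) * \<nu> j x"
        using nu_nonneg[OF j, of x] by (intro mult_right_mono) auto
      also have "\<dots> = p \<alpha> (f x) * \<nu> j x + p \<alpha> (f x - g x) * \<nu> j x" by (rule distrib_right)
      finally show ?thesis using K(2) x f(2) by (smt (verit) field_sum_of_halves)
    qed
    then show "\<exists>K. compact K \<and> (\<forall>x. x \<notin> K \<longrightarrow> p \<alpha> (g x) * \<nu> j x \<le> \<epsilon>)" using K(1) by blast
  qed
  show "\<exists>l\<in>vsp W. \<forall>i\<in>J \<times> A. \<forall>\<epsilon>>0. eventually (\<lambda>f. f \<in> vsp W \<and> nrm i (f - l) < \<epsilon>) \<F>"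
  proof (intro bexI[OF _ gW] ballI allI impI)
    fix i and \<epsilon> :: real assume i: "i \<in> J \<times> A" and \<epsilon>: "\<epsilon> > 0"
    obtain j \<alpha> where ja: "i = (j, \<alpha>)" "j \<in> J" "\<alpha> \<in> A" using i by auto
    have e2: "\<epsilon> / 2 > 0" using \<epsilon> by simp
    obtain Q where Q: "eventually Q \<F>" "\<forall>f. Q f \<longrightarrow> f \<in> vsp W \<and> (\<forall>x. p \<alpha> (f x - g x) * \<nu> j x \<le> \<epsilon> / 2)"
      using unif[OF ja(2,3) e2] by blast
    from Q(1) show "eventually (\<lambda>f. f \<in> vsp W \<and> nrm i (f - g) < \<epsilon>) \<F>"
    proof eventually_elim
      case (elim f)
      then have "nrm i (f - g) \<le> \<epsilon> / 2" unfolding ja(1) using Q(2) e2 by (intro nrm_least) auto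
      then show ?case using Q(2) elim \<epsilon> by auto
    qed
  qed
qed

end

section \<open>Transfer along isomorphisms and uniqueness of completions\<close>

context seminormed_space
begin

text \<open>Meant for the \<epsilon>-product, whose topology is not given by seminorms: the
  seminorms of X composed with S generate the topology of Y, so separation and completeness can be
  imported from X.\<close>

lemma transfer_seminormed_space:
  assumes lin: "linear_on X Y R" and hom: "homeomorphic_maps (vtop X) (vtop Y) R S"
    and vsY: "vector_space (scl Y)"
  shows "seminormed_space Y A (\<lambda>\<alpha> w. p \<alpha> (S w))"
    and "lcHs X \<Longrightarrow> lcHs Y" and "complete_tvs X \<Longrightarrow> complete_tvs Y"
proof -
  interpret VY: vector_space "scl Y" by (rule vsY)
  have RS: "\<And>v. v \<in> vsp X \<Longrightarrow> R v \<in> vsp Y \<and> S (R v) = v" "\<And>w. w \<in> vsp Y \<Longrightarrow> S w \<in> vsp X \<and> R (S w) = w"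
    using hom by (auto simp: homeomorphic_maps_def continuous_map_def vsp_def)
  have Radd: "R (v + w) = R v + R w" and Rscl: "R (scl X c v) = scl Y c (R v)"
    if "v \<in> vsp X" "w \<in> vsp X" for v w c using lin that by (auto simp: linear_on_def)
  have Rdiff: "R (v - w) = R v - R w" if "v \<in> vsp X" "w \<in> vsp X" for v w
    using Radd[of "v - w" w] that diff_mem by simp
  have subY: "VY.subspace (vsp Y)"
  proof -
    have "0 \<in> vsp Y" using RS(1)[OF zero_mem] Rscl[OF zero_mem zero_mem, of 0] by simp
    moreover have "v + w \<in> vsp Y" if "v \<in> vsp Y" "w \<in> vsp Y" for v w
      using RS(2)[OF that(1)] RS(2)[OF that(2)] RS(1)[of "S v + S w"] Radd[of "S v" "S w"] by (simp add: add_mem)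
    moreover have "scl Y c v \<in> vsp Y" if "v \<in> vsp Y" for c v
      using RS(2)[OF that] RS(1)[of "scl X c (S v)"] Rscl[of "S v" "S v" c] by (simp add: scl_mem)
    ultimately show ?thesis by (simp add: VY.subspace_def)
  qed
  have Sadd: "S (v + w) = S v + S w" if "v \<in> vsp Y" "w \<in> vsp Y" for v w
    using RS(2)[OF that(1)] RS(2)[OF that(2)] RS(1)[of "S v + S w"] Radd[of "S v" "S w"] by (simp add: add_mem)
  have Sscl: "S (scl Y c v) = scl X c (S v)" if "v \<in> vsp Y" for c v
    using RS(2)[OF that] RS(1)[of "scl X c (S v)"] Rscl[of "S v" "S v" c] by (simp add: scl_mem)
  let ?p = "\<lambda>\<alpha> w. p \<alpha> (S w)"
  let ?Y = "\<lparr>scl = scl Y, vtop = seminorm_topology (vsp Y) (?p ` A)\<rparr>"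
  have vspY: "vsp ?Y = vsp Y" by (simp add: vsp_def seminorm_topology_def)
  have Y: "seminormed_space ?Y A ?p"
  proof (rule seminormed_space.intro)
    show "vector_space (scl ?Y)" using vsY by simp
    show "module.subspace (scl ?Y) (vsp ?Y)" using subY vspY by simp
    have "seminorm_on ?Y (?p \<alpha>)" if "\<alpha> \<in> A" for \<alpha>
      unfolding seminorm_on_def vspY using RS(2) that
      by (auto simp: Sadd Sscl p_add p_scl p_nonneg)
    moreover have "\<exists>\<gamma>\<in>A. \<exists>C>0. \<forall>v\<in>vsp Y. ?p \<alpha> v \<le> C * ?p \<gamma> v \<and> ?p \<beta> v \<le> C * ?p \<gamma> v"
      if ab: "\<alpha> \<in> A" "\<beta> \<in> A" for \<alpha> \<beta>
    proof -
      obtain \<gamma> C where "\<gamma> \<in> A" "C > 0" "\<forall>v\<in>vsp X. p \<alpha> v \<le> C * p \<gamma> v \<and> p \<beta> v \<le> C * p \<gamma> v"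
        using directed[OF ab] by blast
      then show ?thesis using RS(2) by (intro bexI[of _ \<gamma>] exI[of _ C]) auto
    qed
    ultimately show "fundamental_seminorms ?Y A ?p"
      using index_nonempty vspY unfolding fundamental_seminorms_def by simp
  qed
  interpret Y: seminormed_space ?Y A ?p by (rule Y)
  have Sdiff: "S (v - w) = S v - S w" if "v \<in> vsp Y" "w \<in> vsp Y" for v w
    using Sadd[of "v - w" w] that Y.diff_mem[unfolded vspY] by simp
  have "openin (vtop ?Y) U \<longleftrightarrow> openin (vtop Y) U" for U
  proof
    assume U: "openin (vtop ?Y) U"
    have UY: "U \<subseteq> vsp Y" using U unfolding Y.openin_iff vspY by blast
    have o: "openin (vtop X) {v \<in> vsp X. R v \<in> U}" unfolding openin_iff
    proof (intro conjI ballI)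
      fix v assume v: "v \<in> {v \<in> vsp X. R v \<in> U}"
      then obtain \<alpha> r where a: "\<alpha> \<in> A" "r > 0" "\<forall>y\<in>vsp Y. ?p \<alpha> (y - R v) < r \<longrightarrow> y \<in> U"
        using U unfolding Y.openin_iff vspY by blast
      have "w \<in> {v \<in> vsp X. R v \<in> U}" if w: "w \<in> vsp X" "p \<alpha> (w - v) < r" for w
        using a(3)[rule_format, of "R w"] w v RS(1) by (simp add: Sdiff)
      then show "\<exists>\<alpha>\<in>A. \<exists>r>0. \<forall>y\<in>vsp X. p \<alpha> (y - v) < r \<longrightarrow> y \<in> {v \<in> vsp X. R v \<in> U}"
        using a by blast
    qed auto
    have eq: "{w \<in> topspace (vtop Y). S w \<in> {v \<in> vsp X. R v \<in> U}} = U"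
      using UY RS(2) by (auto simp: vsp_def)
    have "continuous_map (vtop Y) (vtop X) S" using hom by (simp add: homeomorphic_maps_def)
    from openin_continuous_map_preimage[OF this o] show "openin (vtop Y) U" by (simp only: eq)
  next
    assume U: "openin (vtop Y) U"
    then have UY: "U \<subseteq> vsp Y" by (simp add: vsp_def openin_subset)
    have "continuous_map (vtop X) (vtop Y) R" using hom by (simp add: homeomorphic_maps_def)
    then have o: "openin (vtop X) {v \<in> topspace (vtop X). R v \<in> U}" using U by (rule openin_continuous_map_preimage)
    show "openin (vtop ?Y) U" unfolding Y.openin_iff vspY
    proof (intro conjI ballI UY)
      fix w assume w: "w \<in> U"
      then have "S w \<in> {v \<in> topspace (vtop X). R v \<in> U}" using UY RS(2) by (auto simp: vsp_def)
      then obtain \<alpha> r where a: "\<alpha> \<in> A" "r > 0"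
        "\<forall>y\<in>vsp X. p \<alpha> (y - S w) < r \<longrightarrow> y \<in> {v \<in> topspace (vtop X). R v \<in> U}"
        using o unfolding openin_iff by blast
      have "z \<in> U" if z: "z \<in> vsp Y" "?p \<alpha> (z - w) < r" for z
        using a(3)[rule_format, of "S z"] z w UY RS(2) by (auto simp: Sdiff subset_iff)
      then show "\<exists>\<alpha>\<in>A. \<exists>r>0. \<forall>z\<in>vsp Y. ?p \<alpha> (z - w) < r \<longrightarrow> z \<in> U" using a by blast
    qed
  qed
  then have "vtop ?Y = vtop Y" by (simp add: topology_eq)
  then have "?Y = Y" by simp
  then show sn: "seminormed_space Y A ?p" using Y by simp
  interpret Y': seminormed_space Y A ?p by (rule sn)
  show "lcHs Y" if "lcHs X"
    unfolding Y'.lcHs_iff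
  proof (intro ballI impI)
    fix w assume w: "w \<in> vsp Y" "\<forall>\<alpha>\<in>A. p \<alpha> (S w) = 0"
    then have "S w = 0" using that RS(2)[OF w(1)] unfolding lcHs_iff by blast
    then show "w = 0" using RS(2)[OF w(1)] Rscl[OF zero_mem zero_mem, of 0] by simp
  qed
  show "complete_tvs Y" if complete: "complete_tvs X"
  proof (rule Y'.completeI)
    fix \<F> assume ne: "\<F> \<noteq> bot" and ev: "eventually (\<lambda>v. v \<in> vsp Y) \<F>"
      and cau: "\<And>\<alpha> \<epsilon>. \<alpha> \<in> A \<Longrightarrow> \<epsilon> > 0 \<Longrightarrow> \<exists>Q. eventually Q \<F> \<and>
        (\<forall>v w. Q v \<longrightarrow> Q w \<longrightarrow> v \<in> vsp Y \<and> w \<in> vsp Y \<and> p \<alpha> (S (v - w)) < \<epsilon>)"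
    have "cauchy_filter_on X (filtermap S \<F>)" unfolding cauchy_filter_on_iff
    proof (intro conjI ballI allI impI)
      show "filtermap S \<F> \<noteq> bot" using ne by (simp add: filtermap_bot_iff)
      show "eventually (\<lambda>v. v \<in> vsp X) (filtermap S \<F>)"
        unfolding eventually_filtermap using ev by eventually_elim (use RS(2) in blast)
      fix \<alpha> and \<epsilon> :: real assume a: "\<alpha> \<in> A" "\<epsilon> > 0"
      obtain Q where Q: "eventually Q \<F>"
        "\<forall>v w. Q v \<longrightarrow> Q w \<longrightarrow> v \<in> vsp Y \<and> w \<in> vsp Y \<and> p \<alpha> (S (v - w)) < \<epsilon>"
        using cau[OF a] by blast
      have "v \<in> vsp X \<and> w \<in> vsp X \<and> p \<alpha> (v - w) < \<epsilon>"
        if vw: "\<exists>y. Q y \<and> v = S y" "\<exists>y. Q y \<and> w = S y" for v w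
      proof -
        obtain y where y: "Q y" "v = S y" using vw(1) by blast
        obtain z where z: "Q z" "w = S z" using vw(2) by blast
        have yz: "y \<in> vsp Y" "z \<in> vsp Y" "p \<alpha> (S (y - z)) < \<epsilon>" using Q(2) y(1) z(1) by auto
        then show ?thesis using Sdiff[OF yz(1,2)] RS(2) y z by simp
      qed
      moreover have "eventually (\<lambda>v. \<exists>y. Q y \<and> v = S y) (filtermap S \<F>)"
        unfolding eventually_filtermap using Q(1) by eventually_elim blast
      ultimately show "\<exists>Q. eventually Q (filtermap S \<F>) \<and>
          (\<forall>v w. Q v \<longrightarrow> Q w \<longrightarrow> v \<in> vsp X \<and> w \<in> vsp X \<and> p \<alpha> (v - w) < \<epsilon>)" by blast
    qed
    then obtain l where l: "limitin (vtop X) (\<lambda>v. v) l (filtermap S \<F>)"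
      using complete unfolding complete_tvs_def by blast
    then have lX: "l \<in> vsp X" by (simp add: limitin_iff)
    show "\<exists>m\<in>vsp Y. \<forall>\<alpha>\<in>A. \<forall>\<epsilon>>0. eventually (\<lambda>v. v \<in> vsp Y \<and> p \<alpha> (S (v - m)) < \<epsilon>) \<F>"
    proof (intro bexI[of _ "R l"] ballI allI impI)
      fix \<alpha> and \<epsilon> :: real assume a: "\<alpha> \<in> A" "\<epsilon> > 0"
      have "eventually (\<lambda>v. S v \<in> vsp X \<and> p \<alpha> (S v - l) < \<epsilon>) \<F>"
        using l a unfolding limitin_iff eventually_filtermap by blast
      then show "eventually (\<lambda>v. v \<in> vsp Y \<and> p \<alpha> (S (v - R l)) < \<epsilon>) \<F>"
        using ev by eventually_elim (use RS(1)[OF lX] in \<open>simp add: Sdiff\<close>)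
    qed (use RS(1)[OF lX] in blast)
  qed
qed

end

text \<open>Two completions are compared through the closure of the graph of the partial map \<open>i1 v \<mapsto> i2 v\<close>,
  which is symmetric in the two completions.\<close>

locale two_completions =
  Y1: seminormed_space Y1 A1 p1 + Y2: seminormed_space Y2 A2 p2
  for Y1 :: "('k::real_or_complex, 'v::ab_group_add) tvs" and A1 :: "'a set" and p1
    and Y2 :: "('k, 'w::ab_group_add) tvs" and A2 :: "'b set" and p2 +
  fixes X :: "('k, 'u::ab_group_add) tvs" and i1 :: "'u \<Rightarrow> 'v" and i2 :: "'u \<Rightarrow> 'w"
  assumes sub: "\<And>v w. v \<in> vsp X \<Longrightarrow> w \<in> vsp X \<Longrightarrow> v + w \<in> vsp X"
    "\<And>v w. v \<in> vsp X \<Longrightarrow> w \<in> vsp X \<Longrightarrow> v - w \<in> vsp X" "\<And>c v. v \<in> vsp X \<Longrightarrow> scl X c v \<in> vsp X"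
    "0 \<in> vsp X"
    and c1: "is_completion X Y1 i1" and c2: "is_completion X Y2 i2"
begin

lemma swapped: "two_completions Y2 A2 p2 Y1 A1 p1 X i2 i1"
  by unfold_locales (use sub c1 c2 in auto)

definition graph :: "'v \<Rightarrow> 'w \<Rightarrow> bool" where
  "graph v w \<longleftrightarrow> v \<in> vsp Y1 \<and> w \<in> vsp Y2 \<and>
     (\<forall>\<alpha>\<in>A1. \<forall>\<beta>\<in>A2. \<forall>\<epsilon>>0. \<exists>x\<in>vsp X. p1 \<alpha> (i1 x - v) < \<epsilon> \<and> p2 \<beta> (i2 x - w) < \<epsilon>)"

lemma i_mem: "x \<in> vsp X \<Longrightarrow> i1 x \<in> vsp Y1" "x \<in> vsp X \<Longrightarrow> i2 x \<in> vsp Y2"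
proof -
  have h1: "homeomorphic_map (vtop X) (subtopology (vtop Y1) (i1 ` topspace (vtop X))) i1"
    and h2: "homeomorphic_map (vtop X) (subtopology (vtop Y2) (i2 ` topspace (vtop X))) i2"
    using c1 c2 by (auto simp: is_completion_def embedding_map_def)
  show "x \<in> vsp X \<Longrightarrow> i1 x \<in> vsp Y1" using homeomorphic_imp_continuous_map[OF h1]
    by (auto simp: continuous_map_in_subtopology continuous_map_def vsp_def)
  show "x \<in> vsp X \<Longrightarrow> i2 x \<in> vsp Y2" using homeomorphic_imp_continuous_map[OF h2]
    by (auto simp: continuous_map_in_subtopology continuous_map_def vsp_def)
qed

lemma i_diff:
  assumes "x \<in> vsp X" "y \<in> vsp X" shows "i1 (x - y) = i1 x - i1 y" "i2 (x - y) = i2 x - i2 y"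
proof -
  have "i1 ((x - y) + y) = i1 (x - y) + i1 y" "i2 ((x - y) + y) = i2 (x - y) + i2 y"
    using c1 c2 sub(2)[OF assms] assms unfolding is_completion_def linear_on_def by blast+
  then show "i1 (x - y) = i1 x - i1 y" "i2 (x - y) = i2 x - i2 y" by auto
qed

lemma i_zero: "i1 0 = 0" "i2 0 = 0"
  using i_diff[OF sub(4,4)] by simp_all

text \<open>An embedding is open onto its image, so a neighbourhood of zero in Y2, pulled back to X,
  contains the pullback of a ball of Y1. This is continuity of the partial map i1 x \<mapsto> i2 x
  at zero.\<close>

lemma comparison:
  assumes b: "\<beta> \<in> A2" and \<epsilon>: "\<epsilon> > 0"
  obtains \<alpha> r where "\<alpha> \<in> A1" "r > 0" "\<And>x. x \<in> vsp X \<Longrightarrow> p1 \<alpha> (i1 x) < r \<Longrightarrow> p2 \<beta> (i2 x) < \<epsilon>"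
proof -
  have h1: "homeomorphic_map (vtop X) (subtopology (vtop Y1) (i1 ` vsp X)) i1"
    and h2: "homeomorphic_map (vtop X) (subtopology (vtop Y2) (i2 ` vsp X)) i2"
    using c1 c2 by (auto simp: is_completion_def embedding_map_def vsp_def)
  have "continuous_map (vtop X) (vtop Y2) i2"
    using homeomorphic_imp_continuous_map[OF h2] by (simp add: continuous_map_in_subtopology)
  moreover have "openin (vtop Y2) {w \<in> vsp Y2. p2 \<beta> (w - 0) < \<epsilon>}" by (intro Y2.openin_ball b Y2.zero_mem)
  ultimately have "openin (vtop X) {x \<in> topspace (vtop X). i2 x \<in> {w \<in> vsp Y2. p2 \<beta> (w - 0) < \<epsilon>}}"
    (is "openin _ ?G") by (rule openin_continuous_map_preimage)
  then have "openin (subtopology (vtop Y1) (i1 ` vsp X)) (i1 ` ?G)"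
    using homeomorphic_imp_open_map[OF h1] by (simp add: open_map_def)
  then obtain U where U: "openin (vtop Y1) U" "i1 ` ?G = U \<inter> i1 ` vsp X"
    unfolding openin_subtopology by blast
  have "0 \<in> ?G" using sub(4) \<epsilon> i_zero(2) Y2.p_zero[OF b] by (simp add: vsp_def[symmetric])
  then have "i1 0 \<in> U" using U(2) by blast
  then have "0 \<in> U" by (simp only: i_zero)
  then obtain \<alpha> r where a: "\<alpha> \<in> A1" "r > 0" "\<forall>y\<in>vsp Y1. p1 \<alpha> (y - 0) < r \<longrightarrow> y \<in> U"
    using U(1) unfolding Y1.openin_iff by blast
  show ?thesis
  proof (rule that[OF a(1,2)])
    fix x assume x: "x \<in> vsp X" "p1 \<alpha> (i1 x) < r"
    then have "i1 x \<in> U" using a(3) i_mem(1) by simp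
    then have "i1 x \<in> i1 ` ?G" using U(2) x(1) by blast
    then obtain x' where x': "x' \<in> ?G" "i1 x = i1 x'" by blast
    have "inj_on i1 (vsp X)" using homeomorphic_imp_injective_map[OF h1] by (simp add: vsp_def)
    then have "x = x'" using x'(1,2) x(1) by (auto simp: vsp_def inj_on_def)
    then show "p2 \<beta> (i2 x) < \<epsilon>" using x'(1) by simp
  qed
qed

text \<open>Uniform continuity of the graph as a relation. It yields single-valuedness, with v = v',
  as well as continuity of the comparison map. Two approximants and one comparison account for the
  thirds.\<close>

lemma graph_continuous:
  assumes b: "\<beta> \<in> A2" and \<epsilon>: "\<epsilon> > 0"
  obtains \<alpha> r where "\<alpha> \<in> A1" "r > 0"
    "\<And>v w v' w'. graph v w \<Longrightarrow> graph v' w' \<Longrightarrow> p1 \<alpha> (v - v') < r \<Longrightarrow> p2 \<beta> (w - w') < \<epsilon>"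
proof -
  have "\<epsilon> / 3 > 0" using \<epsilon> by simp
  then obtain \<alpha> r where a: "\<alpha> \<in> A1" "r > 0"
    "\<And>x. x \<in> vsp X \<Longrightarrow> p1 \<alpha> (i1 x) < r \<Longrightarrow> p2 \<beta> (i2 x) < \<epsilon> / 3" using comparison[OF b] by metis
  show ?thesis
  proof (rule that[OF a(1), of "r / 3"])
    fix v w v' w' assume g: "graph v w" "graph v' w'" and d: "p1 \<alpha> (v - v') < r / 3"
    have m: "v \<in> vsp Y1" "w \<in> vsp Y2" "v' \<in> vsp Y1" "w' \<in> vsp Y2" using g by (auto simp: graph_def)
    define \<delta> where "\<delta> = min (r / 3) (\<epsilon> / 3)"
    have \<delta>: "\<delta> > 0" "\<delta> \<le> r / 3" "\<delta> \<le> \<epsilon> / 3" using a(2) \<epsilon> by (auto simp: \<delta>_def)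
    obtain x where x: "x \<in> vsp X" "p1 \<alpha> (i1 x - v) < \<delta>" "p2 \<beta> (i2 x - w) < \<delta>"
      using g(1) a(1) b \<delta>(1) unfolding graph_def by blast
    obtain x' where x': "x' \<in> vsp X" "p1 \<alpha> (i1 x' - v') < \<delta>" "p2 \<beta> (i2 x' - w') < \<delta>"
      using g(2) a(1) b \<delta>(1) unfolding graph_def by blast
    note im = i_mem[OF x(1)] i_mem[OF x'(1)]
    have "p1 \<alpha> (i1 x - i1 x') \<le> p1 \<alpha> (i1 x - v) + p1 \<alpha> (v - i1 x')"
      by (intro Y1.p_triangle a(1) im m)
    also have "p1 \<alpha> (v - i1 x') \<le> p1 \<alpha> (v - v') + p1 \<alpha> (v' - i1 x')" by (intro Y1.p_triangle a(1) im m)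
    also have "p1 \<alpha> (v' - i1 x') = p1 \<alpha> (i1 x' - v')" by (intro Y1.p_commute a(1) im m)
    finally have "p1 \<alpha> (i1 (x - x')) < r" using x x' d \<delta> i_diff[OF x(1) x'(1)] by simp
    then have s: "p2 \<beta> (i2 x - i2 x') < \<epsilon> / 3" using a(3)[OF sub(2)[OF x(1) x'(1)]] i_diff[OF x(1) x'(1)] by simp
    have "p2 \<beta> (w - w') \<le> p2 \<beta> (w - i2 x) + p2 \<beta> (i2 x - w')" by (intro Y2.p_triangle b im m)
    also have "p2 \<beta> (i2 x - w') \<le> p2 \<beta> (i2 x - i2 x') + p2 \<beta> (i2 x' - w')" by (intro Y2.p_triangle b im m)
    also have "p2 \<beta> (w - i2 x) = p2 \<beta> (i2 x - w)" by (intro Y2.p_commute b im m)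
    finally show "p2 \<beta> (w - w') < \<epsilon>" using x(3) x'(3) s \<delta>(3) by simp
  qed (use a(2) in simp)
qed

lemma graph_functional:
  assumes g: "graph v w" "graph v w'" shows "w = w'"
proof -
  have m: "v \<in> vsp Y1" "w \<in> vsp Y2" "w' \<in> vsp Y2" using g by (auto simp: graph_def)
  have "p2 \<beta> (w - w') = 0" if b: "\<beta> \<in> A2" for \<beta>
  proof -
    have "p2 \<beta> (w - w') \<le> \<epsilon>" if \<epsilon>: "\<epsilon> > 0" for \<epsilon>
    proof -
      obtain \<alpha> r where a: "\<alpha> \<in> A1" "r > 0"
        "\<And>v w v' w'. graph v w \<Longrightarrow> graph v' w' \<Longrightarrow> p1 \<alpha> (v - v') < r \<Longrightarrow> p2 \<beta> (w - w') < \<epsilon>"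
        using graph_continuous[OF b \<epsilon>] by metis
      have "p1 \<alpha> (v - v) < r" using a(1,2) Y1.p_zero by simp
      then show ?thesis using a(3)[OF g] by simp
    qed
    then have "p2 \<beta> (w - w') \<le> 0" by (rule field_le_epsilon[of _ 0, simplified])
    then show ?thesis using Y2.p_nonneg[OF b Y2.diff_mem[OF m(2,3)]] by simp
  qed
  moreover have "lcHs Y2" using c2 by (simp add: is_completion_def)
  ultimately have "w - w' = 0" using Y2.diff_mem[OF m(2,3)] unfolding Y2.lcHs_iff by blast
  then show ?thesis by simp
qed

text \<open>Points of X whose images in Y1 are close to v have images in Y2 close to one another, by
  \<open>comparison\<close>. Density makes these sets of images nonempty, and completeness of Y2
  gives v a partner.\<close>

lemma graph_total:
  assumes v: "v \<in> vsp Y1" shows "\<exists>w. graph v w"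
proof -
  define I where "I = {i :: 'a \<times> real. fst i \<in> A1 \<and> snd i > 0}"
  define G where "G i = i2 ` {x \<in> vsp X. p1 (fst i) (i1 x - v) < snd i}" for i
  have complete: "complete_tvs Y2" using c2 by (simp add: is_completion_def)
  obtain \<alpha>0 where \<alpha>0: "\<alpha>0 \<in> A1" using Y1.index_nonempty by blast
  then have "(\<alpha>0, 1) \<in> I" by (simp add: I_def)
  then have ne: "I \<noteq> {}" by blast
  have G: "G i \<noteq> {} \<and> G i \<subseteq> vsp Y2" if i: "i \<in> I" for i
  proof -
    have "v \<in> vtop Y1 closure_of (i1 ` vsp X)" using c1 v by (simp add: is_completion_def)
    then obtain y where "y \<in> i1 ` vsp X" "p1 (fst i) (y - v) < snd i"
      using i unfolding Y1.closure_iff I_def by blast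
    then show ?thesis using i_mem(2) by (auto simp: G_def)
  qed
  have dir: "\<exists>m\<in>I. G m \<subseteq> G i \<inter> G k" if ik: "i \<in> I" "k \<in> I" for i k
  proof -
    have a: "fst i \<in> A1" "fst k \<in> A1" "snd i > 0" "snd k > 0" using ik by (auto simp: I_def)
    obtain \<gamma> C where g: "\<gamma> \<in> A1" "C > 0" "\<forall>v\<in>vsp Y1. p1 (fst i) v \<le> C * p1 \<gamma> v \<and> p1 (fst k) v \<le> C * p1 \<gamma> v"
      using Y1.directed[OF a(1,2)] by blast
    define m where "m = (\<gamma>, min (snd i) (snd k) / C)"
    have mI: "m \<in> I" using a g by (simp add: m_def I_def)
    have "p1 (fst i) (i1 x - v) < snd i \<and> p1 (fst k) (i1 x - v) < snd k"
      if x: "x \<in> vsp X" "p1 \<gamma> (i1 x - v) < min (snd i) (snd k) / C" for x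
    proof -
      have "i1 x - v \<in> vsp Y1" by (intro Y1.diff_mem i_mem x v)
      moreover have "C * p1 \<gamma> (i1 x - v) < min (snd i) (snd k)" using x(2) g(2) by (simp add: field_simps)
      ultimately show ?thesis using g(3) by fastforce
    qed
    then have "G m \<subseteq> G i \<inter> G k" by (auto simp: G_def m_def)
    then show ?thesis using mI by blast
  qed
  have small: "\<exists>i\<in>I. \<forall>w\<in>G i. \<forall>w'\<in>G i. p2 \<beta> (w - w') < \<epsilon>" if b: "\<beta> \<in> A2" "\<epsilon> > 0" for \<beta> \<epsilon>
  proof -
    obtain \<alpha> r where a: "\<alpha> \<in> A1" "r > 0" "\<And>x. x \<in> vsp X \<Longrightarrow> p1 \<alpha> (i1 x) < r \<Longrightarrow> p2 \<beta> (i2 x) < \<epsilon>"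
      using comparison[OF b] by metis
    have "p2 \<beta> (i2 x - i2 y) < \<epsilon>"
      if xy: "x \<in> vsp X" "p1 \<alpha> (i1 x - v) < r / 2" "y \<in> vsp X" "p1 \<alpha> (i1 y - v) < r / 2" for x y
    proof -
      have "p1 \<alpha> (i1 x - i1 y) \<le> p1 \<alpha> (i1 x - v) + p1 \<alpha> (v - i1 y)"
        by (intro Y1.p_triangle a(1) i_mem xy v)
      also have "p1 \<alpha> (v - i1 y) = p1 \<alpha> (i1 y - v)" by (intro Y1.p_commute a(1) i_mem xy v)
      finally have "p1 \<alpha> (i1 (x - y)) < r" using xy i_diff by simp
      then show ?thesis using a(3)[OF sub(2)[OF xy(1,3)]] i_diff[OF xy(1,3)] by simp
    qed
    then have "\<forall>w\<in>G (\<alpha>, r / 2). \<forall>w'\<in>G (\<alpha>, r / 2). p2 \<beta> (w - w') < \<epsilon>" by (auto simp: G_def)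
    moreover have "(\<alpha>, r / 2) \<in> I" using a by (simp add: I_def)
    ultimately show ?thesis by blast
  qed
  obtain w where w: "w \<in> vsp Y2"
    "\<And>i \<beta> \<epsilon>. i \<in> I \<Longrightarrow> \<beta> \<in> A2 \<Longrightarrow> \<epsilon> > 0 \<Longrightarrow> \<exists>y\<in>G i. p2 \<beta> (y - w) < \<epsilon>"
    using Y2.complete_limit[OF complete ne G dir small] by blast
  have "graph v w" unfolding graph_def
  proof (intro conjI ballI allI impI v w(1))
    fix \<alpha> \<beta> and \<epsilon> :: real assume a: "\<alpha> \<in> A1" "\<beta> \<in> A2" "\<epsilon> > 0"
    then have "(\<alpha>, \<epsilon>) \<in> I" by (simp add: I_def)
    then obtain y where "y \<in> G (\<alpha>, \<epsilon>)" "p2 \<beta> (y - w) < \<epsilon>" using w(2) a by blast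
    then show "\<exists>x\<in>vsp X. p1 \<alpha> (i1 x - v) < \<epsilon> \<and> p2 \<beta> (i2 x - w) < \<epsilon>" by (auto simp: G_def)
  qed
  then show ?thesis ..
qed

lemma graph_add:
  assumes g: "graph v w" "graph v' w'" shows "graph (v + v') (w + w')"
  unfolding graph_def
proof (intro conjI ballI allI impI)
  have m: "v \<in> vsp Y1" "w \<in> vsp Y2" "v' \<in> vsp Y1" "w' \<in> vsp Y2" using g by (auto simp: graph_def)
  then show "v + v' \<in> vsp Y1" "w + w' \<in> vsp Y2" by (auto intro: Y1.add_mem Y2.add_mem)
  fix \<alpha> \<beta> and \<epsilon> :: real assume a: "\<alpha> \<in> A1" "\<beta> \<in> A2" "\<epsilon> > 0"
  then have e: "\<epsilon> / 2 > 0" by simp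
  obtain x where x: "x \<in> vsp X" "p1 \<alpha> (i1 x - v) < \<epsilon> / 2" "p2 \<beta> (i2 x - w) < \<epsilon> / 2"
    using g(1) a e unfolding graph_def by blast
  obtain x' where x': "x' \<in> vsp X" "p1 \<alpha> (i1 x' - v') < \<epsilon> / 2" "p2 \<beta> (i2 x' - w') < \<epsilon> / 2"
    using g(2) a e unfolding graph_def by blast
  have i: "i1 (x + x') = i1 x + i1 x'" "i2 (x + x') = i2 x + i2 x'"
    using c1 c2 x(1) x'(1) unfolding is_completion_def linear_on_def by blast+
  have "p1 \<alpha> ((i1 x - v) + (i1 x' - v')) \<le> p1 \<alpha> (i1 x - v) + p1 \<alpha> (i1 x' - v')"
    by (intro Y1.p_add a Y1.diff_mem i_mem x x' m)
  moreover have "p2 \<beta> ((i2 x - w) + (i2 x' - w')) \<le> p2 \<beta> (i2 x - w) + p2 \<beta> (i2 x' - w')"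
    by (intro Y2.p_add a Y2.diff_mem i_mem x x' m)
  moreover have "i1 (x + x') - (v + v') = (i1 x - v) + (i1 x' - v')"
    "i2 (x + x') - (w + w') = (i2 x - w) + (i2 x' - w')" by (simp_all add: i)
  ultimately show "\<exists>z\<in>vsp X. p1 \<alpha> (i1 z - (v + v')) < \<epsilon> \<and> p2 \<beta> (i2 z - (w + w')) < \<epsilon>"
    using x x' by (intro bexI[of _ "x + x'"] conjI sub(1)) (simp_all only: | linarith)+
qed

lemma graph_scl:
  assumes g: "graph v w" shows "graph (scl Y1 c v) (scl Y2 c w)"
  unfolding graph_def
proof (intro conjI ballI allI impI)
  have m: "v \<in> vsp Y1" "w \<in> vsp Y2" using g by (auto simp: graph_def)
  then show "scl Y1 c v \<in> vsp Y1" "scl Y2 c w \<in> vsp Y2" by (auto intro: Y1.scl_mem Y2.scl_mem)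
  fix \<alpha> \<beta> and \<epsilon> :: real assume a: "\<alpha> \<in> A1" "\<beta> \<in> A2" "\<epsilon> > 0"
  have pos: "norm c + 1 > 0" by (simp add: add_nonneg_pos)
  then have e: "\<epsilon> / (norm c + 1) > 0" using a by simp
  obtain x where x: "x \<in> vsp X" "p1 \<alpha> (i1 x - v) < \<epsilon> / (norm c + 1)" "p2 \<beta> (i2 x - w) < \<epsilon> / (norm c + 1)"
    using g a(1,2) e unfolding graph_def by blast
  have i: "i1 (scl X c x) = scl Y1 c (i1 x)" "i2 (scl X c x) = scl Y2 c (i2 x)"
    using c1 c2 x(1) unfolding is_completion_def linear_on_def by blast+
  have le: "norm c * t < \<epsilon>" if "0 \<le> t" "t < \<epsilon> / (norm c + 1)" for t
  proof -
    have "norm c * t \<le> (norm c + 1) * t" using that(1) by (intro mult_right_mono) auto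
    also have "\<dots> < \<epsilon>" using that(2) pos by (simp add: field_simps)
    finally show ?thesis .
  qed
  have d: "i1 x - v \<in> vsp Y1" "i2 x - w \<in> vsp Y2" by (intro Y1.diff_mem Y2.diff_mem i_mem x m)+
  have "p1 \<alpha> (i1 (scl X c x) - scl Y1 c v) < \<epsilon>"
    using le[OF Y1.p_nonneg[OF a(1) d(1)] x(2)] Y1.p_scl[OF a(1) d(1), of c]
    by (simp add: i Y1.V.scale_right_diff_distrib)
  moreover have "p2 \<beta> (i2 (scl X c x) - scl Y2 c w) < \<epsilon>"
    using le[OF Y2.p_nonneg[OF a(2) d(2)] x(3)] Y2.p_scl[OF a(2) d(2), of c]
    by (simp add: i Y2.V.scale_right_diff_distrib)
  ultimately show "\<exists>z\<in>vsp X. p1 \<alpha> (i1 z - scl Y1 c v) < \<epsilon> \<and> p2 \<beta> (i2 z - scl Y2 c w) < \<epsilon>"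
    using sub(3)[OF x(1)] by blast
qed

definition comparison_map :: "'v \<Rightarrow> 'w" where
  "comparison_map v = (THE w. graph v w)"

lemma comparison_map_eq: "graph v w \<Longrightarrow> comparison_map v = w"
  unfolding comparison_map_def by (rule the_equality) (auto intro: graph_functional)

lemma graph_comparison_map: "v \<in> vsp Y1 \<Longrightarrow> graph v (comparison_map v)"
  using graph_total comparison_map_eq by metis

lemma comparison_map_continuous: "continuous_map (vtop Y1) (vtop Y2) comparison_map"
  unfolding Y2.continuous_map_into_iff
proof (intro conjI ballI allI impI)
  show "comparison_map \<in> topspace (vtop Y1) \<rightarrow> vsp Y2"
    using graph_comparison_map by (auto simp: graph_def vsp_def)
  fix v \<beta> and \<epsilon> :: real assume v: "v \<in> topspace (vtop Y1)" and b: "\<beta> \<in> A2" and \<epsilon>: "\<epsilon> > 0"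
  then have vY: "v \<in> vsp Y1" by (simp add: vsp_def)
  obtain \<alpha> r where a: "\<alpha> \<in> A1" "r > 0"
    "\<And>v w v' w'. graph v w \<Longrightarrow> graph v' w' \<Longrightarrow> p1 \<alpha> (v - v') < r \<Longrightarrow> p2 \<beta> (w - w') < \<epsilon>"
    using graph_continuous[OF b \<epsilon>] by metis
  have "p2 \<beta> (comparison_map s - comparison_map v) < \<epsilon>" if "s \<in> vsp Y1" "p1 \<alpha> (s - v) < r" for s
    by (rule a(3)[OF graph_comparison_map[OF that(1)] graph_comparison_map[OF vY] that(2)])
  then show "\<exists>U. openin (vtop Y1) U \<and> v \<in> U \<and> (\<forall>s\<in>U. p2 \<beta> (comparison_map s - comparison_map v) < \<epsilon>)"
    using Y1.openin_ball[OF a(1) vY, of r] vY a(2) Y1.p_zero[OF a(1)]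
    by (intro exI[of _ "{s \<in> vsp Y1. p1 \<alpha> (s - v) < r}"]) auto
qed

end

text \<open>Exchanging the completions reverses the graph, so the comparison map of the exchanged
  pair is the inverse, and the same lemma proves it continuous.\<close>

theorem completion_unique:
  fixes X :: "('k::real_or_complex, 'u::ab_group_add) tvs" and Y1 :: "('k, 'v::ab_group_add) tvs"
    and Y2 :: "('k, 'w::ab_group_add) tvs"
  assumes sub: "\<And>v w. v \<in> vsp X \<Longrightarrow> w \<in> vsp X \<Longrightarrow> v + w \<in> vsp X"
    "\<And>v w. v \<in> vsp X \<Longrightarrow> w \<in> vsp X \<Longrightarrow> v - w \<in> vsp X" "\<And>c v. v \<in> vsp X \<Longrightarrow> scl X c v \<in> vsp X"
    "0 \<in> vsp X"
    and c1: "is_completion X Y1 i1" and c2: "is_completion X Y2 i2"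
  shows "Y1 \<cong>\<^sub>t Y2"
proof -
  have l: "lcHs Y1" "lcHs Y2" using c1 c2 by (simp_all add: is_completion_def)
  obtain A1 :: "('v \<Rightarrow> real) set set" and p1 where f1: "fundamental_seminorms Y1 A1 p1"
    using lcHs_fundamental_seminorms[OF l(1)] by blast
  obtain A2 :: "('w \<Rightarrow> real) set set" and p2 where f2: "fundamental_seminorms Y2 A2 p2"
    using lcHs_fundamental_seminorms[OF l(2)] by blast
  interpret C: two_completions Y1 A1 p1 Y2 A2 p2 X i1 i2
    by (intro two_completions.intro two_completions_axioms.intro lcHs_seminormed_space l f1 f2 assms)
  interpret D: two_completions Y2 A2 p2 Y1 A1 p1 X i2 i1 by (rule C.swapped)
  have flip: "D.graph w v \<longleftrightarrow> C.graph v w" for v w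
    unfolding C.graph_def D.graph_def by blast
  have mem: "C.comparison_map v \<in> vsp Y2" if "v \<in> vsp Y1" for v
    using C.graph_comparison_map[OF that] by (simp add: C.graph_def)
  have mem': "D.comparison_map w \<in> vsp Y1" if "w \<in> vsp Y2" for w
    using D.graph_comparison_map[OF that] by (simp add: D.graph_def)
  have inv1: "D.comparison_map (C.comparison_map v) = v" if "v \<in> vsp Y1" for v
    by (intro D.comparison_map_eq) (simp add: flip C.graph_comparison_map that)
  have inv2: "C.comparison_map (D.comparison_map w) = w" if "w \<in> vsp Y2" for w
    by (intro C.comparison_map_eq) (simp add: flip[symmetric] D.graph_comparison_map that)
  have "homeomorphic_maps (vtop Y1) (vtop Y2) C.comparison_map D.comparison_map"
    unfolding homeomorphic_maps_def using C.comparison_map_continuous D.comparison_map_continuous inv1 inv2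
    by (simp add: vsp_def)
  then have "homeomorphic_map (vtop Y1) (vtop Y2) C.comparison_map" unfolding homeomorphic_map_maps by blast
  moreover have "linear_on Y1 Y2 C.comparison_map" unfolding linear_on_def
    by (auto intro!: C.comparison_map_eq C.graph_add C.graph_scl C.graph_comparison_map)
  ultimately show ?thesis unfolding tvs_isomorphic_def by blast
qed

lemma embedding_map_inclusion: "embedding_map (subtopology T S) T (\<lambda>x. x)"
proof -
  have "subtopology T ((\<lambda>x. x) ` topspace (subtopology T S)) = subtopology T S"
    by (simp add: subtopology_restrict)
  then show ?thesis unfolding embedding_map_def using homeomorphic_map_id[of "subtopology T S"] by (simp add: id_def)
qed

section \<open>The tensor product as a dense subspace of the \<epsilon>-product\<close>

context eps_setting
begin

lemma tensor_add:
  assumes "u \<in> tensor_operators FF E" "w \<in> tensor_operators FF E"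
  shows "u + w \<in> tensor_operators FF E"
proof -
  obtain N :: nat and f e where u: "u = (\<lambda>y. if y \<in> dual FF then \<Sum>n<N. scl E (y (f n)) (e n) else 0)"
    "\<forall>n<N. f n \<in> vsp FF" "\<forall>n<N. e n \<in> vsp E" using assms(1) unfolding tensor_operators_def by auto
  obtain M :: nat and g d where w: "w = (\<lambda>y. if y \<in> dual FF then \<Sum>n<M. scl E (y (g n)) (d n) else 0)"
    "\<forall>n<M. g n \<in> vsp FF" "\<forall>n<M. d n \<in> vsp E" using assms(2) unfolding tensor_operators_def by auto
  \<comment> \<open>The disjoint sum of the index sets concatenates two tensors without arithmetic
    on indices.\<close>
  let ?I = "{..<N} <+> {..<M}"
  let ?f = "\<lambda>i. case i of Inl n \<Rightarrow> f n | Inr n \<Rightarrow> g n"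
  let ?e = "\<lambda>i. case i of Inl n \<Rightarrow> e n | Inr n \<Rightarrow> d n"
  have "(\<lambda>y. if y \<in> dual FF then \<Sum>i\<in>?I. scl E (y (?f i)) (?e i) else 0) \<in> tensor_operators FF E"
    by (rule tensor_operators_sum) (use u(2,3) w(2,3) in \<open>auto split: sum.split\<close>)
  moreover have "(\<lambda>y. if y \<in> dual FF then \<Sum>i\<in>?I. scl E (y (?f i)) (?e i) else 0) = u + w"
    by (auto simp: u(1) w(1) sum.Plus fun_eq_iff)
  ultimately show ?thesis by simp
qed

lemma tensor_scl:
  assumes "u \<in> tensor_operators FF E"
  shows "(\<lambda>y. scl E c (u y)) \<in> tensor_operators FF E"
proof -
  obtain N :: nat and f e where u: "u = (\<lambda>y. if y \<in> dual FF then \<Sum>n<N. scl E (y (f n)) (e n) else 0)"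
    "\<forall>n<N. f n \<in> vsp FF" "\<forall>n<N. e n \<in> vsp E" using assms(1) unfolding tensor_operators_def by auto
  have "(\<lambda>y. if y \<in> dual FF then \<Sum>n<N. scl E (y (f n)) (scl E c (e n)) else 0) \<in> tensor_operators FF E"
    using u by (intro tensor_operators_sum) (auto intro: E.scl_mem)
  moreover have "(\<lambda>y. if y \<in> dual FF then \<Sum>n<N. scl E (y (f n)) (scl E c (e n)) else 0) = (\<lambda>y. scl E c (u y))"
    by (auto simp: u(1) E.V.scale_sum_right mult.commute)
  ultimately show ?thesis by simp
qed

lemma tensor_zero: "0 \<in> tensor_operators FF E"
  using tensor_operators_sum[of "{}" _ FF _ E] by (simp add: zero_fun_def cong: if_cong)

lemma vsp_tensor: "vsp (FF \<otimes>\<^sub>\<epsilon> E) = cont_lin DK E \<inter> tensor_operators FF E"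
  using vsp_eps_product[of FF E] by (simp add: vsp_def eps_tensor_def subspace_tvs_def)

lemma scl_tensor: "scl (FF \<otimes>\<^sub>\<epsilon> E) = (\<lambda>c u y. scl E c (u y))"
  by (simp add: eps_tensor_def subspace_tvs_def)

lemma tensor_subspace:
  "v \<in> vsp (FF \<otimes>\<^sub>\<epsilon> E) \<Longrightarrow> w \<in> vsp (FF \<otimes>\<^sub>\<epsilon> E) \<Longrightarrow> v + w \<in> vsp (FF \<otimes>\<^sub>\<epsilon> E)"
  "v \<in> vsp (FF \<otimes>\<^sub>\<epsilon> E) \<Longrightarrow> w \<in> vsp (FF \<otimes>\<^sub>\<epsilon> E) \<Longrightarrow> v - w \<in> vsp (FF \<otimes>\<^sub>\<epsilon> E)"
  "v \<in> vsp (FF \<otimes>\<^sub>\<epsilon> E) \<Longrightarrow> scl (FF \<otimes>\<^sub>\<epsilon> E) c v \<in> vsp (FF \<otimes>\<^sub>\<epsilon> E)"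
  "0 \<in> vsp (FF \<otimes>\<^sub>\<epsilon> E)"
proof -
  show add: "v + w \<in> vsp (FF \<otimes>\<^sub>\<epsilon> E)" if "v \<in> vsp (FF \<otimes>\<^sub>\<epsilon> E)" "w \<in> vsp (FF \<otimes>\<^sub>\<epsilon> E)" for v w
    using that unfolding vsp_tensor by (auto intro: E.cont_lin_add tensor_add)
  show scl: "scl (FF \<otimes>\<^sub>\<epsilon> E) c v \<in> vsp (FF \<otimes>\<^sub>\<epsilon> E)" if "v \<in> vsp (FF \<otimes>\<^sub>\<epsilon> E)" for c v
    using that unfolding vsp_tensor scl_tensor by (auto intro: E.cont_lin_scl tensor_scl)
  show "v - w \<in> vsp (FF \<otimes>\<^sub>\<epsilon> E)" if "v \<in> vsp (FF \<otimes>\<^sub>\<epsilon> E)" "w \<in> vsp (FF \<otimes>\<^sub>\<epsilon> E)"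
  proof -
    have eq: "v - w = v + scl (FF \<otimes>\<^sub>\<epsilon> E) (- 1) w" by (simp add: scl_tensor fun_eq_iff)
    show ?thesis unfolding eq by (rule add[OF that(1) scl[OF that(2)]])
  qed
  show "0 \<in> vsp (FF \<otimes>\<^sub>\<epsilon> E)" unfolding vsp_tensor using E.cont_lin_zero tensor_zero by blast
qed

text \<open>The tensors are dense, and the \<epsilon>-product is Hausdorff and complete because it
  is isomorphic to the weighted space. Hence the \<epsilon>-product itself serves as the completion,
  with the inclusion as embedding.\<close>

theorem eps_product_completion:
  assumes complete: "complete_tvs E"
  shows "is_completion (FF \<otimes>\<^sub>\<epsilon> E) (FF \<epsilon>\<^sub>t E) (\<lambda>u. u)"
proof -
  obtain R where R: "linear_on W (FF \<epsilon>\<^sub>t E) R" "homeomorphic_maps (vtop W) (vtop (FF \<epsilon>\<^sub>t E)) R eval_delta"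
    using eps_isomorphism[OF complete] by blast
  have vs: "vector_space (scl (FF \<epsilon>\<^sub>t E))" unfolding scl_eps_product
    by unfold_locales (simp_all add: fun_eq_iff E.V.scale_right_distrib E.V.scale_left_distrib)
  have "lcHs (FF \<epsilon>\<^sub>t E)" "complete_tvs (FF \<epsilon>\<^sub>t E)"
    using W.transfer_seminormed_space(2,3)[OF R vs] lcHs_W[OF lcHs_E] complete_W[OF complete] by auto
  moreover have "linear_on (FF \<otimes>\<^sub>\<epsilon> E) (FF \<epsilon>\<^sub>t E) (\<lambda>u. u)"
    by (simp add: linear_on_def scl_tensor)
  moreover have "embedding_map (vtop (FF \<otimes>\<^sub>\<epsilon> E)) (vtop (FF \<epsilon>\<^sub>t E)) (\<lambda>u. u)"
    by (simp add: eps_tensor_def subspace_tvs_def embedding_map_inclusion)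
  moreover have "vtop (FF \<epsilon>\<^sub>t E) closure_of ((\<lambda>u. u) ` vsp (FF \<otimes>\<^sub>\<epsilon> E)) = vsp (FF \<epsilon>\<^sub>t E)"
    by (simp add: vsp_tensor tensor_operators_dense)
  ultimately show ?thesis by (simp add: is_completion_def)
qed

end

text \<open>Completions are determined only up to isomorphism and may live on different carrier
  types. The completed tensor product in (c) is therefore rendered by an existence claim together
  with a comparison of the \<epsilon>-product with an arbitrary completion on a type 'y.\<close>

theorem proposition5p1:
  fixes E :: "('k::real_or_complex, 'e::ab_group_add) tvs"
    and A :: "'a set" and p :: "'a \<Rightarrow> 'e \<Rightarrow> real"
    and J :: "'j set" and \<nu> :: "'j \<Rightarrow> 'x::t2_space \<Rightarrow> real"
  assumes "lcHs E" and "vsp E \<noteq> {0}"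
    and "fundamental_seminorms E A p"
    and "locally_compact_space (euclidean :: 'x topology)"
    and "weight_family J \<nu>"
    and "locally_bounded_weights J \<nu>"
    and "locally_bounded_away_from_zero J \<nu>"
  shows
    "(function_tensor (Cc (scalars :: ('k, 'k) tvs)) E \<subseteq> vsp (CV0 J \<nu> E A p) \<and>
      vtop (CV0 J \<nu> E A p) closure_of function_tensor (Cc (scalars :: ('k, 'k) tvs)) E
        = vsp (CV0 J \<nu> E A p))
     \<and>
     (\<forall>f \<in> Cc E. \<forall>V. open V \<and> supp f \<subseteq> V \<longrightarrow>
        (\<forall>\<epsilon>>0. \<forall>j\<in>J. \<forall>\<alpha>\<in>A. \<exists>g \<in> function_tensor (Cc (scalars :: ('k, 'k) tvs)) E.
           supp g \<subseteq> V \<and> wsup UNIV (\<nu> j) (p \<alpha>) (f - g) \<le> ennreal \<epsilon>))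
     \<and>
     (complete_tvs E \<longrightarrow>
        CV0 J \<nu> E A p \<cong>\<^sub>t CV0_scalar J \<nu> \<epsilon>\<^sub>t E \<and>
        (\<exists>(Y :: ('k, (('x \<Rightarrow> 'k) \<Rightarrow> 'k) \<Rightarrow> 'e) tvs) i.
           is_completion (CV0_scalar J \<nu> \<otimes>\<^sub>\<epsilon> E) Y i) \<and>
        (\<forall>(Y :: ('k, 'y::ab_group_add) tvs) i.
           is_completion (CV0_scalar J \<nu> \<otimes>\<^sub>\<epsilon> E) Y i \<longrightarrow> CV0_scalar J \<nu> \<epsilon>\<^sub>t E \<cong>\<^sub>t Y))
     \<and>
     approximation_property (CV0_scalar J \<nu> :: ('k, 'x \<Rightarrow> 'k) tvs)"
proof -
  have w: "weights J \<nu>" using assms(4-7) by (rule weights.intro)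
  interpret eps_setting J \<nu> E A p
    using w lcHs_seminormed_space[OF assms(1,3)] scalars_seminormed_space assms(1)
    by (intro eps_setting.intro weighted_space.intro eps_setting_axioms.intro)
  have c: "CV0 J \<nu> E A p \<cong>\<^sub>t FF \<epsilon>\<^sub>t E \<and>
      (\<exists>(Y :: ('k, (('x \<Rightarrow> 'k) \<Rightarrow> 'k) \<Rightarrow> 'e) tvs) i. is_completion (FF \<otimes>\<^sub>\<epsilon> E) Y i) \<and>
      (\<forall>(Y :: ('k, 'y::ab_group_add) tvs) i. is_completion (FF \<otimes>\<^sub>\<epsilon> E) Y i \<longrightarrow> FF \<epsilon>\<^sub>t E \<cong>\<^sub>t Y)"
    if complete: "complete_tvs E"
  proof (intro conjI allI impI)
    obtain R where "linear_on W (FF \<epsilon>\<^sub>t E) R" "homeomorphic_maps (vtop W) (vtop (FF \<epsilon>\<^sub>t E)) R eval_delta"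
      using eps_isomorphism[OF complete] by blast
    then show "W \<cong>\<^sub>t FF \<epsilon>\<^sub>t E" unfolding tvs_isomorphic_def homeomorphic_map_maps by blast
    show "\<exists>(Y :: ('k, (('x \<Rightarrow> 'k) \<Rightarrow> 'k) \<Rightarrow> 'e) tvs) i. is_completion (FF \<otimes>\<^sub>\<epsilon> E) Y i"
      using eps_product_completion[OF complete] by blast
    fix Y :: "('k, 'y) tvs" and i assume Y: "is_completion (FF \<otimes>\<^sub>\<epsilon> E) Y i"
    show "FF \<epsilon>\<^sub>t E \<cong>\<^sub>t Y"
      by (rule completion_unique[OF _ _ _ _ eps_product_completion[OF complete] Y]) (simp_all add: tensor_subspace)
  qed
  show ?thesis unfolding CV0_scalar_def
    using function_tensor_subset function_tensor_dense Cc_approximation c approximation_property_FF by blast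
qed

end
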